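(* Let $\mu\in\mathbb R$ and let $(X_n)$ be a sequence of iid random variables drawn from some distribution in $\mathrm{DAN}(\mu)$. Fix any $R,\kappa>0$, let $Z_{R,\kappa}=\kappa\sqrt{2\pi}\,(\Phi(R/\kappa)-\Phi(-R/\kappa))$, and for $\alpha>0$ let $y_\alpha^\star\ge0$ solve $$I_R\Big(y_\alpha^\star,\frac{\kappa^2+1}{2\kappa^2}\Big)=\frac{Z_{R,\kappa}}{\alpha}.$$ Define $$\mathcal H_n^{\mathrm{MIX,IWR}}(\alpha;R,\kappa)=(\overline X_n-W_n,\ \overline X_n+W_n),\qquad W_n=W_n^{\mathrm{MIX,IWR}}(\alpha;R,\kappa)=\frac{\hat s_n\,y_\alpha^\star}{\sqrt{n-(y_\alpha^\star)^2}},$$ where the set is taken to be all of $\mathbb R$ if $n-(y_\alpha^\star)^2\le0$. Then $(\mathcal H_n^{\mathrm{MIX,IWR}}(\cdot;R,\kappa))_{n\ge1}$ is an asymptotic post-hoc confidence interval for $\mu$ (under $\mathrm{DAN}(\mu)$).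
   Context: Under $P$, $X_1,X_2,\dots$ are iid with law $P$. $\overline X_n=n^{-1}\sum_{i\le n}X_i$ and $\hat s_n^2=n^{-1}\sum_{i\le n}(X_i-\overline X_n)^2$, $\hat s_n\ge0$. $\Phi$ is the standard normal cdf. For $R,u>0$ and $y\in\mathbb R$, $$I_R(y,u)=\sqrt{\frac{\pi}{u}}\exp\Big\{\frac{y^2}{4u}\Big\}(\Phi(g_1)-\Phi(g_2)),\quad g_1=R\sqrt{2u}-\frac{y}{\sqrt{2u}},\quad g_2=-\Big(R\sqrt{2u}+\frac{y}{\sqrt{2u}}\Big).$$ The function $y\mapsto I_R(y,u)$ is symmetric about $0$ and strictly increasing in $|y|$. For every $\alpha\in(0,1]$ the equation for $y^\star_\alpha$ has a unique nonnegative solution; for those $\alpha>1$ for which it has no solution, $\mathcal H_n^{\mathrm{MIX,IWR}}(\alpha;R,\kappa)$ is taken to be empty. An interval $(a,b)$ with $a\ge b$ is the empty set. $\mathrm{DAN}(\mu)$ is the set of distributions $P$ on $\mathbb R$ with mean $\mu$ such that there exist real sequences $(a_n)$ (with $a_n>0$) and $(b_n)$ with $(\sum_{i\le n}X_i-b_n)/a_n\to N(0,1)$ in distribution under $P$. For families of random sets $\mathcal H_n=\{\mathcal H_n(\alpha)\}_{\alpha>0}$, $(\mathcal H_n)$ is an asymptotic post-hoc confidence interval for $\mu$ under a class $\mathcal Q$ if $\sup_{P\in\mathcal Q}\limsup_{n\to\infty}\mathbb E_P\big[\sup_{\alpha>0}\mathbf 1\{\mu\notin\mathcal H_n(\alpha)\}/\alpha\big]\le1$.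 *)

theory Defs
  imports "HOL-Probability.Probability"
begin

text \<open>Sequences are indexed from 0: \<open>X i\<close> is the (i+1)-st observation, so the first \<open>n\<close>
  observations are \<open>X i\<close> for \<open>i < n\<close>.\<close>

definition iid_under :: "'a measure \<Rightarrow> (nat \<Rightarrow> 'a \<Rightarrow> real) \<Rightarrow> real measure \<Rightarrow> bool" where
  "iid_under M X P \<longleftrightarrow>
     prob_space M \<and>
     prob_space.indep_vars M (\<lambda>_. borel) X UNIV \<and>
     (\<forall>i. distr M borel (X i) = P)"

definition sample_mean :: "(nat \<Rightarrow> 'a \<Rightarrow> real) \<Rightarrow> nat \<Rightarrow> 'a \<Rightarrow> real" where
  "sample_mean X n \<omega> = (\<Sum>i<n. X i \<omega>) / real n"

definition sample_sd :: "(nat \<Rightarrow> 'a \<Rightarrow> real) \<Rightarrow> nat \<Rightarrow> 'a \<Rightarrow> real" where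
  "sample_sd X n \<omega> = sqrt ((\<Sum>i<n. (X i \<omega> - sample_mean X n \<omega>)\<^sup>2) / real n)"

text \<open>The defining property of \<open>DAN\<close> depends only on the joint law of the iid sequence, so it is
  stated for the coordinates of the infinite product measure.\<close>

definition DAN :: "real \<Rightarrow> real measure set" where
  "DAN \<mu> = {P. real_distribution P \<and>
     integrable P (\<lambda>x. x) \<and> (LINT x|P. x) = \<mu> \<and>
     (\<exists>a b. (\<forall>n. a n > 0) \<and>
        weak_conv_m
          (\<lambda>n. distr (\<Pi>\<^sub>M i\<in>(UNIV :: nat set). P) borel (\<lambda>x. ((\<Sum>i<n. x i) - b n) / a n))
          std_normal_distribution)}"

abbreviation std_normal_cdf :: "real \<Rightarrow> real" where
  "std_normal_cdf \<equiv> cdf std_normal_distribution"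

definition I_fun :: "real \<Rightarrow> real \<Rightarrow> real \<Rightarrow> real" where
  "I_fun R y u =
     sqrt (pi / u) * exp (y\<^sup>2 / (4 * u)) *
       (std_normal_cdf (R * sqrt (2 * u) - y / sqrt (2 * u)) -
        std_normal_cdf (- (R * sqrt (2 * u) + y / sqrt (2 * u))))"

definition Z_const :: "real \<Rightarrow> real \<Rightarrow> real" where
  "Z_const R \<kappa> = \<kappa> * sqrt (2 * pi) * (std_normal_cdf (R / \<kappa>) - std_normal_cdf (- R / \<kappa>))"

definition solves_y_star :: "real \<Rightarrow> real \<Rightarrow> real \<Rightarrow> real \<Rightarrow> bool" where
  "solves_y_star R \<kappa> \<alpha> y \<longleftrightarrow>
     y \<ge> 0 \<and> I_fun R y ((\<kappa>\<^sup>2 + 1) / (2 * \<kappa>\<^sup>2)) = Z_const R \<kappa> / \<alpha>"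

text \<open>Meaningful only if the equation is solvable; the solution is then unique because
  \<open>I_fun R y u\<close> is strictly increasing in \<open>y \<ge> 0\<close>.\<close>

definition y_star :: "real \<Rightarrow> real \<Rightarrow> real \<Rightarrow> real" where
  "y_star R \<kappa> \<alpha> = (THE y. solves_y_star R \<kappa> \<alpha> y)"

definition W_mix_iwr ::
    "(nat \<Rightarrow> 'a \<Rightarrow> real) \<Rightarrow> real \<Rightarrow> real \<Rightarrow> nat \<Rightarrow> real \<Rightarrow> 'a \<Rightarrow> real" where
  "W_mix_iwr X R \<kappa> n \<alpha> \<omega> =
     sample_sd X n \<omega> * y_star R \<kappa> \<alpha> / sqrt (real n - (y_star R \<kappa> \<alpha>)\<^sup>2)"

definition H_mix_iwr ::
    "(nat \<Rightarrow> 'a \<Rightarrow> real) \<Rightarrow> real \<Rightarrow> real \<Rightarrow> nat \<Rightarrow> real \<Rightarrow> 'a \<Rightarrow> real set" where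
  "H_mix_iwr X R \<kappa> n \<alpha> \<omega> =
     (if \<nexists>y. solves_y_star R \<kappa> \<alpha> y then {}
      else if real n - (y_star R \<kappa> \<alpha>)\<^sup>2 \<le> 0 then UNIV
      else {sample_mean X n \<omega> - W_mix_iwr X R \<kappa> n \<alpha> \<omega>
              <..< sample_mean X n \<omega> + W_mix_iwr X R \<kappa> n \<alpha> \<omega>})"

definition post_hoc_loss ::
    "(nat \<Rightarrow> real \<Rightarrow> 'a \<Rightarrow> real set) \<Rightarrow> real \<Rightarrow> nat \<Rightarrow> 'a \<Rightarrow> ennreal" where
  "post_hoc_loss H \<mu> n \<omega> = (SUP \<alpha>\<in>{0<..}. ennreal (of_bool (\<mu> \<notin> H n \<alpha> \<omega>) / \<alpha>))"

text \<open>\<open>M P\<close> is the probability measure on the sample space under which the observations have law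
  \<open>P\<close>, so \<open>\<integral>\<^sup>+\<close> with respect to \<open>M P\<close> is the expectation under \<open>P\<close>. On a non-measurable
  function \<open>\<integral>\<^sup>+\<close> is only a lower integral; the measurability clause says that the expectations
  exist. The index \<open>n = 0\<close> has no influence on the limsup.\<close>

definition asymptotic_post_hoc_ci ::
    "(real measure \<Rightarrow> 'a measure) \<Rightarrow> real measure set \<Rightarrow>
     (nat \<Rightarrow> real \<Rightarrow> 'a \<Rightarrow> real set) \<Rightarrow> real \<Rightarrow> bool" where
  "asymptotic_post_hoc_ci M Q H \<mu> \<longleftrightarrow>
     (\<forall>P\<in>Q. \<forall>n\<ge>1. post_hoc_loss H \<mu> n \<in> borel_measurable (M P)) \<and>
     (SUP P\<in>Q. limsup (\<lambda>n. \<integral>\<^sup>+ \<omega>. post_hoc_loss H \<mu> n \<omega> \<partial>M P)) \<le> 1"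

text \<open>The canonical product space realises every law on the same space with the same
  observations.\<close>

lemma iid_under_canonical:
  assumes "real_distribution P"
  shows "iid_under (\<Pi>\<^sub>M i\<in>(UNIV :: nat set). P) (\<lambda>i x. x i) P"
proof -
  interpret real_distribution P by fact
  interpret PP: product_prob_space "\<lambda>_::nat. P" UNIV
    by standard
  have meas: "PP.P.random_variable borel (\<lambda>x. x i)" for i :: nat
    by measurable
  have eq: "distr (\<Pi>\<^sub>M i\<in>(UNIV :: nat set). P) borel (\<lambda>x. x i) = P" for i :: nat
  proof -
    have "distr (\<Pi>\<^sub>M i\<in>(UNIV :: nat set). P) borel (\<lambda>x. x i)
        = distr (\<Pi>\<^sub>M i\<in>(UNIV :: nat set). P) P (\<lambda>x. x i)"
      by (rule distr_cong) auto
    also have "\<dots> = P" by (rule distr_PiM_component) (auto intro: prob_space_axioms)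
    finally show ?thesis .
  qed
  have "PP.P.indep_vars (\<lambda>_. borel) (\<lambda>i x. x i) (UNIV :: nat set)"
  proof (subst PP.P.indep_vars_iff_distr_eq_PiM)
    have "distr (\<Pi>\<^sub>M i\<in>UNIV. P) (\<Pi>\<^sub>M i\<in>UNIV. borel) (\<lambda>x. \<lambda>i\<in>(UNIV :: nat set). x i)
        = distr (\<Pi>\<^sub>M i\<in>UNIV. P) (\<Pi>\<^sub>M i\<in>UNIV. P) (\<lambda>x. x)"
      by (rule distr_cong) (auto intro!: sets_PiM_cong)
    then show "distr (\<Pi>\<^sub>M i\<in>UNIV. P) (\<Pi>\<^sub>M i\<in>UNIV. borel) (\<lambda>x. \<lambda>i\<in>(UNIV :: nat set). x i)
        = (\<Pi>\<^sub>M i\<in>UNIV. distr (\<Pi>\<^sub>M i\<in>UNIV. P) borel (\<lambda>x. x i))"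
      by (simp add: eq)
  qed (use meas in auto)
  then show ?thesis
    using eq PP.P.prob_space_axioms by (simp add: iid_under_def)
qed

end

theory Submission
  imports Defs
begin

text \<open>
  Put \<open>u = (\<kappa>\<^sup>2 + 1) / (2 * \<kappa>\<^sup>2)\<close>, \<open>\<xi>\<^sub>i = X i - \<mu>\<close>, let \<open>S\<close> be the sum of the first \<open>n\<close> of the \<open>\<xi>\<^sub>i\<close> and
  \<open>V\<close> the root of the sum of their squares. The interval at level \<open>\<alpha>\<close> misses \<open>\<mu>\<close> exactly when the
  critical value at level \<open>\<alpha>\<close> is at most \<open>T = \<bar>S\<bar> / V\<close>, and \<open>1 / \<alpha>\<close> is \<open>I_fun R y u / Z\<close> at that
  critical value \<open>y\<close>. Since \<open>I_fun\<close> increases in \<open>y\<close>, the supremum over \<open>\<alpha>\<close> is \<open>I_fun R T u / Z\<close>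
  (lemma \<open>post_hoc_loss_eq\<close>), and the theorem says that the upper limit of the expectation of
  \<open>I_fun R T u\<close> is at most \<open>Z\<close>.

  The function \<open>I_fun R y u\<close> is the integral of \<open>exp (x * y - u * x\<^sup>2)\<close> over \<open>\<bar>x\<bar> \<le> R\<close>. With \<open>y = S / V\<close>
  and the substitution \<open>x = \<theta> * V\<close> the exponent becomes \<open>\<theta> * S - u * \<theta>\<^sup>2 * V\<^sup>2\<close>, which is a sum of
  terms in the single observations, so that its exponential has the \<open>n\<close>-th power of a one-dimensional
  integral as expectation. After \<open>S\<close> and \<open>V\<close> are scaled by a suitable \<open>s\<^sub>n\<close>, this power tends to
  \<open>exp (\<theta>\<^sup>2 / 2 - u * \<theta>\<^sup>2)\<close> while \<open>s\<^sub>n * V\<close> tends to \<open>1\<close> in probability. The limit integrates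
  over \<open>\<bar>\<theta>\<bar> \<le> R\<close> to \<open>Z\<close>, because \<open>u - 1 / 2 = 1 / (2 * \<kappa>\<^sup>2)\<close>; this is the reason for the choice of \<open>u\<close>.

  Attraction to the normal law enters only through slow variation of the truncated variance. It is
  measured here by the expectation \<open>U s\<close> of \<open>1 - exp (- (s * \<xi>)\<^sup>2 / 2)\<close>, and the property used is that
  \<open>U (2 * s) / U s\<close> tends to \<open>4\<close> as \<open>s\<close> decreases to \<open>0\<close> (theorem \<open>DAN_centered_slowly_varying\<close>). It is read
  off the moduli of characteristic functions, in which the centring sequence of the normal limit
  cancels. The ratio property gives the asymptotics of the expectation of \<open>h (s * \<xi>)\<close> for every \<open>h\<close> that is
  quadratic at \<open>0\<close> and of linear growth (lemma \<open>expectation_asymp\<close>), and hence all the limits of powers.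

  What remains is to exclude a contribution of the event on which \<open>s\<^sub>n * V\<close> is not close to \<open>1\<close>. There the
  bound \<open>I_fun R T u \<le> 2 * R * exp (R * T)\<close> and boundedness of the exponential moments of \<open>T\<close> suffice
  (theorem \<open>self_norm_exp_moment_bounded\<close>). The critical case of that theorem is small \<open>V\<close>, which is cut
  into dyadic shells; at the scale \<open>\<sigma>\<close> of a shell the damping factor \<open>exp (- c * \<sigma>\<^sup>2 * V\<^sup>2)\<close> has an
  expectation so small that the shells sum up.
\<close>

section \<open>The mixture integral\<close>

lemma std_normal_cdf_isCont: "isCont std_normal_cdf x"
proof -
  interpret real_distribution std_normal_distribution by (rule real_dist_normal_dist)
  have "emeasure std_normal_distribution {x} = 0"
    by (subst emeasure_density) (auto intro!: nn_integral_0_iff_AE[THEN iffD2]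
        intro: AE_mp[OF AE_lborel_singleton[of x]])
  then show ?thesis by (simp add: isCont_cdf measure_def)
qed

lemma std_normal_cdf_diff:
  assumes "a \<le> b"
  shows "ennreal (std_normal_cdf b - std_normal_cdf a) =
    (\<integral>\<^sup>+x. ennreal (std_normal_density x) * indicator {a<..b} x \<partial>lborel)"
proof -
  interpret real_distribution std_normal_distribution by (rule real_dist_normal_dist)
  have "std_normal_cdf b - std_normal_cdf a = measure std_normal_distribution {a<..b}"
  proof (cases "a = b")
    case False
    then show ?thesis using assms by (intro cdf_diff_eq) auto
  qed simp
  then have "ennreal (std_normal_cdf b - std_normal_cdf a) = emeasure std_normal_distribution {a<..b}"
    by (simp add: emeasure_eq_measure)
  then show ?thesis by (subst (asm) emeasure_density) auto
qed

text \<open>Completing the square in \<open>x * y - u * x\<^sup>2\<close> turns the integrand into a Gaussian density with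
  variance \<open>1 / (2 * u)\<close>; the distribution function values in \<open>I_fun\<close> are its mass on \<open>[- R, R]\<close>.\<close>

lemma I_fun_nn_integral:
  assumes "R > 0" "u > 0"
  shows "ennreal (I_fun R y u) =
    (\<integral>\<^sup>+x. ennreal (exp (x * y - u * x\<^sup>2)) * indicator {-R..R} x \<partial>lborel)"
proof -
  define c where "c = sqrt (2 * u)"
  have c: "c > 0" "c\<^sup>2 = 2 * u" using assms by (simp_all add: c_def)
  define k where "k = sqrt (pi / u) * exp (y\<^sup>2 / (4 * u))"
  have k: "k \<ge> 0" using assms by (simp add: k_def)
  let ?J = "{- (R * c + y / c)<..R * c - y / c}"
  have le: "- (R * c + y / c) \<le> R * c - y / c" using assms c by simp
  have dens: "k * (c * std_normal_density (- y / c + c * x)) = exp (x * y - u * x\<^sup>2)" for x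
  proof -
    have "(- y / c + c * x)\<^sup>2 = y\<^sup>2 / c\<^sup>2 - 2 * (x * y) + c\<^sup>2 * x\<^sup>2"
      using c(1) by (simp add: power2_eq_square field_simps)
    then have "(- y / c + c * x)\<^sup>2 / 2 = y\<^sup>2 / (4 * u) - (x * y - u * x\<^sup>2)"
      by (simp add: c(2) field_simps)
    then have "- ((- y / c + c * x)\<^sup>2) / 2 = - (y\<^sup>2 / (4 * u)) + (x * y - u * x\<^sup>2)" by simp
    then have "exp (- ((- y / c + c * x)\<^sup>2) / 2) * exp (y\<^sup>2 / (4 * u)) = exp (x * y - u * x\<^sup>2)"
      by (simp only: exp_add[symmetric]) simp
    moreover have "sqrt (pi / u) * c * (1 / sqrt (2 * pi)) = 1"
      unfolding c_def using assms by (simp add: real_sqrt_mult real_sqrt_divide)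
    moreover have "k * (c * std_normal_density (- y / c + c * x)) = (sqrt (pi / u) * c * (1 / sqrt (2 * pi))) *
        (exp (- ((- y / c + c * x)\<^sup>2) / 2) * exp (y\<^sup>2 / (4 * u)))"
      unfolding k_def std_normal_density_def by (simp only: mult_ac)
    ultimately show ?thesis by (simp only: mult_1)
  qed
  have "ennreal (I_fun R y u) = ennreal k * ennreal (std_normal_cdf (R * c - y / c) - std_normal_cdf (- (R * c + y / c)))"
    unfolding I_fun_def c_def[symmetric] k_def[symmetric] by (rule ennreal_mult'[OF k])
  also have "\<dots> = ennreal k * (\<integral>\<^sup>+x. ennreal (std_normal_density x) * indicator ?J x \<partial>lborel)"
    by (simp only: std_normal_cdf_diff[OF le])
  also have "\<dots> = ennreal k * (ennreal \<bar>c\<bar> * (\<integral>\<^sup>+x. ennreal (std_normal_density (- y / c + c * x)) *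
      indicator ?J (- y / c + c * x) \<partial>lborel))"
    using c by (intro arg_cong[where f = "\<lambda>z. ennreal k * z"] nn_integral_real_affine) auto
  also have "\<dots> = ennreal k * (\<integral>\<^sup>+x. ennreal \<bar>c\<bar> * (ennreal (std_normal_density (- y / c + c * x)) *
      indicator ?J (- y / c + c * x)) \<partial>lborel)"
    by (rule arg_cong[where f = "\<lambda>z. ennreal k * z"], rule nn_integral_cmult[symmetric]) measurable
  also have "\<dots> = (\<integral>\<^sup>+x. ennreal k * (ennreal \<bar>c\<bar> * (ennreal (std_normal_density (- y / c + c * x)) *
      indicator ?J (- y / c + c * x))) \<partial>lborel)"
    by (rule nn_integral_cmult[symmetric]) measurable
  also have "\<dots> = (\<integral>\<^sup>+x. ennreal (exp (x * y - u * x\<^sup>2)) * indicator {-R..R} x \<partial>lborel)"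
  proof (rule nn_integral_cong_AE)
    have ind: "indicator ?J (- y / c + c * x) = (indicator {-R..R} x :: ennreal)"
      if "x \<noteq> -R" for x
    proof -
      have "- (R * c + y / c) < - y / c + c * x \<longleftrightarrow> c * (- R) < c * x" by (auto simp: mult.commute)
      then have "- (R * c + y / c) < - y / c + c * x \<longleftrightarrow> - R < x" by (simp only: mult_less_cancel_left_pos[OF c(1)])
      moreover have "- y / c + c * x \<le> R * c - y / c \<longleftrightarrow> c * x \<le> c * R" by (auto simp: mult.commute)
      then have "- y / c + c * x \<le> R * c - y / c \<longleftrightarrow> x \<le> R" by (simp only: mult_le_cancel_left_pos[OF c(1)])
      ultimately show ?thesis using that by (simp add: indicator_def)
    qed
    have "AE x in lborel. x \<noteq> -R" by (rule AE_lborel_singleton)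
    then show "AE x in lborel. ennreal k * (ennreal \<bar>c\<bar> * (ennreal (std_normal_density (- y / c + c * x)) *
        indicator ?J (- y / c + c * x))) =
        ennreal (exp (x * y - u * x\<^sup>2)) * indicator {-R..R} x"
    proof (eventually_elim)
      case (elim x)
      have "ennreal (exp (x * y - u * x\<^sup>2)) = ennreal k * (ennreal \<bar>c\<bar> * ennreal (std_normal_density (- y / c + c * x)))"
        unfolding dens[of x, symmetric] using c k by (simp add: ennreal_mult' mult.assoc)
      then show ?case unfolding ind[OF elim] by (simp add: mult.assoc)
    qed
  qed
  finally show ?thesis .
qed

lemma I_fun_nonneg:
  assumes "R > 0" "u > 0" shows "0 \<le> I_fun R y u"
proof -
  interpret real_distribution std_normal_distribution by (rule real_dist_normal_dist)
  show ?thesis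
    unfolding I_fun_def using assms
    by (intro mult_nonneg_nonneg) (auto intro!: cdf_nondecreasing)
qed

lemma I_fun_integral:
  assumes "R > 0" "u > 0"
  shows "I_fun R y u = (LINT x:{-R..R}|lborel. exp (x * y - u * x\<^sup>2))"
proof -
  have "(LINT x:{-R..R}|lborel. exp (x * y - u * x\<^sup>2)) =
      enn2real (\<integral>\<^sup>+x. ennreal (indicator {-R..R} x * exp (x * y - u * x\<^sup>2)) \<partial>lborel)"
    unfolding set_lebesgue_integral_def by (subst integral_eq_nn_integral) auto
  also have "(\<lambda>x. ennreal (indicator {-R..R} x * exp (x * y - u * x\<^sup>2))) =
      (\<lambda>x. ennreal (exp (x * y - u * x\<^sup>2)) * indicator {-R..R} x)"
    by (auto simp: indicator_def)
  finally show ?thesis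
    by (simp add: I_fun_nn_integral[OF assms, symmetric] I_fun_nonneg[OF assms])
qed

text \<open>The normalising constant is the mixture integral at \<open>y = 0\<close> for the limiting Gaussian weight.\<close>

lemma Z_const_eq_I_fun:
  assumes "\<kappa> > 0"
  shows "Z_const R \<kappa> = I_fun R 0 (1 / (2 * \<kappa>\<^sup>2))"
  using assms by (simp add: Z_const_def I_fun_def real_sqrt_mult real_sqrt_divide)

lemma sinh_ge_self: "0 \<le> t \<Longrightarrow> t \<le> sinh (t::real)"
proof -
  assume t: "0 \<le> t"
  have "sinh 0 - 0 \<le> sinh t - t"
  proof (rule DERIV_nonneg_imp_nondecreasing[OF t])
    fix x :: real
    show "\<exists>y. ((\<lambda>t. sinh t - t) has_real_derivative y) (at x) \<and> 0 \<le> y"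
      by (intro exI[of _ "cosh x - 1"]) (auto intro!: derivative_eq_intros simp: cosh_real_ge_1)
  qed
  then show ?thesis by simp
qed

lemma cosh_diff_ge:
  assumes "0 \<le> a" "a \<le> (b::real)"
  shows "(b\<^sup>2 - a\<^sup>2) / 2 \<le> cosh b - cosh a"
proof -
  have "cosh a - a\<^sup>2 / 2 \<le> cosh b - b\<^sup>2 / 2"
  proof (rule DERIV_nonneg_imp_nondecreasing[OF assms(2)])
    fix x :: real assume "a \<le> x"
    then show "\<exists>y. ((\<lambda>t. cosh t - t\<^sup>2 / 2) has_real_derivative y) (at x) \<and> 0 \<le> y"
      using assms by (intro exI[of _ "sinh x - x"]) (auto intro!: derivative_eq_intros simp: sinh_ge_self)
  qed
  then show ?thesis by (simp add: field_simps)
qed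

lemma I_fun_cosh:
  assumes "R > 0" "u > 0"
  shows "I_fun R y u = (LINT x:{-R..R}|lborel. cosh (x * y) * exp (- u * x\<^sup>2))"
proof -
  have int: "set_integrable lborel {-R..R} (\<lambda>x. exp (x * z - u * x\<^sup>2))" for z
    by (intro borel_integrable_atLeastAtMost' continuous_intros)
  have "(LINT x:{-R..R}|lborel. exp (x * y - u * x\<^sup>2)) = (LINT x:{x. -x \<in> {-R..R}}|lborel. exp (- x * y - u * (-x)\<^sup>2))"
    by (rule set_integral_reflect)
  also have "{x. -x \<in> {-R..R}} = {-R..R}" by auto
  finally have "2 * I_fun R y u = (LINT x:{-R..R}|lborel. exp (x * y - u * x\<^sup>2)) + (LINT x:{-R..R}|lborel. exp (x * (-y) - u * x\<^sup>2))"
    by (simp add: I_fun_integral[OF assms])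
  also have "\<dots> = (LINT x:{-R..R}|lborel. exp (x * y - u * x\<^sup>2) + exp (x * (-y) - u * x\<^sup>2))"
    by (rule set_integral_add(2)[OF int int, symmetric])
  also have "\<dots> = (LINT x:{-R..R}|lborel. 2 * (cosh (x * y) * exp (- u * x\<^sup>2)))"
    by (intro set_lebesgue_integral_cong)
      (auto simp: cosh_field_def exp_diff exp_minus field_simps)
  finally show ?thesis by simp
qed

text \<open>In the form of lemma \<open>I_fun_cosh\<close> the integrand grows in \<open>y\<close> at least like \<open>x\<^sup>2 * y\<^sup>2 / 2\<close>, since
  \<open>cosh t - t\<^sup>2 / 2\<close> increases for \<open>t \<ge> 0\<close>. This gives strict monotonicity and unboundedness at once,
  hence existence and uniqueness of the critical values.\<close>

lemma I_fun_quadratic_growth: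
  assumes "R > 0" "u > 0"
  obtains c where "c > 0"
    "\<And>y z. 0 \<le> y \<Longrightarrow> y \<le> z \<Longrightarrow> c * (z\<^sup>2 - y\<^sup>2) \<le> I_fun R z u - I_fun R y u"
proof
  define c where "c = (LINT x:{-R..R}|lborel. x\<^sup>2 / 2 * exp (- u * x\<^sup>2))"
  have int: "set_integrable lborel {-R..R} (\<lambda>x. x\<^sup>2 / 2 * exp (- u * x\<^sup>2))"
    by (intro borel_integrable_atLeastAtMost' continuous_intros) auto
  show "c > 0"
  proof -
    have "0 < R\<^sup>2 / 8 * exp (- u * R\<^sup>2) * (R / 2)" using assms by simp
    also have "\<dots> = (LINT x|lborel. R\<^sup>2 / 8 * exp (- u * R\<^sup>2) * indicator {R/2..R} x)"
      using assms by simp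
    also have "\<dots> \<le> c"
      unfolding c_def set_lebesgue_integral_def
    proof (rule integral_mono)
      show "integrable lborel (\<lambda>x. indicat_real {-R..R} x *\<^sub>R (x\<^sup>2 / 2 * exp (- u * x\<^sup>2)))"
        using int by (simp add: set_integrable_def)
      fix x
      have "R\<^sup>2 / 8 * exp (- u * R\<^sup>2) \<le> x\<^sup>2 / 2 * exp (- u * x\<^sup>2)" if "R / 2 \<le> x" "x \<le> R"
      proof (rule mult_mono)
        have "(R / 2)\<^sup>2 \<le> x\<^sup>2" using that assms by (intro power_mono) auto
        then show "R\<^sup>2 / 8 \<le> x\<^sup>2 / 2" by (simp add: power_divide)
        have "x\<^sup>2 \<le> R\<^sup>2" using that assms by (intro power_mono) auto
        then show "exp (- u * R\<^sup>2) \<le> exp (- u * x\<^sup>2)" using assms by simp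
      qed auto
      then show "R\<^sup>2 / 8 * exp (- u * R\<^sup>2) * indicator {R/2..R} x \<le> indicat_real {-R..R} x *\<^sub>R (x\<^sup>2 / 2 * exp (- u * x\<^sup>2))"
        using assms by (auto simp: indicator_def)
    qed (intro integrable_mult_right integrable_real_indicator; simp add: emeasure_lborel_Icc_eq)
    finally show ?thesis .
  qed
  fix y z :: real assume yz: "0 \<le> y" "y \<le> z"
  have intc: "set_integrable lborel {-R..R} (\<lambda>x. cosh (x * w) * exp (- u * x\<^sup>2))" for w
    by (intro borel_integrable_atLeastAtMost' continuous_intros)
  have "c * (z\<^sup>2 - y\<^sup>2) = (LINT x:{-R..R}|lborel. (z\<^sup>2 - y\<^sup>2) * (x\<^sup>2 / 2 * exp (- u * x\<^sup>2)))"
    by (simp add: c_def)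
  also have "\<dots> \<le> (LINT x:{-R..R}|lborel. cosh (x * z) * exp (- u * x\<^sup>2) - cosh (x * y) * exp (- u * x\<^sup>2))"
  proof (rule set_integral_mono)
    show "set_integrable lborel {-R..R} (\<lambda>x. (z\<^sup>2 - y\<^sup>2) * (x\<^sup>2 / 2 * exp (- u * x\<^sup>2)))"
      using int by (rule set_integrable_mult_right)
    show "set_integrable lborel {-R..R} (\<lambda>x. cosh (x * z) * exp (- u * x\<^sup>2) - cosh (x * y) * exp (- u * x\<^sup>2))"
      by (rule set_integral_diff(1)[OF intc intc])
    fix x
    have "((\<bar>x\<bar> * z)\<^sup>2 - (\<bar>x\<bar> * y)\<^sup>2) / 2 \<le> cosh (\<bar>x\<bar> * z) - cosh (\<bar>x\<bar> * y)"
      using yz by (intro cosh_diff_ge) (auto intro: mult_left_mono)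
    moreover have "cosh (\<bar>x\<bar> * w) = cosh (x * w)" for w
      by (cases "x \<ge> 0") simp_all
    moreover have "((\<bar>x\<bar> * z)\<^sup>2 - (\<bar>x\<bar> * y)\<^sup>2) / 2 = (z\<^sup>2 - y\<^sup>2) * (x\<^sup>2 / 2)"
      by (simp add: power_mult_distrib field_simps)
    ultimately have "(z\<^sup>2 - y\<^sup>2) * (x\<^sup>2 / 2) \<le> cosh (x * z) - cosh (x * y)"
      by simp
    from mult_right_mono[OF this exp_ge_zero, of "- u * x\<^sup>2"]
    show "(z\<^sup>2 - y\<^sup>2) * (x\<^sup>2 / 2 * exp (- u * x\<^sup>2)) \<le> cosh (x * z) * exp (- u * x\<^sup>2) - cosh (x * y) * exp (- u * x\<^sup>2)"
      by (simp only: left_diff_distrib mult.assoc)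
  qed
  also have "\<dots> = I_fun R z u - I_fun R y u"
    by (subst set_integral_diff(2)[OF intc intc]) (simp add: I_fun_cosh[OF assms])
  finally show "c * (z\<^sup>2 - y\<^sup>2) \<le> I_fun R z u - I_fun R y u" .
qed

lemma I_fun_strict_mono:
  assumes "R > 0" "u > 0" "0 \<le> y" "y < z"
  shows "I_fun R y u < I_fun R z u"
proof -
  obtain c where c: "c > 0"
    "\<And>y z. 0 \<le> y \<Longrightarrow> y \<le> z \<Longrightarrow> c * (z\<^sup>2 - y\<^sup>2) \<le> I_fun R z u - I_fun R y u"
    using I_fun_quadratic_growth[OF assms(1,2)] by blast
  have "y\<^sup>2 < z\<^sup>2" using assms by (intro power_strict_mono) auto
  then have "0 < c * (z\<^sup>2 - y\<^sup>2)" using c by simp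
  then show ?thesis using c(2)[of y z] assms by simp
qed

lemma I_fun_mono:
  assumes "R > 0" "u > 0" "0 \<le> y" "y \<le> z"
  shows "I_fun R y u \<le> I_fun R z u"
  using I_fun_strict_mono[OF assms(1-3), of z] assms(4) by (cases "y = z") auto

lemma I_fun_isCont: "u > 0 \<Longrightarrow> isCont (\<lambda>y. I_fun R y u) y"
  unfolding I_fun_def
  by (intro continuous_intros isCont_o2[OF _ std_normal_cdf_isCont]) auto

lemma I_fun_pos:
  assumes "R > 0" "u > 0" "0 \<le> y" shows "0 < I_fun R y u"
proof -
  have "0 < 2 * R * exp (- u * R\<^sup>2)" using assms by simp
  also have "\<dots> = (LINT x|lborel. exp (- u * R\<^sup>2) * indicator {-R..R} x)"
    using assms by simp
  also have "\<dots> \<le> I_fun R 0 u"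
    unfolding I_fun_integral[OF assms(1,2)] set_lebesgue_integral_def
  proof (rule integral_mono)
    have "set_integrable lborel {-R..R} (\<lambda>x. exp (x * 0 - u * x\<^sup>2))"
      by (intro borel_integrable_atLeastAtMost' continuous_intros)
    then show "integrable lborel (\<lambda>x. indicat_real {-R..R} x *\<^sub>R exp (x * 0 - u * x\<^sup>2))"
      by (simp add: set_integrable_def)
    fix x
    have "x\<^sup>2 \<le> R\<^sup>2" if "-R \<le> x" "x \<le> R"
      using that by (simp add: abs_le_square_iff[symmetric] abs_le_iff)
    then show "exp (- u * R\<^sup>2) * indicator {-R..R} x \<le> indicat_real {-R..R} x *\<^sub>R exp (x * 0 - u * x\<^sup>2)"
      using assms by (auto simp: indicator_def)
  qed (intro integrable_mult_right integrable_real_indicator; simp add: emeasure_lborel_Icc_eq)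
  also have "\<dots> \<le> I_fun R y u" using assms by (intro I_fun_mono) auto
  finally show ?thesis .
qed

lemma I_fun_le_exp:
  assumes "R > 0" "u > 0" "0 \<le> y"
  shows "I_fun R y u \<le> 2 * R * exp (R * y)"
proof -
  have "I_fun R y u \<le> (LINT x|lborel. exp (R * y) * indicator {-R..R} x)"
    unfolding I_fun_integral[OF assms(1,2)] set_lebesgue_integral_def
  proof (rule integral_mono)
    have "set_integrable lborel {-R..R} (\<lambda>x. exp (x * y - u * x\<^sup>2))"
      by (intro borel_integrable_atLeastAtMost' continuous_intros)
    then show "integrable lborel (\<lambda>x. indicat_real {-R..R} x *\<^sub>R exp (x * y - u * x\<^sup>2))"
      by (simp add: set_integrable_def)
    fix x
    have "x * y - u * x\<^sup>2 \<le> R * y" if "x \<le> R"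
    proof -
      have "x * y \<le> R * y" using that assms by (intro mult_right_mono) auto
      moreover have "0 \<le> u * x\<^sup>2" using assms by simp
      ultimately show ?thesis by linarith
    qed
    then show "indicat_real {-R..R} x *\<^sub>R exp (x * y - u * x\<^sup>2) \<le> exp (R * y) * indicator {-R..R} x"
      by (auto simp: indicator_def)
  qed (intro integrable_mult_right integrable_real_indicator; simp add: emeasure_lborel_Icc_eq)
  then show ?thesis using assms by (simp add: mult.commute)
qed

lemma I_fun_solvable:
  assumes "R > 0" "u > 0" "I_fun R 0 u \<le> w"
  shows "\<exists>y\<ge>0. I_fun R y u = w"
proof -
  obtain c where c: "c > 0"
    "\<And>y z. 0 \<le> y \<Longrightarrow> y \<le> z \<Longrightarrow> c * (z\<^sup>2 - y\<^sup>2) \<le> I_fun R z u - I_fun R y u"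
    using I_fun_quadratic_growth[OF assms(1,2)] by blast
  have w: "w \<ge> 0" using assms(3) I_fun_pos[OF assms(1,2), of 0] by simp
  define z where "z = sqrt (w / c)"
  have z: "z \<ge> 0" "z\<^sup>2 = w / c" using w c by (simp_all add: z_def)
  have "w \<le> I_fun R z u"
    using c(2)[of 0 z] z c(1) I_fun_pos[OF assms(1,2), of 0] by simp
  then have "\<exists>y\<ge>0. y \<le> z \<and> I_fun R y u = w"
    using assms z by (intro IVT) (auto intro!: I_fun_isCont)
  then show ?thesis by blast
qed

section \<open>The loss as a function of the self-normalised sum\<close>

definition root_sum_sq :: "(nat \<Rightarrow> 'a \<Rightarrow> real) \<Rightarrow> nat \<Rightarrow> 'a \<Rightarrow> real" where
  "root_sum_sq Y n \<omega> = sqrt (\<Sum>i<n. (Y i \<omega>)\<^sup>2)"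

text \<open>If all observations vanish, the sample standard deviation is \<open>0\<close>, so every interval of finite
  half-width is empty. The value \<open>sqrt n\<close>, the upper bound of the quotient by the Cauchy-Schwarz inequality, makes
  the description of the loss below valid in this case too.\<close>

definition self_norm :: "(nat \<Rightarrow> 'a \<Rightarrow> real) \<Rightarrow> nat \<Rightarrow> 'a \<Rightarrow> real" where
  "self_norm Y n \<omega> =
     (if root_sum_sq Y n \<omega> = 0 then sqrt (real n) else \<bar>\<Sum>i<n. Y i \<omega>\<bar> / root_sum_sq Y n \<omega>)"

lemma root_sum_sq_nonneg: "0 \<le> root_sum_sq Y n \<omega>"
  by (simp add: root_sum_sq_def sum_nonneg)

lemma root_sum_sq_power2: "(root_sum_sq Y n \<omega>)\<^sup>2 = (\<Sum>i<n. (Y i \<omega>)\<^sup>2)"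
  by (simp add: root_sum_sq_def sum_nonneg)

lemma self_norm_nonneg: "0 \<le> self_norm Y n \<omega>"
  by (simp add: self_norm_def root_sum_sq_nonneg)

lemma abs_sum_le_root_sum_sq: "\<bar>\<Sum>i<n. Y i \<omega>\<bar> \<le> sqrt (real n) * root_sum_sq Y n \<omega>"
proof -
  have "(\<Sum>i<n. 1 * Y i \<omega>)\<^sup>2 \<le> (\<Sum>i<n. 1\<^sup>2) * (\<Sum>i<n. (Y i \<omega>)\<^sup>2)"
    by (rule Cauchy_Schwarz_ineq_sum)
  then have "sqrt ((\<Sum>i<n. Y i \<omega>)\<^sup>2) \<le> sqrt (real n * (\<Sum>i<n. (Y i \<omega>)\<^sup>2))"
    by (intro real_sqrt_le_mono) simp
  then show ?thesis by (simp add: real_sqrt_mult root_sum_sq_def)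
qed

lemma self_norm_le: "self_norm Y n \<omega> \<le> sqrt (real n)"
  using abs_sum_le_root_sum_sq[where Y = Y and n = n and \<omega> = \<omega>] root_sum_sq_nonneg[of Y n \<omega>]
  by (auto simp: self_norm_def pos_divide_le_eq)

lemma le_self_norm_iff:
  assumes "y < sqrt (real n)"
  shows "y \<le> self_norm Y n \<omega> \<longleftrightarrow> y * root_sum_sq Y n \<omega> \<le> \<bar>\<Sum>i<n. Y i \<omega>\<bar>"
  using assms root_sum_sq_nonneg[of Y n \<omega>] by (auto simp: self_norm_def pos_le_divide_eq)

lemma measurable_self_norm:
  assumes [measurable]: "\<And>i. Y i \<in> borel_measurable M"
  shows "root_sum_sq Y n \<in> borel_measurable M" "self_norm Y n \<in> borel_measurable M"
proof -
  show [measurable]: "root_sum_sq Y n \<in> borel_measurable M"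
    unfolding root_sum_sq_def[abs_def] by measurable
  show "self_norm Y n \<in> borel_measurable M"
    unfolding self_norm_def[abs_def] by measurable
qed

text \<open>Squaring \<open>W \<le> \<bar>sample_mean - \<mu>\<bar>\<close> and inserting \<open>n * (sample_sd)\<^sup>2 = V\<^sup>2 - S\<^sup>2 / n\<close>, all terms with
  \<open>y\<^sup>2 * S\<^sup>2\<close> cancel; the denominator \<open>sqrt (n - y\<^sup>2)\<close> of the half-width is designed for this.\<close>

lemma miscoverage_iff:
  assumes n: "n \<ge> 1" and y: "0 \<le> y" "y\<^sup>2 < real n"
  shows "\<mu> \<notin> {sample_mean X n \<omega> - sample_sd X n \<omega> * y / sqrt (real n - y\<^sup>2)
      <..< sample_mean X n \<omega> + sample_sd X n \<omega> * y / sqrt (real n - y\<^sup>2)}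
    \<longleftrightarrow> y \<le> self_norm (\<lambda>i \<omega>. X i \<omega> - \<mu>) n \<omega>"
proof -
  define m where "m = sample_mean X n \<omega>"
  define S where "S = (\<Sum>i<n. X i \<omega> - \<mu>)"
  define V where "V = root_sum_sq (\<lambda>i \<omega>. X i \<omega> - \<mu>) n \<omega>"
  define s where "s = sample_sd X n \<omega>"
  define d where "d = sqrt (real n - y\<^sup>2)"
  have d: "d > 0" "d\<^sup>2 = real n - y\<^sup>2" using y by (simp_all add: d_def)
  have V: "V \<ge> 0" by (simp add: V_def root_sum_sq_nonneg)
  have s: "s \<ge> 0" by (simp add: s_def sample_sd_def sum_nonneg)
  have mS: "m - \<mu> = S / real n"
    using n by (simp add: m_def S_def sample_mean_def sum_subtractf field_simps)
  \<comment> \<open>the bias-variance identity for the empirical measure\<close>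
  have "(\<Sum>i<n. (X i \<omega> - m)\<^sup>2) = (\<Sum>i<n. (X i \<omega> - \<mu>)\<^sup>2 - 2 * (m - \<mu>) * (X i \<omega> - \<mu>) + (m - \<mu>)\<^sup>2)"
    by (intro sum.cong refl) algebra
  also have "\<dots> = V\<^sup>2 - 2 * (m - \<mu>) * S + real n * (m - \<mu>)\<^sup>2"
    by (simp add: sum.distrib sum_subtractf V_def root_sum_sq_power2 S_def flip: sum_distrib_left)
  also have "\<dots> = V\<^sup>2 - S\<^sup>2 / real n"
    unfolding mS using n by (simp add: power2_eq_square field_simps)
  finally have sum_eq: "(\<Sum>i<n. (X i \<omega> - m)\<^sup>2) = V\<^sup>2 - S\<^sup>2 / real n" .
  have "s\<^sup>2 = (\<Sum>i<n. (X i \<omega> - m)\<^sup>2) / real n"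
    by (simp add: s_def sample_sd_def sum_nonneg m_def)
  then have s2: "s\<^sup>2 = (V\<^sup>2 - S\<^sup>2 / real n) / real n"
    by (simp only: sum_eq)
  have "\<mu> \<notin> {m - s * y / d<..<m + s * y / d} \<longleftrightarrow> s * y / d \<le> \<bar>S / real n\<bar>"
    unfolding mS[symmetric] by auto
  also have "\<dots> \<longleftrightarrow> s * y \<le> \<bar>S / real n\<bar> * d"
    using d by (simp add: pos_divide_le_eq)
  also have "\<dots> \<longleftrightarrow> (s * y)\<^sup>2 \<le> (\<bar>S / real n\<bar> * d)\<^sup>2"
    using s y d by (subst abs_le_square_iff[symmetric]) (simp add: abs_mult)
  also have "\<dots> \<longleftrightarrow> y\<^sup>2 * (V\<^sup>2 - S\<^sup>2 / real n) / real n \<le> S\<^sup>2 / (real n)\<^sup>2 * (real n - y\<^sup>2)"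
    by (simp add: power_mult_distrib s2 d(2) power_divide mult.commute)
  also have "\<dots> \<longleftrightarrow> y\<^sup>2 * V\<^sup>2 \<le> S\<^sup>2"
    using n by (simp add: field_simps power2_eq_square)
  also have "\<dots> \<longleftrightarrow> y * V \<le> \<bar>S\<bar>"
    using y V abs_le_square_iff[of "y * V" S] by (simp add: abs_mult power_mult_distrib)
  also have "\<dots> \<longleftrightarrow> y \<le> self_norm (\<lambda>i \<omega>. X i \<omega> - \<mu>) n \<omega>"
    unfolding V_def S_def using y
    by (intro le_self_norm_iff[symmetric]) (simp add: real_less_rsqrt)
  finally show ?thesis by (simp add: m_def s_def d_def)
qed

lemma y_star_eq:
  assumes "R > 0" "\<kappa> > 0" "solves_y_star R \<kappa> \<alpha> y"
  shows "y_star R \<kappa> \<alpha> = y"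
  unfolding y_star_def
proof (rule the_equality)
  have u: "(\<kappa>\<^sup>2 + 1) / (2 * \<kappa>\<^sup>2) > 0" using assms by (simp add: add_pos_pos)
  fix z assume "solves_y_star R \<kappa> \<alpha> z"
  with assms(3) show "z = y"
    using I_fun_strict_mono[OF assms(1) u, of y z] I_fun_strict_mono[OF assms(1) u, of z y]
    unfolding solves_y_star_def by (cases y z rule: linorder_cases) auto
qed (rule assms(3))

text \<open>For a level with critical value \<open>y\<close> the loss is \<open>I_fun R y u / Z\<close> if \<open>y \<le> T\<close> and \<open>0\<close> otherwise, so
  monotonicity bounds it by the value at \<open>T\<close>; a level without critical value has \<open>1 / \<alpha>\<close> below the
  value at \<open>0\<close>. Critical values with \<open>y\<^sup>2 \<ge> n\<close> never cause a loss, so for \<open>T = sqrt n\<close> the supremum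
  is not attained and only approached by continuity. Equality, not just the bound, is needed for the measurability of the
  loss, which is a supremum over uncountably many levels.\<close>

lemma post_hoc_loss_eq:
  assumes R: "R > 0" and \<kappa>: "\<kappa> > 0" and n: "n \<ge> 1"
  shows "post_hoc_loss (H_mix_iwr X R \<kappa>) \<mu> n \<omega> =
    ennreal (I_fun R (self_norm (\<lambda>i \<omega>. X i \<omega> - \<mu>) n \<omega>) ((\<kappa>\<^sup>2 + 1) / (2 * \<kappa>\<^sup>2)) / Z_const R \<kappa>)"
proof -
  define u where "u = (\<kappa>\<^sup>2 + 1) / (2 * \<kappa>\<^sup>2)"
  define Z where "Z = Z_const R \<kappa>"
  define T where "T = self_norm (\<lambda>i \<omega>. X i \<omega> - \<mu>) n \<omega>"
  have u: "u > 0" using \<kappa> by (simp add: u_def add_pos_pos)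
  have Z: "Z > 0" unfolding Z_def Z_const_eq_I_fun[OF \<kappa>] using R \<kappa> by (intro I_fun_pos) auto
  have T: "0 \<le> T" "T \<le> sqrt (real n)" by (simp_all add: T_def self_norm_nonneg self_norm_le)
  have loss: "post_hoc_loss (H_mix_iwr X R \<kappa>) \<mu> n \<omega> =
      (SUP \<alpha>\<in>{0<..}. ennreal (of_bool (\<mu> \<notin> H_mix_iwr X R \<kappa> n \<alpha> \<omega>) / \<alpha>))" (is "_ = ?sup")
    by (simp add: post_hoc_loss_def)
  have "ennreal (of_bool (\<mu> \<notin> H_mix_iwr X R \<kappa> n \<alpha> \<omega>) / \<alpha>) \<le> ennreal (I_fun R T u / Z)"
    if \<alpha>: "\<alpha> > 0" for \<alpha>
  proof (cases "\<exists>y. solves_y_star R \<kappa> \<alpha> y")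
    case False
    then have "\<not> I_fun R 0 u \<le> Z / \<alpha>"
      using I_fun_solvable[OF R u, of "Z / \<alpha>"] by (auto simp: solves_y_star_def u_def Z_def)
    then have "Z / \<alpha> \<le> I_fun R T u"
      using I_fun_mono[OF R u, of 0 T] T by simp
    then have "1 / \<alpha> \<le> I_fun R T u / Z"
      using Z \<alpha> by (simp add: field_simps)
    moreover have "of_bool (\<mu> \<notin> H_mix_iwr X R \<kappa> n \<alpha> \<omega>) / \<alpha> \<le> 1 / \<alpha>"
      using \<alpha> by (simp add: divide_right_mono)
    ultimately show ?thesis by (intro ennreal_leI) simp
  next
    case True
    then obtain y where y: "solves_y_star R \<kappa> \<alpha> y" by blast
    then have y0: "0 \<le> y" "I_fun R y u = Z / \<alpha>" by (auto simp: solves_y_star_def u_def Z_def)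
    note ys = y_star_eq[OF R \<kappa> y]
    show ?thesis
    proof (cases "\<mu> \<in> H_mix_iwr X R \<kappa> n \<alpha> \<omega>")
      case False
      then have yn: "y\<^sup>2 < real n"
        using True by (auto simp: H_mix_iwr_def ys split: if_splits)
      then have "y \<le> T"
        using False True miscoverage_iff[OF n y0(1) yn, of \<mu> X \<omega>]
        by (simp add: H_mix_iwr_def W_mix_iwr_def ys T_def)
      then have "Z / \<alpha> \<le> I_fun R T u"
        using I_fun_mono[OF R u y0(1)] y0(2) by simp
      then show ?thesis
        using Z \<alpha> False by (intro ennreal_leI) (simp add: field_simps)
    qed simp
  qed
  then have "?sup \<le> ennreal (I_fun R T u / Z)"
    by (intro SUP_least) simp
  moreover have "ennreal (I_fun R T u / Z) \<le> ?sup"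
  proof -
    \<comment> \<open>every \<open>y \<le> T\<close> with \<open>y\<^sup>2 < n\<close> is the critical value of a level at which the interval misses \<open>\<mu>\<close>\<close>
    have att: "ennreal (I_fun R y u / Z) \<le> ?sup" if y: "0 \<le> y" "y \<le> T" "y < sqrt (real n)" for y
    proof -
      define \<alpha> where "\<alpha> = Z / I_fun R y u"
      have I: "I_fun R y u > 0" using I_fun_pos[OF R u y(1)] .
      have \<alpha>: "\<alpha> > 0" using I Z by (simp add: \<alpha>_def)
      have sol: "solves_y_star R \<kappa> \<alpha> y"
        using y Z I by (simp add: solves_y_star_def \<alpha>_def flip: u_def Z_def)
      have yn: "y\<^sup>2 < real n"
        using power_strict_mono[OF y(3,1), of 2] by simp
      have "\<mu> \<notin> H_mix_iwr X R \<kappa> n \<alpha> \<omega>"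
        using miscoverage_iff[OF n y(1) yn, of \<mu> X \<omega>] y(2) sol yn
        by (auto simp: H_mix_iwr_def W_mix_iwr_def y_star_eq[OF R \<kappa> sol] T_def)
      then have "ennreal (of_bool (\<mu> \<notin> H_mix_iwr X R \<kappa> n \<alpha> \<omega>) / \<alpha>) = ennreal (I_fun R y u / Z)"
        by (simp add: \<alpha>_def)
      then show ?thesis using \<alpha> by (intro SUP_upper2[of \<alpha>]) auto
    qed
    show ?thesis
    proof (cases "T = 0")
      case True
      then show ?thesis using att[of 0] n by simp
    next
      case False
      have "((\<lambda>y. ennreal (I_fun R y u / Z)) \<longlongrightarrow> ennreal (I_fun R T u / Z)) (at_left T)"
        using I_fun_isCont[OF u, of T R] Z
        by (intro tendsto_intros tendsto_ennrealI)
          (auto simp: isCont_def intro: filterlim_mono[OF _ order_refl at_le])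
      moreover have "\<forall>\<^sub>F y in at_left T. ennreal (I_fun R y u / Z) \<le> ?sup"
        using eventually_at_left_real[of 0 T] False T
        by (auto elim!: eventually_mono intro!: att)
      ultimately show ?thesis
        by (rule tendsto_upperbound) simp
    qed
  qed
  ultimately show ?thesis
    unfolding loss u_def T_def Z_def by (rule order_antisym)
qed

section \<open>Slow variation of the truncated variance\<close>

text \<open>A smooth version of \<open>min 1 (y\<^sup>2 / 2)\<close>. It is monotone in \<open>\<bar>y\<bar>\<close>, a Gaussian average of
  \<open>1 - cos (y * z)\<close> over \<open>z\<close>, and satisfies the doubling inequality below.\<close>

definition defect :: "real \<Rightarrow> real" where
  "defect y = 1 - exp (- y\<^sup>2 / 2)"

text \<open>Up to constants this is \<open>s\<^sup>2\<close> times the second moment truncated at \<open>1 / s\<close>, plus the tail probability beyond \<open>1 / s\<close>.\<close>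

definition trunc_var :: "real measure \<Rightarrow> real \<Rightarrow> real" where
  "trunc_var Q s = (LINT x|Q. defect (s * x))"

lemma defect_nonneg: "0 \<le> defect y"
  by (simp add: defect_def)

lemma defect_le_1: "defect y \<le> 1"
  by (simp add: defect_def)

lemma defect_pos: "y \<noteq> 0 \<Longrightarrow> 0 < defect y"
  by (simp add: defect_def)

lemma defect_mono: "\<bar>y\<bar> \<le> \<bar>z\<bar> \<Longrightarrow> defect y \<le> defect z"
  by (simp add: defect_def abs_le_square_iff)

text \<open>With \<open>q = exp (- y\<^sup>2 / 2)\<close> the difference \<open>4 * (1 - q) - (1 - q ^ 4)\<close> has a double zero at \<open>q = 1\<close>. Since
  the right-hand side is small in mean compared with the defect itself when the ratio at \<open>2 * s\<close> and \<open>s\<close> is nearly \<open>4\<close>,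
  so is the squared defect.\<close>

lemma defect_double: "3 * (defect y)\<^sup>2 \<le> 4 * defect y - defect (2 * y)"
proof -
  define q where "q = exp (- y\<^sup>2 / 2)"
  have q: "0 < q" "exp (- (2 * y)\<^sup>2 / 2) = q ^ 4"
    by (simp_all add: q_def flip: exp_of_nat_mult)
  have "0 \<le> (1 - q)\<^sup>2 * (2 * q + q\<^sup>2)"
    using q(1) by simp
  also have "\<dots> = 4 * (1 - q) - (1 - q ^ 4) - 3 * (1 - q)\<^sup>2"
    by algebra
  finally show ?thesis
    using q(2) by (simp add: defect_def q_def)
qed

lemma defect_measurable [measurable]: "defect \<in> borel_measurable borel"
  unfolding defect_def by measurable

lemma defect_quotient: "((\<lambda>y. defect y / y\<^sup>2) \<longlongrightarrow> 1 / 2) (at 0)"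
proof -
  have "((\<lambda>w::real. (exp w - 1) / w) \<longlongrightarrow> 1) (at 0)"
    using DERIV_exp[of "0::real"] by (simp add: has_field_derivative_iff)
  moreover have "filterlim (\<lambda>y::real. - y\<^sup>2 / 2) (at 0) (at 0)"
    unfolding filterlim_at by (auto intro!: tendsto_eq_intros simp: eventually_at intro!: exI[of _ 1])
  ultimately have "((\<lambda>y::real. (exp (- y\<^sup>2 / 2) - 1) / (- y\<^sup>2 / 2)) \<longlongrightarrow> 1) (at 0)"
    by (rule filterlim_compose)
  then have "((\<lambda>y::real. 1 / 2 * ((exp (- y\<^sup>2 / 2) - 1) / (- y\<^sup>2 / 2))) \<longlongrightarrow> 1 / 2 * 1) (at 0)"
    by (rule tendsto_mult[OF tendsto_const])
  moreover have "1 / 2 * ((exp (- y\<^sup>2 / 2) - 1) / (- y\<^sup>2 / 2)) = defect y / y\<^sup>2" for y :: real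
    by (cases "y = 0") (simp_all add: defect_def field_simps)
  ultimately show ?thesis by simp
qed

context real_distribution
begin

lemma trunc_var_integrable [simp]: "integrable M (\<lambda>x. defect (s * x))"
  by (rule integrable_const_bound[where B = 1]) (auto simp: defect_nonneg defect_le_1)

lemma trunc_var_nonneg: "0 \<le> trunc_var M s"
  unfolding trunc_var_def by (intro integral_nonneg_AE) (simp add: defect_nonneg)

lemma trunc_var_mono: "0 \<le> s \<Longrightarrow> s \<le> t \<Longrightarrow> trunc_var M s \<le> trunc_var M t"
  unfolding trunc_var_def
  by (intro integral_mono trunc_var_integrable defect_mono) (simp add: abs_mult mult_right_mono)

lemma trunc_var_0 [simp]: "trunc_var M 0 = 0"
  by (simp add: trunc_var_def defect_def)

lemma trunc_var_isCont: "isCont (trunc_var M) s"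
  unfolding continuous_at_sequentially comp_def
proof (intro allI impI)
  fix f :: "nat \<Rightarrow> real" assume f: "f \<longlonglongrightarrow> s"
  show "(\<lambda>n. trunc_var M (f n)) \<longlonglongrightarrow> trunc_var M s"
    unfolding trunc_var_def
  proof (rule integral_dominated_convergence[where w = "\<lambda>_. 1"])
    show "AE x in M. (\<lambda>n. defect (f n * x)) \<longlonglongrightarrow> defect (s * x)"
      unfolding defect_def by (intro AE_I2 tendsto_intros f) simp
  qed (auto simp: defect_nonneg defect_le_1)
qed

lemma trunc_var_double:
  "3 * (LINT x|M. (defect (s * x))\<^sup>2) \<le> 4 * trunc_var M s - trunc_var M (2 * s)"
proof -
  have int2: "integrable M (\<lambda>x. (defect (s * x))\<^sup>2)"
    by (rule integrable_const_bound[where B = 1])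
      (auto simp: defect_nonneg defect_le_1 abs_square_le_1)
  have "(LINT x|M. 3 * (defect (s * x))\<^sup>2) \<le> (LINT x|M. 4 * defect (s * x) - defect ((2 * s) * x))"
    using defect_double
    by (intro integral_mono Bochner_Integration.integrable_diff integrable_mult_right int2
        trunc_var_integrable) (simp_all add: mult.assoc)
  then show ?thesis
    unfolding trunc_var_def
    by (subst (asm) Bochner_Integration.integral_diff) (simp_all only: integral_mult_right_zero
        integrable_mult_right trunc_var_integrable)
qed

end

text \<open>The ratio condition is equivalent to slow variation of the truncated variance, the classical
  criterion for attraction to the normal law. The ratio at the single factor \<open>2\<close> suffices because the function
  divided by \<open>s\<^sup>2\<close> is monotone.\<close>

locale centered_slowly_varying = real_distribution Q for Q :: "real measure" +
  assumes integrable_id: "integrable Q (\<lambda>x. x)"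
    and mean_zero: "(LINT x|Q. x) = 0"
    and ratio: "((\<lambda>s. trunc_var Q (2 * s) / trunc_var Q s) \<longlongrightarrow> 4) (at_right 0)"
begin

abbreviation "U \<equiv> trunc_var Q"

lemma trunc_var_pos:
  assumes "0 < s" shows "0 < U s"
proof -
  have "\<forall>\<^sub>F t in at_right 0. 3 < U (2 * t) / U t"
    using ratio by (rule order_tendstoD) simp
  then have "\<forall>\<^sub>F t in at_right 0. t < s \<and> 3 < U (2 * t) / U t \<and> 0 < t"
    using assms by (auto simp: eventually_conj_iff eventually_at_right_less
      intro: order_tendstoD(2)[OF tendsto_ident_at])
  then obtain t where t: "t < s" "3 < U (2 * t) / U t" "0 < t"
    using eventually_happens[of _ "at_right (0::real)"] by auto
  then have "U t \<noteq> 0" by auto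
  then have "0 < U t" using trunc_var_nonneg[of t] by simp
  also have "\<dots> \<le> U s" using t by (intro trunc_var_mono) auto
  finally show ?thesis .
qed

lemma eventually_trunc_var_triple:
  "\<exists>s0>0. \<forall>s. 0 < s \<and> s \<le> s0 \<longrightarrow> 3 * U s \<le> U (2 * s)"
proof -
  have "\<forall>\<^sub>F s in at_right 0. 3 < U (2 * s) / U s"
    using ratio by (rule order_tendstoD) simp
  then obtain b where b: "b > 0" "\<And>s. 0 < s \<Longrightarrow> s < b \<Longrightarrow> 3 < U (2 * s) / U s"
    unfolding eventually_at_right_field by blast
  show ?thesis
  proof (intro exI[of _ "b / 2"] conjI allI impI)
    fix s assume "0 < s \<and> s \<le> b / 2"
    then show "3 * U s \<le> U (2 * s)"
      using b(1) b(2)[of s] trunc_var_pos[of s] by (auto simp: pos_less_divide_eq)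
  qed (use b in simp)
qed

lemma square_defect_small:
  assumes "e > 0"
  shows "\<forall>\<^sub>F s in at_right 0. (LINT x|Q. (defect (s * x))\<^sup>2) \<le> e * U s"
proof -
  have "\<forall>\<^sub>F s in at_right 0. 4 - 3 * e < U (2 * s) / U s"
    using ratio by (rule order_tendstoD) (use assms in simp)
  moreover have "\<forall>\<^sub>F s::real in at_right 0. 0 < s"
    by (rule eventually_at_right_less)
  ultimately show ?thesis
  proof eventually_elim
    case (elim s)
    then show ?case
      using trunc_var_double[of s] trunc_var_pos[of s]
      by (simp add: pos_less_divide_eq left_diff_distrib)
  qed
qed

text \<open>Karamata's estimate for the tail of the first absolute moment. Cutting at twice the threshold
  compares the tail at \<open>s\<close> with twice the tail at \<open>s / 2\<close>, up to an error of smaller order than \<open>U s\<close>. Halving a small \<open>s\<close> divides \<open>U\<close> by at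
  least \<open>3\<close>, so the errors in the iteration form a geometric series with ratio \<open>2 / 3\<close>, and the remaining tail vanishes
  since the first moment is finite.\<close>

lemma linear_tail_small:
  assumes "\<eta> > 0" "e > 0"
  shows "\<forall>\<^sub>F s in at_right 0.
    (LINT x|Q. \<bar>s * x\<bar> * indicator {x. \<eta> \<le> \<bar>s * x\<bar>} x) \<le> e * U s"
proof -
  define J where "J s = (LINT x|Q. \<bar>s * x\<bar> * indicator {x. \<eta> \<le> \<bar>s * x\<bar>} x)" for s
  define c where "c = 2 * \<eta> / (defect \<eta>)\<^sup>2"
  have c: "c > 0" using assms defect_pos[of \<eta>] by (simp add: c_def)
  have intJ: "integrable Q (\<lambda>x. \<bar>s * x\<bar> * indicator {x. \<eta> \<le> \<bar>s * x\<bar>} x)" for s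
    by (rule Bochner_Integration.integrable_bound[OF integrable_mult_right[OF integrable_id, of s]])
      (auto simp: indicator_def)
  have int2: "integrable Q (\<lambda>x. (defect (s * x))\<^sup>2)" for s
    by (rule integrable_const_bound[where B = 1])
      (auto simp: defect_nonneg defect_le_1 abs_square_le_1)
  \<comment> \<open>splitting at twice the threshold: the shell is paid for by the squared defect\<close>
  have step: "J s \<le> c * (LINT x|Q. (defect (s * x))\<^sup>2) + 2 * J (s / 2)" for s
  proof -
    have "J s \<le> (LINT x|Q. c * (defect (s * x))\<^sup>2 +
        2 * (\<bar>s / 2 * x\<bar> * indicator {x. \<eta> \<le> \<bar>s / 2 * x\<bar>} x))"
      unfolding J_def
    proof (intro integral_mono Bochner_Integration.integrable_add integrable_mult_right int2 intJ)
      fix x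
      show "\<bar>s * x\<bar> * indicator {x. \<eta> \<le> \<bar>s * x\<bar>} x \<le> c * (defect (s * x))\<^sup>2 +
          2 * (\<bar>s / 2 * x\<bar> * indicator {x. \<eta> \<le> \<bar>s / 2 * x\<bar>} x)"
      proof (cases "\<eta> \<le> \<bar>s * x\<bar> \<and> \<not> \<eta> \<le> \<bar>s / 2 * x\<bar>")
        case True
        then have "(defect \<eta>)\<^sup>2 \<le> (defect (s * x))\<^sup>2"
          using assms by (intro power_mono defect_mono defect_nonneg) auto
        then have "2 * \<eta> \<le> c * (defect (s * x))\<^sup>2"
          using assms defect_pos[of \<eta>] unfolding c_def by (simp add: field_simps)
        with True show ?thesis by (simp add: indicator_def abs_mult)
      next
        case False
        have "0 \<le> c * (defect (s * x))\<^sup>2" using c by simp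
        with False show ?thesis by (auto simp: indicator_def abs_mult)
      qed
    qed
    then show ?thesis
      unfolding J_def using int2 intJ[of "s/2"]
      by (subst (asm) Bochner_Integration.integral_add) (auto simp del: times_divide_eq_left)
  qed
  obtain s0 where s0: "s0 > 0" "\<And>s. 0 < s \<Longrightarrow> s \<le> s0 \<Longrightarrow> 3 * U s \<le> U (2 * s)"
    using eventually_trunc_var_triple by blast
  \<comment> \<open>\<open>e = d * (1 + 2/3 + (2/3)\<^sup>2 + \<dots>)\<close>: the invariant \<open>d + 2 * (e / 3) \<le> e\<close> carries the iteration\<close>
  define d where "d = e / 3"
  have "\<forall>\<^sub>F s in at_right 0. (LINT x|Q. (defect (s * x))\<^sup>2) \<le> d / c * U s"
    using assms c by (intro square_defect_small) (simp add: d_def)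
  then obtain b where b: "b > 0"
    "\<And>s. 0 < s \<Longrightarrow> s < b \<Longrightarrow> (LINT x|Q. (defect (s * x))\<^sup>2) \<le> d / c * U s"
    unfolding eventually_at_right_field by blast
  have iter: "J s \<le> e * U s + 2 ^ K * J (s / 2 ^ K)" if "0 < s" "s < min b s0" for s K
    using that
  proof (induction K arbitrary: s)
    case 0
    then show ?case using trunc_var_nonneg[of s] assms by simp
  next
    case (Suc K)
    have "J s \<le> d * U s + 2 * J (s / 2)"
      using step[of s] b(2)[of s] Suc.prems c by (simp add: field_simps)
    also have "\<dots> \<le> d * U s + 2 * (e * U (s / 2) + 2 ^ K * J (s / 2 / 2 ^ K))"
      using Suc.IH[of "s / 2"] Suc.prems by simp
    also have "e * U (s / 2) \<le> d * U s"
      using s0(2)[of "s / 2"] Suc.prems assms by (simp add: d_def)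
    finally show ?case
      by (simp add: d_def field_simps)
  qed
  have van: "(\<lambda>K. 2 ^ K * J (s / 2 ^ K)) \<longlonglongrightarrow> 0" if s: "s > 0" for s
  proof -
    have "(\<lambda>K. (LINT x|Q. \<bar>s * x\<bar> * indicator {x. \<eta> \<le> \<bar>s / 2 ^ K * x\<bar>} x)) \<longlonglongrightarrow> (LINT x|Q. 0)"
    proof (rule integral_dominated_convergence[where w = "\<lambda>x. \<bar>s * x\<bar>"])
      show "AE x in Q. (\<lambda>K. \<bar>s * x\<bar> * indicator {x. \<eta> \<le> \<bar>s / 2 ^ K * x\<bar>} x) \<longlonglongrightarrow> 0"
      proof (intro AE_I2 tendsto_eventually)
        fix x
        have "(\<lambda>K. \<bar>s * x\<bar> * (1 / 2) ^ K) \<longlonglongrightarrow> 0"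
          by (intro tendsto_mult_right_zero LIMSEQ_realpow_zero) auto
        then have "\<forall>\<^sub>F K in sequentially. \<bar>s * x\<bar> * (1 / 2) ^ K < \<eta>"
          by (rule order_tendstoD(2)) (rule assms)
        then show "\<forall>\<^sub>F K in sequentially. \<bar>s * x\<bar> * indicator {x. \<eta> \<le> \<bar>s / 2 ^ K * x\<bar>} x = 0"
          by eventually_elim (auto simp: indicator_def abs_mult power_divide)
      qed
      show "integrable Q (\<lambda>x. \<bar>s * x\<bar>)"
        by (intro integrable_abs integrable_mult_right integrable_id)
    qed (simp_all add: indicator_def)
    moreover have "2 ^ K * J (s / 2 ^ K) = (LINT x|Q. \<bar>s * x\<bar> * indicator {x. \<eta> \<le> \<bar>s / 2 ^ K * x\<bar>} x)" for K
      unfolding J_def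
      by (subst integral_mult_right_zero[symmetric]) (simp add: abs_mult)
    ultimately show ?thesis by simp
  qed
  show ?thesis
    unfolding eventually_at_right_field J_def[symmetric]
  proof (intro exI[of _ "min b s0"] conjI allI impI)
    fix s assume s: "0 < s" "s < min b s0"
    have "(\<lambda>K. e * U s + 2 ^ K * J (s / 2 ^ K)) \<longlonglongrightarrow> e * U s + 0"
      by (intro tendsto_intros van s)
    then show "J s \<le> e * U s"
      using iter[OF s] by (intro LIMSEQ_le_const) auto
  qed (use b s0 in auto)
qed

text \<open>Near \<open>0\<close> the function \<open>h\<close> is \<open>2 * \<beta>\<close> times the defect up to a small multiple of the defect; away from
  \<open>0\<close> the difference is bounded by a multiple of \<open>\<bar>y\<bar>\<close>, whose expectation lemma
  \<open>linear_tail_small\<close> controls.\<close>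

lemma expectation_asymp:
  assumes [measurable]: "h \<in> borel_measurable borel"
    and lin: "\<And>y. \<bar>h y\<bar> \<le> C * \<bar>y\<bar>"
    and quad: "((\<lambda>y. h y / y\<^sup>2) \<longlongrightarrow> \<beta>) (at 0)"
  shows "((\<lambda>s. (LINT x|Q. h (s * x)) / U s) \<longlongrightarrow> 2 * \<beta>) (at_right 0)"
proof (rule tendstoI)
  fix e :: real assume e: "e > 0"
  have "((\<lambda>y. (h y - 2 * \<beta> * defect y) / y\<^sup>2) \<longlongrightarrow> \<beta> - 2 * \<beta> * (1 / 2)) (at 0)"
    unfolding diff_divide_distrib times_divide_eq_right[symmetric]
    by (intro tendsto_intros quad defect_quotient)
  from tendsto_divide[OF this defect_quotient]
  have "((\<lambda>y. ((h y - 2 * \<beta> * defect y) / y\<^sup>2) / (defect y / y\<^sup>2)) \<longlongrightarrow> 0) (at 0)"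
    by simp
  then have "\<forall>\<^sub>F y in at 0. \<bar>((h y - 2 * \<beta> * defect y) / y\<^sup>2) / (defect y / y\<^sup>2)\<bar> < e / 3"
    by (rule order_tendstoD(2)[OF tendsto_rabs_zero]) (simp add: e)
  then obtain \<eta> where \<eta>: "\<eta> > 0" "\<And>y. y \<noteq> 0 \<Longrightarrow> \<bar>y\<bar> < \<eta> \<Longrightarrow>
      \<bar>((h y - 2 * \<beta> * defect y) / y\<^sup>2) / (defect y / y\<^sup>2)\<bar> < e / 3"
    unfolding eventually_at by (auto simp: dist_real_def)
  have C: "C \<ge> 0" using lin[of 1] by simp
  have h0: "h 0 = 0" using lin[of 0] by simp
  define D where "D = C + 2 * \<bar>\<beta>\<bar> / \<eta>"
  have D: "D \<ge> 0" using C \<eta> by (simp add: D_def)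
  have pt: "\<bar>h y - 2 * \<beta> * defect y\<bar> \<le> e / 3 * defect y + D * (\<bar>y\<bar> * indicator {y. \<eta> \<le> \<bar>y\<bar>} y)" for y
  proof (cases "y = 0")
    case True then show ?thesis using h0 by (simp add: defect_def)
  next
    case y: False
    show ?thesis
    proof (cases "\<bar>y\<bar> < \<eta>")
      case True
      have "\<bar>(h y - 2 * \<beta> * defect y) / defect y\<bar> < e / 3"
        using \<eta>(2)[OF y True] y by simp
      then show ?thesis
        using defect_pos[OF y] True by (simp add: abs_divide divide_simps indicator_def)
    next
      case False
      have "\<bar>h y - 2 * \<beta> * defect y\<bar> \<le> \<bar>h y\<bar> + \<bar>2 * \<beta> * defect y\<bar>" by simp
      also have "\<dots> \<le> C * \<bar>y\<bar> + 2 * \<bar>\<beta>\<bar> * 1"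
        using lin[of y] defect_nonneg[of y] mult_left_mono[OF defect_le_1[of y], of "2 * \<bar>\<beta>\<bar>"]
        by (simp add: abs_mult)
      also have "2 * \<bar>\<beta>\<bar> * 1 \<le> 2 * \<bar>\<beta>\<bar> / \<eta> * \<bar>y\<bar>"
        using False \<eta>(1) mult_left_mono[of \<eta> "\<bar>y\<bar>" "\<bar>\<beta>\<bar>"] by (simp add: field_simps)
      finally have "\<bar>h y - 2 * \<beta> * defect y\<bar> \<le> D * \<bar>y\<bar>" by (simp add: D_def algebra_simps)
      moreover have "0 \<le> e / 3 * defect y" using e defect_nonneg by simp
      ultimately show ?thesis using False by simp
    qed
  qed
  have "\<forall>\<^sub>F s in at_right 0. (LINT x|Q. \<bar>s * x\<bar> * indicator {x. \<eta> \<le> \<bar>s * x\<bar>} x)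
      \<le> e / (3 * (D + 1)) * U s"
    using \<eta> e D by (intro linear_tail_small) auto
  moreover have "\<forall>\<^sub>F s::real in at_right 0. 0 < s"
    by (rule eventually_at_right_less)
  ultimately show "\<forall>\<^sub>F s in at_right 0. dist ((LINT x|Q. h (s * x)) / U s) (2 * \<beta>) < e"
  proof eventually_elim
    case (elim s)
    let ?U = "U s"
    have U: "?U > 0" using elim by (intro trunc_var_pos)
    have inth: "integrable Q (\<lambda>x. h (s * x))"
      by (rule Bochner_Integration.integrable_bound[OF integrable_mult_right[OF integrable_id, of "C * s"]])
        (use lin[of "s * _"] C in \<open>simp_all add: abs_mult mult.assoc\<close>)
    have intJ: "integrable Q (\<lambda>x. \<bar>s * x\<bar> * indicator {y. \<eta> \<le> \<bar>y\<bar>} (s * x))"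
      by (rule Bochner_Integration.integrable_bound[OF integrable_mult_right[OF integrable_id, of s]])
        (auto simp: indicator_def)
    have "\<bar>(LINT x|Q. h (s * x)) - 2 * \<beta> * ?U\<bar> = \<bar>LINT x|Q. h (s * x) - 2 * \<beta> * defect (s * x)\<bar>"
      unfolding trunc_var_def using inth by (subst Bochner_Integration.integral_diff) auto
    also have "\<dots> \<le> (LINT x|Q. \<bar>h (s * x) - 2 * \<beta> * defect (s * x)\<bar>)"
      by (rule integral_abs_bound)
    also have "\<dots> \<le> (LINT x|Q. e / 3 * defect (s * x) + D * (\<bar>s * x\<bar> * indicator {y. \<eta> \<le> \<bar>y\<bar>} (s * x)))"
      using inth intJ by (intro integral_mono pt) auto
    also have "\<dots> = e / 3 * ?U + D * (LINT x|Q. \<bar>s * x\<bar> * indicator {y. \<eta> \<le> \<bar>y\<bar>} (s * x))"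
      unfolding trunc_var_def using intJ by (subst Bochner_Integration.integral_add) auto
    also have "(LINT x|Q. \<bar>s * x\<bar> * indicator {y. \<eta> \<le> \<bar>y\<bar>} (s * x)) =
        (LINT x|Q. \<bar>s * x\<bar> * indicator {x. \<eta> \<le> \<bar>s * x\<bar>} x)"
      by (simp add: indicator_def)
    also have "e / 3 * ?U + D * \<dots> \<le> e / 3 * ?U + D * (e / (3 * (D + 1)) * ?U)"
      using elim(1) D by (intro add_left_mono mult_left_mono)
    also have "D * (e / (3 * (D + 1)) * ?U) \<le> e / 3 * ?U"
      using D e U by (simp add: field_simps)
    finally have "\<bar>(LINT x|Q. h (s * x)) - 2 * \<beta> * ?U\<bar> < e * ?U"
      using mult_pos_pos[OF e U] by linarith
    moreover have "(LINT x|Q. h (s * x)) / ?U - 2 * \<beta> = ((LINT x|Q. h (s * x)) - 2 * \<beta> * ?U) / ?U"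
      using U by (simp add: field_simps)
    ultimately show ?case
      using U by (simp add: dist_real_def abs_divide pos_divide_less_eq)
  qed
qed

end

section \<open>Slow variation from characteristic functions\<close>

text \<open>One minus the real part of the characteristic function.\<close>

definition cos_defect :: "real measure \<Rightarrow> real \<Rightarrow> real" where
  "cos_defect Q s = (LINT x|Q. 1 - cos (s * x))"

lemma abs_sin_mult_le: "\<bar>sin (real m * x)\<bar> \<le> real m * \<bar>sin x\<bar>"
proof (induction m)
  case (Suc m)
  have "\<bar>sin (real (Suc m) * x)\<bar> = \<bar>sin (real m * x) * cos x + cos (real m * x) * sin x\<bar>"
    using sin_add[of "real m * x" x] by (simp add: distrib_right add.commute)
  also have "\<dots> \<le> \<bar>sin (real m * x)\<bar> * \<bar>cos x\<bar> + \<bar>cos (real m * x)\<bar> * \<bar>sin x\<bar>"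
    unfolding abs_mult[symmetric] by (rule abs_triangle_ineq)
  also have "\<dots> \<le> \<bar>sin (real m * x)\<bar> * 1 + 1 * \<bar>sin x\<bar>"
    by (intro add_mono mult_left_mono mult_right_mono) auto
  finally show ?case using Suc by (simp add: distrib_right)
qed simp

lemma one_minus_cos: "1 - cos x = 2 * (sin (x / 2))\<^sup>2" for x :: real
  using cos_double_sin[of "x / 2"] by simp

text \<open>It carries bounds of \<open>cos_defect\<close> near \<open>0\<close> to larger arguments, at the price of a quadratic factor.\<close>

lemma one_minus_cos_mult_le: "1 - cos (real m * x) \<le> (real m)\<^sup>2 * (1 - cos x)"
proof -
  have "(sin (real m * (x / 2)))\<^sup>2 \<le> (real m * \<bar>sin (x / 2)\<bar>)\<^sup>2"
    using abs_sin_mult_le[of m "x / 2"] by (subst abs_le_square_iff[symmetric]) simp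
  then show ?thesis by (simp add: one_minus_cos power_mult_distrib)
qed

lemma one_minus_cos_ge:
  assumes "\<bar>x\<bar> \<le> 1" shows "x\<^sup>2 / 4 \<le> 1 - cos (x::real)"
proof -
  define w where "w = x / 2"
  have w: "\<bar>w\<bar> \<le> 1 / 2" using assms by (simp add: w_def)
  have "\<bar>sin w - w\<bar> \<le> \<bar>w\<bar> ^ 3 / 6"
    using Maclaurin_sin_bound[of w 3] by (simp add: numeral_3_eq_3 sin_coeff_def fact_numeral)
  also have "\<bar>w\<bar> ^ 3 / 6 = \<bar>w\<bar> * (\<bar>w\<bar>\<^sup>2) / 6" by (simp add: power3_eq_cube power2_eq_square)
  also have "\<dots> \<le> \<bar>w\<bar> * (1 / 4) / 6"
    using power_mono[OF w, of 2] by (intro divide_right_mono mult_left_mono) (auto simp: power_divide)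
  finally have "\<bar>sin w - w\<bar> \<le> \<bar>w\<bar> / 24" by simp
  then have "3 / 4 * \<bar>w\<bar> \<le> \<bar>sin w\<bar>" by linarith
  then have "(3 / 4 * \<bar>w\<bar>)\<^sup>2 \<le> \<bar>sin w\<bar>\<^sup>2" by (rule power_mono) simp
  then have "9 / 16 * w\<^sup>2 \<le> (sin w)\<^sup>2" by (simp add: power_mult_distrib power_divide)
  then have "w\<^sup>2 \<le> 2 * (sin w)\<^sup>2" using zero_le_power2[of w] by linarith
  then show ?thesis by (simp add: one_minus_cos w_def power_divide)
qed

lemma std_normal_cos: "(LINT z|std_normal_distribution. cos (w * z)) = exp (- w\<^sup>2 / 2)"
proof -
  interpret N: real_distribution std_normal_distribution by (rule real_dist_normal_dist)
  have "(LINT z|std_normal_distribution. cos (w * z)) = Re (char std_normal_distribution w)"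
    unfolding char_def by (subst integral_Re[symmetric]) (auto intro!: N.integrable_iexp simp: Re_exp)
  then show ?thesis by (simp add: char_std_normal_distribution del: of_real_exp)
qed

context real_distribution
begin

lemma prob_UNIV: "prob UNIV = 1"
  using prob_space by simp

lemma integrable_cos: "integrable M (\<lambda>x. 1 - cos (s * x))"
proof (rule integrable_const_bound[where B = 2])
  have "norm (1 - cos (s * x)) \<le> 2" for x
    using cos_ge_minus_one[of "s * x"] by simp
  then show "AE x in M. norm (1 - cos (s * x)) \<le> 2" by simp
qed simp

lemma cos_defect_nonneg: "0 \<le> cos_defect M s"
  unfolding cos_defect_def by (intro integral_nonneg_AE) simp

lemma cos_defect_uminus [simp]: "cos_defect M (- s) = cos_defect M s"
  by (simp add: cos_defect_def)

lemma cos_defect_mult_le: "cos_defect M (real m * s) \<le> (real m)\<^sup>2 * cos_defect M s"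
proof -
  have "cos_defect M (real m * s) \<le> (LINT x|M. (real m)\<^sup>2 * (1 - cos (s * x)))"
    unfolding cos_defect_def using one_minus_cos_mult_le
    by (intro integral_mono integrable_mult_right integrable_cos) (simp add: mult.assoc)
  then show ?thesis by (simp add: cos_defect_def)
qed

lemma cos_defect_isCont: "isCont (cos_defect M) s"
  unfolding continuous_at_sequentially comp_def
proof (intro allI impI)
  fix f :: "nat \<Rightarrow> real" assume f: "f \<longlonglongrightarrow> s"
  show "(\<lambda>n. cos_defect M (f n)) \<longlonglongrightarrow> cos_defect M s"
    unfolding cos_defect_def
  proof (rule integral_dominated_convergence[where w = "\<lambda>_. 2"])
    show "AE x in M. (\<lambda>n. 1 - cos (f n * x)) \<longlonglongrightarrow> 1 - cos (s * x)"
      by (intro AE_I2 tendsto_intros f)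
    show "AE x in M. norm (1 - cos (f n * x)) \<le> 2" for n
    proof (rule AE_I2)
      fix x show "norm (1 - cos (f n * x)) \<le> 2"
        using cos_ge_minus_one[of "f n * x"] by simp
    qed
  qed auto
qed

lemma norm_char_power2: "(norm (char M s))\<^sup>2 = (1 - cos_defect M s)\<^sup>2 + (LINT x|M. sin (s * x))\<^sup>2"
proof -
  have "Re (char M s) = (LINT x|M. cos (s * x))"
    unfolding char_def by (subst integral_Re[symmetric]) (auto intro!: integrable_iexp simp: Re_exp)
  also have "\<dots> = 1 - cos_defect M s"
    using integrable_cos[of s] Bochner_Integration.integral_diff[OF integrable_const[of 1] integrable_cos[of s]]
    by (simp add: cos_defect_def prob_UNIV)
  finally have 1: "Re (char M s) = 1 - cos_defect M s" .
  have 2: "Im (char M s) = (LINT x|M. sin (s * x))"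
    unfolding char_def by (subst integral_Im[symmetric]) (auto intro!: integrable_iexp simp: Im_exp)
  show ?thesis unfolding cmod_power2 1 2 ..
qed

text \<open>The standard normal characteristic function at \<open>s * x\<close> is \<open>1\<close> minus the defect. The mixture makes
  the truncated variance accessible from characteristic functions and, unlike \<open>cos_defect\<close>, it is monotone
  in \<open>s\<close>.\<close>

lemma trunc_var_eq_gaussian_mixture:
  "trunc_var M s = (LINT z|std_normal_distribution. cos_defect M (s * z))"
proof -
  interpret N: real_distribution std_normal_distribution by (rule real_dist_normal_dist)
  interpret pair_prob_space M std_normal_distribution ..
  have "trunc_var M s = (LINT x|M. (LINT z|std_normal_distribution. 1 - cos (s * z * x)))"
    unfolding trunc_var_def
  proof (rule Bochner_Integration.integral_cong)
    fix x
    have "(LINT z|std_normal_distribution. 1 - cos (s * z * x)) =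
        (LINT z|std_normal_distribution. 1 - cos ((s * x) * z))"
      by (simp add: mult_ac)
    also have "\<dots> = 1 - exp (- (s * x)\<^sup>2 / 2)"
    proof (subst Bochner_Integration.integral_diff)
      show "integrable std_normal_distribution (\<lambda>z. cos ((s * x) * z))"
        by (rule N.integrable_const_bound[where B = 1]) auto
    qed (use N.prob_space in \<open>simp_all add: std_normal_cos\<close>)
    finally show "defect (s * x) = (LINT z|std_normal_distribution. 1 - cos (s * z * x))"
      by (simp add: defect_def)
  qed simp
  also have "\<dots> = (LINT z|std_normal_distribution. (LINT x|M. 1 - cos (s * z * x)))"
  proof (rule Fubini_integral[symmetric])
    show "integrable (M \<Otimes>\<^sub>M std_normal_distribution) (\<lambda>(x, z). 1 - cos (s * z * x))"
    proof (rule P.integrable_const_bound[where B = 2])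
      have "norm (1 - cos (s * z * x)) \<le> 2" for x z
        using cos_ge_minus_one[of "s * z * x"] by simp
      then show "AE x in M \<Otimes>\<^sub>M std_normal_distribution. norm (case x of (x, z) \<Rightarrow> 1 - cos (s * z * x)) \<le> 2"
        by (simp add: split_beta)
    qed simp
  qed
  finally show ?thesis by (simp add: cos_defect_def)
qed

text \<open>The real part of the characteristic function is an expected cosine. The cosine is at least
  \<open>7 / 8\<close> on \<open>[- K, K]\<close> and at least \<open>- 1\<close> elsewhere.\<close>

lemma norm_char_ge_of_tight:
  assumes K: "1 - cdf M K + cdf M (- K) \<le> 1 / 10" "K > 0" and t: "\<bar>t\<bar> * K \<le> 1 / 2"
  shows "1 / 2 \<le> norm (char M t)"
proof -
  have "cdf M K - cdf M (- K) = prob {- K<..K}" using K by (intro cdf_diff_eq) auto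
  then have p: "9 / 10 \<le> prob {- K<..K}" using K by simp
  have cos_low: "3 * indicator {- K<..K} x - 2 \<le> cos (t * x) + 1 / 8" for x
  proof (cases "x \<in> {- K<..K}")
    case True
    then have "\<bar>t * x\<bar> \<le> \<bar>t\<bar> * K" by (auto simp: abs_mult intro!: mult_left_mono)
    with t have "\<bar>t * x\<bar> \<le> 1 / 2" by simp
    then have "(t * x)\<^sup>2 \<le> (1 / 2)\<^sup>2" by (subst abs_le_square_iff[symmetric]) simp
    moreover have "1 - cos (t * x) \<le> (t * x)\<^sup>2 / 2"
    proof -
      have "(sin (t * x / 2))\<^sup>2 \<le> (t * x / 2)\<^sup>2"
        using abs_sin_le_one abs_sin_x_le_abs_x[of "t * x / 2"] by (subst abs_le_square_iff[symmetric]) simp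
      then show ?thesis by (simp add: one_minus_cos power_divide)
    qed
    ultimately show ?thesis using True by (simp add: power_divide)
  next
    case False
    then have "indicator {- K<..K} x = (0::real)" by (rule indicator_simps(2))
    with cos_ge_minus_one[of "t * x"] show ?thesis by linarith
  qed
  have intc: "integrable M (\<lambda>x. cos (t * x))"
    by (rule integrable_const_bound[where B = 1]) auto
  have "3 * prob {- K<..K} - 2 = (LINT x|M. 3 * indicator {- K<..K} x - 2)"
    by (subst Bochner_Integration.integral_diff) (simp_all add: prob_UNIV emeasure_eq_measure)
  also have "\<dots> \<le> (LINT x|M. cos (t * x) + 1 / 8)"
    using intc by (intro integral_mono cos_low Bochner_Integration.integrable_diff
        Bochner_Integration.integrable_add integrable_mult_right integrable_real_indicator integrable_const)
      (simp_all add: emeasure_eq_measure)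
  also have "\<dots> = (LINT x|M. cos (t * x)) + 1 / 8"
    using intc by (subst Bochner_Integration.integral_add) (simp_all add: prob_UNIV)
  also have "(LINT x|M. cos (t * x)) = Re (char M t)"
    unfolding char_def by (subst integral_Re[symmetric]) (auto intro!: integrable_iexp simp: Re_exp)
  also have "Re (char M t) + 1 / 8 \<le> norm (char M t) + 1 / 8"
    by (simp add: complex_Re_le_cmod)
  finally show ?thesis using p by simp
qed

end

text \<open>What the convergence to the normal law says about a single observation: the left-hand sides are
  the moduli of the characteristic functions of the normalised sums, where the centring has disappeared. The
  uniform lower bound expresses tightness.\<close>

locale char_attracted = real_distribution Q for Q :: "real measure" +
  fixes a :: "nat \<Rightarrow> real" and \<delta> :: real
  assumes integrable_id: "integrable Q (\<lambda>x. x)"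
    and mean_zero: "(LINT x|Q. x) = 0"
    and a_pos: "0 < a n"
    and char_lim: "(\<lambda>n. norm (char Q (t / a n)) ^ n) \<longlonglongrightarrow> exp (- t\<^sup>2 / 2)"
    and \<delta>_pos: "0 < \<delta>"
    and char_low: "\<forall>\<^sub>F n in sequentially. \<forall>t. \<bar>t\<bar> \<le> \<delta> \<longrightarrow> 1 / 2 \<le> norm (char Q (t / a n)) ^ n"
begin

abbreviation "U \<equiv> trunc_var Q"
abbreviation "g \<equiv> cos_defect Q"

lemma nondegenerate: "\<not> (AE x in Q. x = 0)"
proof
  assume ae: "AE x in Q. x = 0"
  have "char Q s = 1" for s
  proof -
    have "char Q s = (CLINT x|Q. 1)"
      unfolding char_def using ae by (intro integral_cong_AE) (auto elim!: eventually_mono)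
    then show ?thesis using prob_space by simp
  qed
  then have "(\<lambda>n. 1) \<longlonglongrightarrow> exp (- (1::real)\<^sup>2 / 2)"
    using char_lim[of 1] by simp
  then have "exp (- (1::real)\<^sup>2 / 2) = 1"
    by (rule LIMSEQ_unique) simp
  then show False by simp
qed

lemma cos_defect_quadratic_lower: "\<exists>c>0. \<forall>\<^sub>F s in at_right 0. c * s\<^sup>2 \<le> g s"
proof -
  have intk: "integrable Q (\<lambda>x. x\<^sup>2 * indicator {x. \<bar>x\<bar> \<le> K} x)" for K :: real
  proof (rule integrable_const_bound[where B = "K\<^sup>2"])
    have "x\<^sup>2 * indicator {x. \<bar>x\<bar> \<le> K} x \<le> K\<^sup>2" for x :: real
      using abs_le_square_iff[of x K] by (auto simp: indicator_def)
    then show "AE x in Q. norm (x\<^sup>2 * indicator {x. \<bar>x\<bar> \<le> K} x) \<le> K\<^sup>2" by simp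
  qed simp
  have "\<exists>K::nat. 0 < (LINT x|Q. x\<^sup>2 * indicator {x. \<bar>x\<bar> \<le> real K} x)"
  proof (rule ccontr)
    assume "\<not> ?thesis"
    then have "(LINT x|Q. x\<^sup>2 * indicator {x. \<bar>x\<bar> \<le> real K} x) = 0" for K :: nat
      by (intro antisym integral_nonneg_AE) (auto simp: not_less)
    then have "AE x in Q. x\<^sup>2 * indicator {x. \<bar>x\<bar> \<le> real K} x = 0" for K :: nat
      by (subst (asm) integral_nonneg_eq_0_iff_AE[OF intk]) auto
    then have "AE x in Q. \<forall>K::nat. x\<^sup>2 * indicator {x. \<bar>x\<bar> \<le> real K} x = 0"
      by (subst AE_all_countable) auto
    then have "AE x in Q. x = 0"
    proof (rule AE_mp, intro AE_I2 impI)
      fix x :: real assume "\<forall>K::nat. x\<^sup>2 * indicator {x. \<bar>x\<bar> \<le> real K} x = 0"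
      moreover obtain K :: nat where "\<bar>x\<bar> \<le> real K" using real_arch_simple by blast
      ultimately show "x = 0" by (auto simp: indicator_def dest!: spec[of _ K])
    qed
    then show False using nondegenerate by simp
  qed
  then obtain K :: nat where K: "0 < (LINT x|Q. x\<^sup>2 * indicator {x. \<bar>x\<bar> \<le> real K} x)" (is "0 < ?k") by blast
  have "\<forall>\<^sub>F s::real in at_right 0. 0 < s \<and> s < 1 / (real K + 1)"
    by (auto simp: eventually_conj_iff eventually_at_right_less
      intro!: order_tendstoD(2)[OF tendsto_ident_at])
  then have "\<forall>\<^sub>F s in at_right 0. ?k / 4 * s\<^sup>2 \<le> g s"
  proof eventually_elim
    case (elim s)
    have "?k / 4 * s\<^sup>2 = (LINT x|Q. s\<^sup>2 / 4 * (x\<^sup>2 * indicator {x. \<bar>x\<bar> \<le> real K} x))" by simp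
    also have "\<dots> \<le> g s"
      unfolding cos_defect_def
    proof (intro integral_mono integrable_mult_right intk integrable_cos)
      fix x
      show "s\<^sup>2 / 4 * (x\<^sup>2 * indicator {x. \<bar>x\<bar> \<le> real K} x) \<le> 1 - cos (s * x)"
      proof (cases "\<bar>x\<bar> \<le> real K")
        case True
        have "\<bar>s * x\<bar> \<le> 1 / (real K + 1) * (real K + 1)"
          unfolding abs_mult using elim True by (intro mult_mono) auto
        then have "\<bar>s * x\<bar> \<le> 1" by simp
        then show ?thesis
          using one_minus_cos_ge[of "s * x"] True by (simp add: power_mult_distrib)
      qed simp
    qed
    finally show ?case .
  qed
  then show ?thesis using K by (intro exI[of _ "?k / 4"]) simp
qed

text \<open>Dominated convergence to the mean, which is zero: \<open>sin (s * x) / s\<close> tends to \<open>x\<close> and is dominated by \<open>\<bar>x\<bar>\<close>.\<close>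

lemma sin_mean_small: "((\<lambda>s. (LINT x|Q. sin (s * x)) / s) \<longlongrightarrow> 0) (at_right 0)"
proof (rule tendsto_at_right_sequentially[of 0 1])
  fix S :: "nat \<Rightarrow> real" assume S: "\<And>n. 0 < S n" "S \<longlonglongrightarrow> 0"
  have sin_lim: "((\<lambda>w::real. sin w / w) \<longlongrightarrow> 1) (at 0)"
    using DERIV_sin[of "0::real"] by (simp add: has_field_derivative_iff)
  have "(\<lambda>n. LINT x|Q. sin (S n * x) / S n) \<longlonglongrightarrow> (LINT x|Q. x)"
  proof (rule integral_dominated_convergence[where w = "\<lambda>x. \<bar>x\<bar>"])
    show "AE x in Q. (\<lambda>n. sin (S n * x) / S n) \<longlonglongrightarrow> x"
    proof (rule AE_I2)
      fix x :: real
      show "(\<lambda>n. sin (S n * x) / S n) \<longlonglongrightarrow> x"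
      proof (cases "x = 0")
        case False
        have "filterlim (\<lambda>n. S n * x) (at 0) sequentially"
          using S False by (auto simp: filterlim_at less_imp_neq[THEN not_sym] intro!: tendsto_mult_left_zero)
        then have "(\<lambda>n. x * (sin (S n * x) / (S n * x))) \<longlonglongrightarrow> x * 1"
          by (intro tendsto_intros filterlim_compose[OF sin_lim])
        then show ?thesis using False by simp
      qed simp
    qed
    show "AE x in Q. norm (sin (S n * x) / S n) \<le> \<bar>x\<bar>" for n
    proof (rule AE_I2)
      fix x :: real
      show "norm (sin (S n * x) / S n) \<le> \<bar>x\<bar>"
        using abs_sin_x_le_abs_x[of "S n * x"] S(1)[of n]
        by (simp add: abs_divide pos_divide_le_eq abs_mult mult.commute)
    qed
    show "integrable Q (\<lambda>x. \<bar>x\<bar>)"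
      by (rule integrable_abs[OF integrable_id])
  qed simp_all
  then show "(\<lambda>n. (LINT x|Q. sin (S n * x)) / S n) \<longlonglongrightarrow> 0"
    by (simp only: mean_zero integral_divide_zero)
qed simp

lemma cos_defect_pos: "\<forall>\<^sub>F s in at_right 0. 0 < g s"
proof -
  obtain c where c: "c > 0" "\<forall>\<^sub>F s in at_right 0. c * s\<^sup>2 \<le> g s"
    using cos_defect_quadratic_lower by blast
  from c(2) eventually_at_right_less[of "0::real"] show ?thesis
    by eventually_elim (use c(1) in \<open>auto intro: less_le_trans[rotated]\<close>)
qed

lemma cos_defect_tendsto_0: "(g \<longlongrightarrow> 0) (at_right 0)"
proof -
  have "(g \<longlongrightarrow> g 0) (at_right 0)"
    using cos_defect_isCont[of 0] unfolding isCont_def by (rule tendsto_within_subset) simp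
  then show ?thesis by (simp add: cos_defect_def)
qed

text \<open>With \<open>h\<close> for the mean of \<open>sin (s * x)\<close>, the squared modulus is \<open>(1 - g)\<^sup>2 + h\<^sup>2\<close>. The imaginary
  part is negligible, since \<open>h\<close> is of smaller order than \<open>s\<close> and \<open>g\<close> is at least of order \<open>s\<^sup>2\<close>.\<close>

lemma char_defect_ratio:
  "((\<lambda>s. (1 - (norm (char Q s))\<^sup>2) / g s) \<longlongrightarrow> 2) (at_right 0)"
proof -
  obtain c where c: "c > 0" "\<forall>\<^sub>F s in at_right 0. c * s\<^sup>2 \<le> g s"
    using cos_defect_quadratic_lower by blast
  define h where "h s = (LINT x|Q. sin (s * x))" for s
  have "((\<lambda>s. (h s / s)\<^sup>2 / c) \<longlongrightarrow> 0\<^sup>2 / c) (at_right 0)"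
    unfolding h_def using c by (intro tendsto_intros sin_mean_small) auto
  then have lim0: "((\<lambda>s. (h s / s)\<^sup>2 / c) \<longlongrightarrow> 0) (at_right 0)" by simp
  have h0: "((\<lambda>s. (h s)\<^sup>2 / g s) \<longlongrightarrow> 0) (at_right 0)"
  proof (rule tendsto_sandwich[OF _ _ tendsto_const lim0])
    show "\<forall>\<^sub>F s in at_right 0. 0 \<le> (h s)\<^sup>2 / g s"
      by (simp add: cos_defect_nonneg)
    from c(2) eventually_at_right_less[of "0::real"]
    show "\<forall>\<^sub>F s in at_right 0. (h s)\<^sup>2 / g s \<le> (h s / s)\<^sup>2 / c"
    proof eventually_elim
      case (elim s)
      then have "(h s)\<^sup>2 / g s \<le> (h s)\<^sup>2 / (c * s\<^sup>2)"
        using c(1) by (intro divide_left_mono) (auto intro!: mult_pos_pos intro: less_le_trans[rotated])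
      then show ?case by (simp add: power_divide mult.commute)
    qed
  qed
  have "((\<lambda>s. 2 - g s - (h s)\<^sup>2 / g s) \<longlongrightarrow> 2 - 0 - 0) (at_right 0)"
    by (intro tendsto_intros cos_defect_tendsto_0 h0)
  moreover have "\<forall>\<^sub>F s in at_right 0. 2 - g s - (h s)\<^sup>2 / g s =
      (1 - (norm (char Q s))\<^sup>2) / g s"
    using cos_defect_pos
  proof eventually_elim
    case (elim s)
    have "1 - (norm (char Q s))\<^sup>2 = 2 * g s - g s * g s - (h s)\<^sup>2"
      unfolding norm_char_power2 h_def by (simp add: power2_eq_square algebra_simps)
    then show ?case using elim by (simp add: diff_divide_distrib)
  qed
  ultimately have "((\<lambda>s. (1 - (norm (char Q s))\<^sup>2) / g s) \<longlongrightarrow> 2 - 0 - 0) (at_right 0)"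
    by (rule Lim_transform_eventually)
  then show ?thesis by simp
qed

lemma norm_char_lt_1: "\<forall>\<^sub>F s in at_right 0. norm (char Q s) < 1"
proof -
  have "\<forall>\<^sub>F s in at_right 0. 1 < (1 - (norm (char Q s))\<^sup>2) / g s"
    using char_defect_ratio by (rule order_tendstoD) simp
  with cos_defect_pos show ?thesis
  proof eventually_elim
    case (elim s)
    then have "(norm (char Q s))\<^sup>2 < 1" by (simp add: pos_less_divide_eq)
    then show ?case using power2_less_imp_less[of "norm (char Q s)" 1] by simp
  qed
qed

lemma norm_char_tendsto_1: "((\<lambda>s. norm (char Q s)) \<longlongrightarrow> 1) (at_right 0)"
proof -
  have "(char Q \<longlongrightarrow> char Q 0) (at_right 0)"
    using isCont_char[of 0] unfolding isCont_def by (rule tendsto_within_subset) simp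
  from tendsto_norm[OF this] show ?thesis by (simp add: char_zero)
qed

lemma cos_defect_log_char:
  "((\<lambda>s. g s / (- ln (norm (char Q s)))) \<longlongrightarrow> 1) (at_right 0)"
proof -
  let ?w = "\<lambda>s. norm (char Q s)"
  have ln_lim: "((\<lambda>w::real. ln w / (w - 1)) \<longlongrightarrow> 1) (at 1)"
    using DERIV_ln[of "1::real", OF zero_less_one] unfolding has_field_derivative_iff by simp
  have "filterlim ?w (at 1) (at_right 0)"
    unfolding filterlim_at
  proof
    show "\<forall>\<^sub>F s in at_right 0. ?w s \<in> UNIV \<and> ?w s \<noteq> 1"
      using norm_char_lt_1 by eventually_elim simp
  qed (rule norm_char_tendsto_1)
  then have ln_w: "((\<lambda>s. ln (?w s) / (?w s - 1)) \<longlongrightarrow> 1) (at_right 0)"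
    by (rule filterlim_compose[OF ln_lim])
  have "((\<lambda>s. (1 + ?w s) / (((1 - (?w s)\<^sup>2) / g s) * (ln (?w s) / (?w s - 1)))) \<longlongrightarrow> (1 + 1) / (2 * 1)) (at_right 0)"
    by (intro tendsto_intros norm_char_tendsto_1 char_defect_ratio ln_w) auto
  moreover have "\<forall>\<^sub>F s in at_right 0. (1 + ?w s) / (((1 - (?w s)\<^sup>2) / g s) * (ln (?w s) / (?w s - 1))) =
      g s / (- ln (?w s))"
    using norm_char_lt_1 cos_defect_pos
  proof eventually_elim
    case (elim s)
    have "1 - (?w s)\<^sup>2 = (1 + ?w s) * (1 - ?w s)" by (simp add: power2_eq_square algebra_simps)
    moreover have "1 + ?w s \<noteq> 0" using norm_ge_zero[of "char Q s"] by linarith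
    moreover have "?w s - 1 \<noteq> 0" "1 - ?w s \<noteq> 0" using elim by auto
    moreover have "(1 + w) / (((1 + w) * (1 - w) / g) * (l / (w - 1))) = g / (- l)"
      if "1 + w \<noteq> 0" "w - 1 \<noteq> 0" "g \<noteq> 0" for w g l :: real
    proof -
      have "((1 + w) * (1 - w) / g) * (l / (w - 1)) = (1 + w) * (- l) / g"
        using that by (simp add: field_simps)
      then show ?thesis using that by simp
    qed
    ultimately show ?case using elim by simp
  qed
  ultimately have "((\<lambda>s. g s / (- ln (?w s))) \<longlongrightarrow> (1 + 1) / (2 * 1)) (at_right 0)"
    by (rule Lim_transform_eventually)
  then show ?thesis by simp
qed

text \<open>If \<open>a n\<close> stayed bounded along a subsequence, the lower bound would apply at one fixed small \<open>s\<close> for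
  infinitely many \<open>n\<close>, although the modulus at \<open>s\<close> is less than \<open>1\<close> and its powers vanish.\<close>

lemma inverse_scale_small:
  assumes "r > 0" shows "\<forall>\<^sub>F n in sequentially. 1 / a n < r"
proof (rule ccontr)
  assume "\<not> ?thesis"
  then have freq: "\<exists>\<^sub>F n in sequentially. r \<le> 1 / a n"
    by (simp add: not_eventually not_less)
  have "\<forall>\<^sub>F s::real in at_right 0. s < \<delta> * r"
    using assms \<delta>_pos by (intro order_tendstoD(2)[OF tendsto_ident_at]) simp
  then have "\<forall>\<^sub>F s in at_right 0. 0 < s \<and> s < \<delta> * r \<and> norm (char Q s) < 1"
    using norm_char_lt_1 eventually_at_right_less[of "0::real"] by eventually_elim simp
  then obtain s where s: "0 < s" "s < \<delta> * r" "norm (char Q s) < 1"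
    using eventually_happens[of _ "at_right (0::real)"] by auto
  have "(\<lambda>n. norm (char Q s) ^ n) \<longlonglongrightarrow> 0"
    using s(3) by (intro LIMSEQ_realpow_zero) auto
  then have "\<forall>\<^sub>F n in sequentially. norm (char Q s) ^ n < 1 / 2"
    by (rule order_tendstoD) simp
  with char_low have "\<forall>\<^sub>F n in sequentially. \<not> r \<le> 1 / a n"
  proof eventually_elim
    case (elim n)
    show ?case
    proof
      assume r: "r \<le> 1 / a n"
      have "r * a n \<le> 1" using r a_pos[of n] by (simp add: pos_le_divide_eq)
      have "s * a n \<le> \<delta> * r * a n" using s a_pos[of n] by simp
      also have "\<dots> \<le> \<delta> * 1" unfolding mult.assoc using \<open>r * a n \<le> 1\<close> \<delta>_pos by (intro mult_left_mono) auto
      finally have "\<bar>s * a n\<bar> \<le> \<delta>" using s a_pos[of n] by simp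
      with elim have "1 / 2 \<le> norm (char Q (s * a n / a n)) ^ n" by blast
      then show False using elim a_pos[of n] by simp
    qed
  qed
  with freq show False by (simp add: frequently_def)
qed

lemma scaled_at_right:
  assumes "t > 0" shows "filterlim (\<lambda>n. t / a n) (at_right 0) sequentially"
proof -
  have "(\<lambda>n. t / a n) \<longlonglongrightarrow> 0"
  proof (rule tendstoI)
    fix e :: real assume "e > 0"
    then have "\<forall>\<^sub>F n in sequentially. 1 / a n < e / t"
      using assms by (intro inverse_scale_small) simp
    then show "\<forall>\<^sub>F n in sequentially. dist (t / a n) 0 < e"
      by eventually_elim (use assms a_pos in \<open>simp add: dist_real_def abs_divide less_imp_le field_simps\<close>)
  qed
  moreover have "t / a n \<in> {0<..} \<and> t / a n \<noteq> 0" for n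
    using assms a_pos[of n] by auto
  ultimately show ?thesis
    unfolding filterlim_at by (blast intro: always_eventually)
qed

lemma log_char_lim:
  "(\<lambda>n. real n * - ln (norm (char Q (t / a n)))) \<longlonglongrightarrow> t\<^sup>2 / 2"
proof -
  have "(\<lambda>n. - ln (norm (char Q (t / a n)) ^ n)) \<longlonglongrightarrow> - ln (exp (- t\<^sup>2 / 2))"
    by (intro tendsto_intros char_lim) simp
  then show ?thesis by (simp add: ln_realpow)
qed

lemma cos_defect_lim: "(\<lambda>n. real n * g (t / a n)) \<longlonglongrightarrow> t\<^sup>2 / 2"
proof -
  have pos: "(\<lambda>n. real n * g (t / a n)) \<longlonglongrightarrow> t\<^sup>2 / 2" if t: "t > 0" for t
  proof -
    have "(\<lambda>n. (g (t / a n) / (- ln (norm (char Q (t / a n))))) *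
        (real n * - ln (norm (char Q (t / a n))))) \<longlonglongrightarrow> 1 * (t\<^sup>2 / 2)"
      by (intro tendsto_mult log_char_lim filterlim_compose[OF cos_defect_log_char scaled_at_right] t)
    moreover have "\<forall>\<^sub>F n in sequentially. 1 / 2 < g (t / a n) / (- ln (norm (char Q (t / a n))))"
      by (rule order_tendstoD(1)[OF filterlim_compose[OF cos_defect_log_char scaled_at_right[OF t]]]) simp
    then have "\<forall>\<^sub>F n in sequentially. (g (t / a n) / (- ln (norm (char Q (t / a n))))) *
        (real n * - ln (norm (char Q (t / a n)))) = real n * g (t / a n)"
      by eventually_elim auto
    ultimately have "(\<lambda>n. real n * g (t / a n)) \<longlonglongrightarrow> 1 * (t\<^sup>2 / 2)"
      by (rule Lim_transform_eventually)
    then show ?thesis by simp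
  qed
  show ?thesis
  proof (cases t "0::real" rule: linorder_cases)
    case less
    then show ?thesis using pos[of "- t"] by simp
  next
    case equal
    then show ?thesis by (simp add: cos_defect_def)
  qed (rule pos)
qed

text \<open>The domination for averaging lemma \<open>cos_defect_lim\<close> over a normal argument. For arguments up to \<open>\<delta>\<close> the lower bound on the
  moduli gives \<open>2 * ln 2\<close>; an arbitrary \<open>z\<close> is an integer multiple of such an argument.\<close>

lemma cos_defect_bound:
  "\<exists>C. \<forall>\<^sub>F n in sequentially. \<forall>z. real n * g (z / a n) \<le> C * (1 + z\<^sup>2)"
proof -
  have "\<forall>\<^sub>F s in at_right 0. g s / (- ln (norm (char Q s))) < 2"
    "\<forall>\<^sub>F s in at_right 0. 1 / 2 < g s / (- ln (norm (char Q s)))"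
    by (rule order_tendstoD[OF cos_defect_log_char], simp)+
  then have "\<forall>\<^sub>F s in at_right 0. g s \<le> 2 * - ln (norm (char Q s))"
    using cos_defect_pos
  proof eventually_elim
    case (elim s)
    have "- ln (norm (char Q s)) > 0"
      using elim divide_nonneg_nonpos[of "g s" "- ln (norm (char Q s))"] by linarith
    from pos_divide_less_eq[OF this] elim(1) show ?case by (metis less_imp_le)
  qed
  then obtain s2 where s2: "s2 > 0"
    "\<And>s. 0 < s \<Longrightarrow> s < s2 \<Longrightarrow> g s \<le> 2 * - ln (norm (char Q s))"
    unfolding eventually_at_right_field by blast
  define C0 where "C0 = 2 * ln (2::real)"
  have C0: "C0 \<ge> 0" by (simp add: C0_def)
  have "\<forall>\<^sub>F n in sequentially. 1 / a n < s2 / \<delta>"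
    using s2 \<delta>_pos by (intro inverse_scale_small) simp
  with char_low have base: "\<forall>\<^sub>F n in sequentially. \<forall>t. 0 < t \<and> t \<le> \<delta> \<longrightarrow> real n * g (t / a n) \<le> C0"
  proof eventually_elim
    case (elim n)
    show ?case
    proof (intro allI impI)
      fix t assume t: "0 < t \<and> t \<le> \<delta>"
      let ?w = "norm (char Q (t / a n))"
      have w: "1 / 2 \<le> ?w ^ n" using elim t by auto
      have "t / a n \<le> \<delta> * (1 / a n)" using t a_pos[of n] by (simp add: divide_right_mono)
      also have "\<dots> < s2" using elim \<delta>_pos by (simp add: field_simps)
      finally have "real n * g (t / a n) \<le> real n * (2 * - ln ?w)"
        using t a_pos[of n] by (intro mult_left_mono s2) auto
      also have "\<dots> = 2 * - ln (?w ^ n)"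
        by (simp add: ln_realpow)
      also have "\<dots> \<le> 2 * - ln (1 / 2)"
        using w by (intro mult_left_mono) (auto simp: )
      finally show "real n * g (t / a n) \<le> C0" by (simp add: C0_def ln_div)
    qed
  qed
  have "\<forall>\<^sub>F n in sequentially. \<forall>z. real n * g (z / a n) \<le> (2 * C0 * (1 + 1 / \<delta>\<^sup>2)) * (1 + z\<^sup>2)"
    using base
  proof eventually_elim
    case (elim n)
    have pos: "real n * g (z / a n) \<le> (2 * C0 * (1 + 1 / \<delta>\<^sup>2)) * (1 + z\<^sup>2)" if z: "z > 0" for z
    proof -
      define m where "m = nat \<lceil>z / \<delta>\<rceil>"
      have zd: "z / \<delta> > 0" using z \<delta>_pos by simp
      have m: "real m \<ge> z / \<delta>" "real m \<le> z / \<delta> + 1" "real m > 0"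
        using zd unfolding m_def by linarith+
      have "g (z / a n) = g (real m * (z / real m / a n))"
        using m by simp
      also have "\<dots> \<le> (real m)\<^sup>2 * g (z / real m / a n)"
        by (rule cos_defect_mult_le)
      finally have "real n * g (z / a n) \<le> real n * ((real m)\<^sup>2 * g (z / real m / a n))"
        by (rule mult_left_mono) simp
      also have "\<dots> = (real m)\<^sup>2 * (real n * g (z / real m / a n))" by simp
      also have "\<dots> \<le> (real m)\<^sup>2 * C0"
      proof (intro mult_left_mono elim[rule_format])
        show "0 < z / real m \<and> z / real m \<le> \<delta>"
          using z m \<delta>_pos by (simp add: pos_divide_le_eq mult.commute)
      qed simp
      also have "\<dots> \<le> (z / \<delta> + 1)\<^sup>2 * C0"
        using m C0 by (intro mult_right_mono power_mono) auto
      also have "\<dots> \<le> (2 * ((z / \<delta>)\<^sup>2 + 1)) * C0"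
      proof (intro mult_right_mono C0)
        have "0 \<le> (z / \<delta> - 1)\<^sup>2" by simp
        then show "(z / \<delta> + 1)\<^sup>2 \<le> 2 * ((z / \<delta>)\<^sup>2 + 1)"
          unfolding power2_sum power2_diff by simp
      qed
      also have "\<dots> = 2 * C0 * (1 + z\<^sup>2 / \<delta>\<^sup>2)" by (simp add: power_divide algebra_simps)
      also have "\<dots> \<le> 2 * C0 * ((1 + 1 / \<delta>\<^sup>2) * (1 + z\<^sup>2))"
        using C0 \<delta>_pos by (intro mult_left_mono) (auto simp: field_simps)
      finally show ?thesis by (simp add: mult.assoc)
    qed
    show ?case
    proof
      fix z :: real
      show "real n * g (z / a n) \<le> (2 * C0 * (1 + 1 / \<delta>\<^sup>2)) * (1 + z\<^sup>2)"
      proof (cases z "0::real" rule: linorder_cases)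
        case less
        then show ?thesis using pos[of "- z"] by simp
      next
        case equal
        then show ?thesis using C0 by (simp add: cos_defect_def)
      qed (rule pos)
    qed
  qed
  then show ?thesis by blast
qed

lemma trunc_var_lim: "(\<lambda>n. real n * U (t / a n)) \<longlonglongrightarrow> t\<^sup>2 / 2"
proof -
  interpret N: real_distribution std_normal_distribution by (rule real_dist_normal_dist)
  obtain C where "\<forall>\<^sub>F n in sequentially. \<forall>z. real n * g (z / a n) \<le> C * (1 + z\<^sup>2)"
    using cos_defect_bound by blast
  then obtain n0 where n0: "\<And>n z. n \<ge> n0 \<Longrightarrow> real n * g (z / a n) \<le> C * (1 + z\<^sup>2)"
    unfolding eventually_sequentially by blast
  have [measurable]: "g \<in> borel_measurable borel"
    by (intro borel_measurable_continuous_onI continuous_at_imp_continuous_on ballI cos_defect_isCont)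
  have sq: "integrable std_normal_distribution (\<lambda>z. z\<^sup>2)"
    by (rule integrable_std_normal_distribution_moment)
  have "(\<lambda>n. LINT z|std_normal_distribution. real (n + n0) * g (t * z / a (n + n0))) \<longlonglongrightarrow>
      (LINT z|std_normal_distribution. t\<^sup>2 / 2 * z\<^sup>2)"
  proof (rule integral_dominated_convergence[where w = "\<lambda>z. C * (1 + t\<^sup>2 * z\<^sup>2)"])
    show "AE z in std_normal_distribution.
        (\<lambda>n. real (n + n0) * g (t * z / a (n + n0))) \<longlonglongrightarrow> t\<^sup>2 / 2 * z\<^sup>2"
    proof (rule AE_I2)
      fix z
      show "(\<lambda>n. real (n + n0) * g (t * z / a (n + n0))) \<longlonglongrightarrow> t\<^sup>2 / 2 * z\<^sup>2"
        using LIMSEQ_ignore_initial_segment[OF cos_defect_lim[of "t * z"], of n0]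
        by (simp add: power_mult_distrib)
    qed
    show "AE z in std_normal_distribution.
        norm (real (n + n0) * g (t * z / a (n + n0))) \<le> C * (1 + t\<^sup>2 * z\<^sup>2)" for n
      using n0[of "n + n0" "t * _"] by (intro AE_I2) (simp add: cos_defect_nonneg power_mult_distrib del: of_nat_add)
    show "integrable std_normal_distribution (\<lambda>z. C * (1 + t\<^sup>2 * z\<^sup>2))"
      by (intro integrable_mult_right Bochner_Integration.integrable_add sq N.integrable_const)
  qed measurable
  moreover have "(LINT z|std_normal_distribution. t\<^sup>2 / 2 * z\<^sup>2) = t\<^sup>2 / 2"
    using std_normal_distribution_even_moments(1)[of 1] by (simp add: fact_numeral)
  moreover have "(LINT z|std_normal_distribution. real (n + n0) * g (t * z / a (n + n0))) =
      real (n + n0) * U (t / a (n + n0))" for n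
    unfolding trunc_var_eq_gaussian_mixture by (simp only: integral_mult_right_zero times_divide_eq_left)
  ultimately have "(\<lambda>n. real (n + n0) * U (t / a (n + n0))) \<longlonglongrightarrow> t\<^sup>2 / 2"
    by (simp only:)
  then show ?thesis by (rule LIMSEQ_offset)
qed

lemma trunc_var_positive:
  assumes "s > 0" shows "0 < U s"
proof -
  have "\<forall>\<^sub>F n in sequentially. 0 < real n * U (1 / a n)"
    using trunc_var_lim[of 1] by (rule order_tendstoD) simp
  then have "\<forall>\<^sub>F n in sequentially. 0 < real n * U (1 / a n) \<and> 1 / a n < s"
    using inverse_scale_small[OF assms] by eventually_elim simp
  then obtain n where n: "0 < real n * U (1 / a n)" "1 / a n < s"
    using eventually_happens[of _ sequentially] by auto
  then have "0 < U (1 / a n)" by (simp add: zero_less_mult_iff)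
  also have "\<dots> \<le> U s"
    using n a_pos[of n] by (intro trunc_var_mono) auto
  finally show ?thesis .
qed

lemma trunc_var_tendsto_0: "(U \<longlongrightarrow> 0) (at_right 0)"
proof -
  have "(U \<longlongrightarrow> U 0) (at_right 0)"
    using trunc_var_isCont[of 0] unfolding isCont_def by (rule tendsto_within_subset) simp
  then show ?thesis by simp
qed

text \<open>The limits of \<open>n * U (t / a n)\<close> are known only along the sequence \<open>a\<close>. For given small \<open>s\<close> take
  \<open>n\<close> to be the integer part of \<open>1 / U s\<close>, so that \<open>n * U s\<close> is nearly \<open>1\<close>. With \<open>t\<close> slightly below \<open>sqrt 2\<close> the
  limit \<open>t\<^sup>2 / 2\<close> is below \<open>1\<close>, so \<open>t / a n < s\<close> by monotonicity, and \<open>n * U (2 * s)\<close> is at least about \<open>2 * t\<^sup>2\<close>, which is close to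
  \<open>4\<close>.\<close>

lemma trunc_var_ratio_lower:
  assumes e: "0 < e" "e < 1"
  shows "\<forall>\<^sub>F s in at_right 0. 4 * (1 - e)\<^sup>2 - e < U (2 * s) / U s"
proof -
  define t where "t = sqrt 2 * (1 - e)"
  have t: "t > 0" "t\<^sup>2 / 2 = (1 - e)\<^sup>2" "(2 * t)\<^sup>2 / 2 = 4 * (1 - e)\<^sup>2"
    using e by (simp_all add: t_def power_mult_distrib)
  have "(1 - e)\<^sup>2 < 1 - e" using e by (simp add: power2_eq_square)
  then have "\<forall>\<^sub>F n in sequentially. real n * U (t / a n) < 1 - e"
    using trunc_var_lim[of t] t by (intro order_tendstoD(2)) auto
  moreover have "\<forall>\<^sub>F n in sequentially. 4 * (1 - e)\<^sup>2 - e < real n * U (2 * t / a n)"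
    using trunc_var_lim[of "2 * t"] t e by (intro order_tendstoD(1)) auto
  ultimately have "\<forall>\<^sub>F n in sequentially. real n * U (t / a n) < 1 - e \<and>
      4 * (1 - e)\<^sup>2 - e < real n * U (2 * t / a n)"
    by eventually_elim simp
  then obtain n0 where n0: "\<And>n. n \<ge> n0 \<Longrightarrow> real n * U (t / a n) < 1 - e \<and>
      4 * (1 - e)\<^sup>2 - e < real n * U (2 * t / a n)"
    unfolding eventually_sequentially by blast
  have "\<forall>\<^sub>F s in at_right 0. U s < min e (1 / (real n0 + 1))"
    using e by (intro order_tendstoD(2)[OF trunc_var_tendsto_0]) simp
  then show ?thesis
    using eventually_at_right_less[of "0::real"]
  proof eventually_elim
    case (elim s)
    let ?U = "U s"
    have U: "?U > 0" using elim by (intro trunc_var_positive)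
    define n where "n = nat \<lfloor>1 / ?U\<rfloor>"
    have inv: "1 / ?U > real n0 + 1" using elim U by (simp add: field_simps)
    have n: "real n \<le> 1 / ?U" "1 / ?U - 1 < real n" "n \<ge> n0"
      using inv unfolding n_def by linarith+
    have n1: "real n * ?U \<le> 1" using n(1) U by (simp add: pos_le_divide_eq)
    have "1 - ?U < real n * ?U" using n(2) U by (simp add: pos_divide_less_eq field_simps)
    then have "real n * U (t / a n) < real n * ?U"
      using n0[OF n(3)] elim by simp
    then have "U (t / a n) < ?U" by (simp add: mult_less_cancel_left)
    then have lt: "t / a n < s"
      using trunc_var_mono[of s "t / a n"] elim by (meson less_imp_le not_le)
    have "4 * (1 - e)\<^sup>2 - e < real n * U (2 * t / a n)" using n0[OF n(3)] by simp
    also have "\<dots> \<le> real n * U (2 * s)"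
      using lt t a_pos[of n] by (intro mult_left_mono trunc_var_mono) auto
    also have "\<dots> \<le> (1 / ?U) * U (2 * s)"
      using n by (intro mult_right_mono trunc_var_nonneg)
    finally show ?case by simp
  qed
qed

lemma trunc_var_ratio: "((\<lambda>s. U (2 * s) / U s) \<longlongrightarrow> 4) (at_right 0)"
proof (rule order_tendstoI)
  fix w :: real assume w: "w < 4"
  have "((\<lambda>e::real. 4 * (1 - e)\<^sup>2 - e) \<longlongrightarrow> 4 * (1 - 0)\<^sup>2 - 0) (at_right 0)"
    by (intro tendsto_intros)
  then have "\<forall>\<^sub>F e::real in at_right 0. w < 4 * (1 - e)\<^sup>2 - e"
    using w by (intro order_tendstoD(1)) auto
  moreover have "\<forall>\<^sub>F e::real in at_right 0. e < 1"
    by (intro order_tendstoD(2)[OF tendsto_ident_at]) simp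
  ultimately have "\<forall>\<^sub>F e::real in at_right 0. w < 4 * (1 - e)\<^sup>2 - e \<and> 0 < e \<and> e < 1"
    using eventually_at_right_less[of "0::real"] by eventually_elim simp
  then obtain e :: real where e: "w < 4 * (1 - e)\<^sup>2 - e" "0 < e" "e < 1"
    using eventually_happens[of _ "at_right (0::real)"] by auto
  show "\<forall>\<^sub>F s in at_right 0. w < U (2 * s) / U s"
    using trunc_var_ratio_lower[OF e(2,3)] by eventually_elim (use e in simp)
next
  fix w :: real assume w: "4 < w"
  show "\<forall>\<^sub>F s in at_right 0. U (2 * s) / U s < w"
    using eventually_at_right_less[of "0::real"]
  proof eventually_elim
    case (elim s)
    have "0 \<le> (LINT x|Q. (defect (s * x))\<^sup>2)" by simp
    then have "U (2 * s) \<le> 4 * U s"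
      using trunc_var_double[of s] by linarith
    then have "U (2 * s) / U s \<le> 4"
      using trunc_var_positive[OF elim] by (simp add: pos_divide_le_eq)
    then show ?case using w by simp
  qed
qed

lemma centered_slowly_varying: "centered_slowly_varying Q"
  by unfold_locales (rule integrable_id mean_zero trunc_var_ratio)+

end

section \<open>The domain of attraction of the normal law\<close>

lemma (in prob_space) norm_char_affine:
  assumes [measurable]: "random_variable borel X"
  shows "norm (char (distr M borel (\<lambda>\<omega>. (X \<omega> - b) / a)) t) = norm (char (distr M borel X) (t / a))"
proof -
  have "char (distr M borel (\<lambda>\<omega>. (X \<omega> - b) / a)) t = (CLINT \<omega>|M. iexp (t * ((X \<omega> - b) / a)))"
    unfolding char_def by (subst integral_distr) auto
  also have "(\<lambda>\<omega>. iexp (t * ((X \<omega> - b) / a))) = (\<lambda>\<omega>. iexp (- (t * b / a)) * iexp (t / a * X \<omega>))"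
  proof
    fix \<omega>
    have "t * ((X \<omega> - b) / a) = - (t * b / a) + t / a * X \<omega>"
      by (simp add: diff_divide_distrib right_diff_distrib)
    then have "\<i> * complex_of_real (t * ((X \<omega> - b) / a)) = \<i> * complex_of_real (- (t * b / a)) + \<i> * complex_of_real (t / a * X \<omega>)"
      by (simp only: of_real_add distrib_left)
    then show "iexp (t * ((X \<omega> - b) / a)) = iexp (- (t * b / a)) * iexp (t / a * X \<omega>)"
      by (simp only: exp_add)
  qed
  also have "(CLINT \<omega>|M. iexp (- (t * b / a)) * iexp (t / a * X \<omega>)) =
      iexp (- (t * b / a)) * (CLINT \<omega>|M. iexp (t / a * X \<omega>))"
    by (rule integral_mult_right_zero)
  also have "(CLINT \<omega>|M. iexp (t / a * X \<omega>)) = char (distr M borel X) (t / a)"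
    unfolding char_def by (subst integral_distr) auto
  finally have "norm (char (distr M borel (\<lambda>\<omega>. (X \<omega> - b) / a)) t) =
      norm (iexp (- (t * b / a))) * norm (char (distr M borel X) (t / a))"
    by (simp only: norm_mult)
  then show ?thesis by (simp only: norm_exp_i_times mult_1)
qed

text \<open>Levy's continuity theorem gives the limits of the moduli, and convergence of the distribution
  functions at two points \<open>K\<close> and \<open>- K\<close> with small normal mass outside gives the uniform lower bound.\<close>

theorem DAN_centered_slowly_varying:
  assumes P: "P \<in> DAN \<mu>"
  shows "centered_slowly_varying (distr P borel (\<lambda>x. x - \<mu>))"
proof -
  define Q where "Q = distr P borel (\<lambda>x. x - \<mu>)"
  from P obtain a b where P_dist: "real_distribution P" and int: "integrable P (\<lambda>x. x)"
    and mean: "(LINT x|P. x) = \<mu>" and a: "\<And>n. a n > 0"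
    and wc: "weak_conv_m (\<lambda>n. distr (\<Pi>\<^sub>M i\<in>(UNIV :: nat set). P) borel (\<lambda>x. ((\<Sum>i<n. x i) - b n) / a n))
          std_normal_distribution"
    unfolding DAN_def by blast
  interpret P: real_distribution P by (rule P_dist)
  interpret N: real_distribution std_normal_distribution by (rule real_dist_normal_dist)
  define Pi where "Pi = (\<Pi>\<^sub>M i\<in>(UNIV :: nat set). P)"
  define D where "D n = distr Pi borel (\<lambda>x. ((\<Sum>i<n. x i) - b n) / a n)" for n
  have iid: "iid_under Pi (\<lambda>i x. x i) P"
    unfolding Pi_def by (rule iid_under_canonical[OF P_dist])
  interpret Pi: prob_space Pi using iid by (simp add: iid_under_def)
  have ind: "Pi.indep_vars (\<lambda>_. borel) (\<lambda>i x. x i) UNIV" and law: "\<And>i. distr Pi borel (\<lambda>x. x i) = P"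
    using iid by (auto simp: iid_under_def)
  have [measurable]: "Pi.random_variable borel (\<lambda>x. x i)" for i :: nat
    using ind by (auto simp: Pi.indep_vars_def)
  have Q_dist: "real_distribution Q" unfolding Q_def by (rule P.real_distribution_distr) simp
  then interpret Q: real_distribution Q .
  have normQ: "norm (char Q t) = norm (char P t)" for t
    using P.norm_char_affine[of "\<lambda>x. x" \<mu> 1 t] by (simp add: Q_def distr_id2)
  have D_dist: "real_distribution (D n)" for n
    unfolding D_def by (rule Pi.real_distribution_distr) simp
  have normD: "norm (char (D n) t) = norm (char Q (t / a n)) ^ n" for n t
  proof -
    have "norm (char (D n) t) = norm (char (distr Pi borel (\<lambda>x. \<Sum>i<n. x i)) (t / a n))"
      unfolding D_def by (rule Pi.norm_char_affine) simp
    also have "char (distr Pi borel (\<lambda>x. \<Sum>i<n. x i)) (t / a n) = char P (t / a n) ^ n"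
      using Pi.char_distr_sum[OF Pi.indep_vars_subset[OF ind], of "{..<n}" "t / a n"] by (simp add: law)
    finally show ?thesis by (simp add: norm_power normQ)
  qed
  have wcD: "weak_conv_m D std_normal_distribution"
    using wc unfolding D_def[abs_def] Pi_def .
  have cdf_lim: "(\<lambda>n. cdf (D n) x) \<longlonglongrightarrow> std_normal_cdf x" for x
    using wcD std_normal_cdf_isCont unfolding weak_conv_m_def weak_conv_def by blast
  have "\<forall>\<^sub>F K in at_top. 39 / 40 < std_normal_cdf K"
    using N.cdf_lim_at_top_prob by (rule order_tendstoD) simp
  moreover have "\<forall>\<^sub>F K in at_top. std_normal_cdf (- K) < 1 / 40"
    by (rule order_tendstoD(2)[OF filterlim_compose[OF N.cdf_lim_at_bot filterlim_uminus_at_bot_at_top]]) simp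
  ultimately have "\<forall>\<^sub>F K in at_top. 39 / 40 < std_normal_cdf K \<and> std_normal_cdf (- K) < 1 / 40 \<and> 0 < K"
    using eventually_gt_at_top[of "0::real"] by eventually_elim simp
  then obtain K where K: "39 / 40 < std_normal_cdf K" "std_normal_cdf (- K) < 1 / 40" "0 < K"
    using eventually_happens[of _ "at_top :: real filter"] by auto
  \<comment> \<open>the margins leave mass at most \<open>1 / 10\<close> outside \<open>(- K, K]\<close> for the normalised sums\<close>
  have "\<forall>\<^sub>F n in sequentially. 38 / 40 < cdf (D n) K"
    using cdf_lim[of K] by (rule order_tendstoD) (use K in simp)
  moreover have "\<forall>\<^sub>F n in sequentially. cdf (D n) (- K) < 2 / 40"
    using cdf_lim[of "- K"] by (rule order_tendstoD) (use K in simp)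
  ultimately have low: "\<forall>\<^sub>F n in sequentially. \<forall>t. \<bar>t\<bar> \<le> 1 / (2 * K) \<longrightarrow> 1 / 2 \<le> norm (char Q (t / a n)) ^ n"
  proof eventually_elim
    case (elim n)
    interpret D: real_distribution "D n" by (rule D_dist)
    show ?case
    proof (intro allI impI)
      fix t :: real assume "\<bar>t\<bar> \<le> 1 / (2 * K)"
      then have "\<bar>t\<bar> * K \<le> 1 / 2" using K(3) by (simp add: field_simps)
      then have "1 / 2 \<le> norm (char (D n) t)"
        using elim K(3) by (intro D.norm_char_ge_of_tight) auto
      then show "1 / 2 \<le> norm (char Q (t / a n)) ^ n" by (simp add: normD)
    qed
  qed
  have "(\<lambda>n. norm (char (D n) t)) \<longlonglongrightarrow> norm (char std_normal_distribution t)" for t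
    by (intro tendsto_norm levy_continuity1 D_dist real_dist_normal_dist wcD)
  then have lim: "(\<lambda>n. norm (char Q (t / a n)) ^ n) \<longlonglongrightarrow> exp (- t\<^sup>2 / 2)" for t
    unfolding normD char_std_normal_distribution by (simp only: norm_of_real abs_exp_cancel)
  have intQ: "integrable Q (\<lambda>x. x)"
    unfolding Q_def by (subst integrable_distr_eq) (simp_all add: int)
  have "(LINT x|Q. x) = (LINT x|P. x - \<mu>)"
    unfolding Q_def by (subst integral_distr) simp_all
  also have "\<dots> = 0"
    by (subst Bochner_Integration.integral_diff[OF int]) (simp_all add: mean P.prob_UNIV)
  finally have meanQ: "(LINT x|Q. x) = 0" .
  interpret char_attracted Q a "1 / (2 * K)"
    by unfold_locales (rule intQ meanQ a lim low | simp add: K)+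
  show ?thesis using centered_slowly_varying by (simp add: Q_def)
qed

section \<open>Exponential tilting and the law of large numbers for the normaliser\<close>

lemma abs_exp_minus_one_le:
  assumes "w \<le> m" "0 \<le> m"
  shows "\<bar>exp w - 1\<bar> \<le> \<bar>w\<bar> * exp (m::real)"
proof (cases "w \<ge> 0")
  case True
  have "1 + - w \<le> exp (- w)" by (rule exp_ge_add_one_self)
  then have "(1 + - w) * exp w \<le> exp (- w) * exp w" by (intro mult_right_mono) auto
  then have "exp w - 1 \<le> w * exp w" by (simp add: algebra_simps exp_minus)
  also have "\<dots> \<le> w * exp m" using True assms by (intro mult_left_mono) auto
  finally show ?thesis using True by simp
next
  case False
  have "1 - exp w \<le> - w" using exp_ge_add_one_self[of w] by linarith
  also have "\<dots> \<le> - w * exp m" using False assms by simp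
  finally show ?thesis using False by simp
qed

lemma exp_second_order:
  "((\<lambda>y. (exp (x * y - c * y\<^sup>2) - 1 - x * y) / y\<^sup>2) \<longlongrightarrow> x\<^sup>2 / 2 - c) (at (0::real))"
proof -
  define k where "k w = (if w = 0 then 1 / 2 else (exp w - 1 - w) / w\<^sup>2)" for w :: real
  have "((\<lambda>w::real. (exp w - 1 - w) / w\<^sup>2) \<longlongrightarrow> 1 / 2) (at 0)"
  proof (rule lhopital)
    have "((\<lambda>w::real. (exp w - 1) / w) \<longlongrightarrow> 1) (at 0)"
      using DERIV_exp[of "0::real"] by (simp add: has_field_derivative_iff)
    from tendsto_mult[OF this tendsto_const[of "1 / 2"]]
    show "((\<lambda>w::real. (exp w - 1) / (2 * w)) \<longlongrightarrow> 1 / 2) (at 0)" by (simp add: mult.commute)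
  qed (auto intro!: tendsto_eq_intros derivative_eq_intros always_eventually simp: eventually_at intro: exI[of _ 1])
  then have "(k \<longlongrightarrow> 1 / 2) (at 0)"
    by (rule Lim_transform_eventually) (auto simp: k_def eventually_at intro!: exI[of _ 1])
  then have k: "isCont k 0" by (simp add: isCont_def k_def)
  have keq: "exp w - 1 - w = k w * w\<^sup>2" for w by (simp add: k_def)
  have "((\<lambda>y. x * y - c * y\<^sup>2) \<longlongrightarrow> 0) (at 0)" by (auto intro!: tendsto_eq_intros)
  with k have "((\<lambda>y. k (x * y - c * y\<^sup>2)) \<longlongrightarrow> k 0) (at 0)" by (rule isCont_tendsto_compose)
  then have "((\<lambda>y. k (x * y - c * y\<^sup>2) * (x - c * y)\<^sup>2 - c) \<longlongrightarrow> 1 / 2 * (x - c * 0)\<^sup>2 - c) (at 0)"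
    by (intro tendsto_intros) (simp add: k_def)
  moreover have "\<forall>\<^sub>F y in at 0. k (x * y - c * y\<^sup>2) * (x - c * y)\<^sup>2 - c = (exp (x * y - c * y\<^sup>2) - 1 - x * y) / y\<^sup>2"
    unfolding eventually_at
  proof (intro exI[of _ 1] conjI ballI impI)
    fix y :: real assume "y \<noteq> 0 \<and> dist y 0 < 1"
    then have y: "y \<noteq> 0" by simp
    have "exp (x * y - c * y\<^sup>2) - 1 - x * y = k (x * y - c * y\<^sup>2) * (x * y - c * y\<^sup>2)\<^sup>2 - c * y\<^sup>2"
      using keq[of "x * y - c * y\<^sup>2"] by simp
    also have "(x * y - c * y\<^sup>2)\<^sup>2 = (x - c * y)\<^sup>2 * y\<^sup>2" by (simp add: power2_eq_square algebra_simps)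
    finally have "exp (x * y - c * y\<^sup>2) - 1 - x * y = (k (x * y - c * y\<^sup>2) * (x - c * y)\<^sup>2 - c) * y\<^sup>2"
      by (simp add: algebra_simps)
    then show "k (x * y - c * y\<^sup>2) * (x - c * y)\<^sup>2 - c = (exp (x * y - c * y\<^sup>2) - 1 - x * y) / y\<^sup>2"
      using y by simp
  qed simp
  ultimately have "((\<lambda>y. (exp (x * y - c * y\<^sup>2) - 1 - x * y) / y\<^sup>2) \<longlongrightarrow> 1 / 2 * (x - c * 0)\<^sup>2 - c) (at 0)"
    by (rule Lim_transform_eventually)
  then show ?thesis by simp
qed

lemma exponent_le:
  fixes x y c :: real
  assumes "c > 0" shows "x * y - c * y\<^sup>2 \<le> x\<^sup>2 / (4 * c)"
proof -
  have "0 \<le> (x - 2 * c * y)\<^sup>2 / (4 * c)" using assms by simp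
  also have "\<dots> = x\<^sup>2 / (4 * c) - (x * y - c * y\<^sup>2)"
    using assms by (simp add: power2_eq_square field_simps)
  finally show ?thesis by simp
qed

lemma exp_linear_bound:
  assumes "c > 0"
  shows "\<exists>C. \<forall>y. \<bar>exp (x * y - c * y\<^sup>2) - 1 - x * y\<bar> \<le> C * \<bar>y::real\<bar>"
proof -
  define m where "m = x\<^sup>2 / (4 * c)"
  have m: "m \<ge> 0" using assms by (simp add: m_def)
  have w: "x * y - c * y\<^sup>2 \<le> m" for y unfolding m_def by (rule exponent_le[OF assms])
  have "\<bar>exp (x * y - c * y\<^sup>2) - 1 - x * y\<bar> \<le> ((\<bar>x\<bar> + c) * exp m + exp m + \<bar>x\<bar>) * \<bar>y\<bar>" for y
  proof -
    have "\<bar>exp (x * y - c * y\<^sup>2) - 1\<bar> \<le> ((\<bar>x\<bar> + c) * exp m + exp m) * \<bar>y\<bar>"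
    proof (cases "\<bar>y\<bar> \<le> 1")
      case True
      have "y\<^sup>2 \<le> \<bar>y\<bar>"
        using mult_right_mono[OF True abs_ge_zero[of y]] by (simp add: power2_eq_square)
      then have "c * y\<^sup>2 \<le> c * \<bar>y\<bar>" using assms by simp
      then have "\<bar>x * y - c * y\<^sup>2\<bar> \<le> (\<bar>x\<bar> + c) * \<bar>y\<bar>"
        using abs_triangle_ineq4[of "x * y" "c * y\<^sup>2"] assms
        unfolding distrib_right abs_mult[of x] abs_mult[of c] abs_power2 abs_of_pos[OF assms] by linarith
      then have "\<bar>x * y - c * y\<^sup>2\<bar> * exp m \<le> (\<bar>x\<bar> + c) * \<bar>y\<bar> * exp m" by (intro mult_right_mono) auto
      then have "\<bar>exp (x * y - c * y\<^sup>2) - 1\<bar> \<le> (\<bar>x\<bar> + c) * \<bar>y\<bar> * exp m"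
        by (rule order_trans[OF abs_exp_minus_one_le[OF w[of y] m]])
      also have "\<dots> \<le> ((\<bar>x\<bar> + c) * exp m + exp m) * \<bar>y\<bar>" by (simp add: algebra_simps)
      finally show ?thesis .
    next
      case False
      have "exp (x * y - c * y\<^sup>2) \<le> exp m" using w[of y] by simp
      moreover have "1 \<le> exp m" using m by simp
      ultimately have "\<bar>exp (x * y - c * y\<^sup>2) - 1\<bar> \<le> exp m"
        using exp_gt_zero[of "x * y - c * y\<^sup>2"] by linarith
      also have "\<dots> \<le> exp m * \<bar>y\<bar>" using False by simp
      also have "\<dots> \<le> ((\<bar>x\<bar> + c) * exp m + exp m) * \<bar>y\<bar>"
        using assms by (intro mult_right_mono) auto
      finally show ?thesis .
    qed
    moreover have "\<bar>exp (x * y - c * y\<^sup>2) - 1 - x * y\<bar> \<le> \<bar>exp (x * y - c * y\<^sup>2) - 1\<bar> + \<bar>x\<bar> * \<bar>y\<bar>"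
      unfolding abs_mult[symmetric] by (rule abs_triangle_ineq4)
    ultimately show ?thesis by (simp add: distrib_right)
  qed
  then show ?thesis by blast
qed

lemma power_tendsto_exp:
  assumes "(\<lambda>n. real n * c n) \<longlonglongrightarrow> L"
  shows "(\<lambda>n. (1 + c n) ^ n) \<longlonglongrightarrow> exp L"
proof -
  have "(\<lambda>n. (real n * c n) * (1 / real n)) \<longlonglongrightarrow> L * 0"
    by (intro tendsto_mult assms lim_1_over_n)
  moreover have "\<forall>\<^sub>F n in sequentially. (real n * c n) * (1 / real n) = c n"
    using eventually_gt_at_top[of 0] by eventually_elim simp
  ultimately have c0: "c \<longlonglongrightarrow> 0"
    by (auto dest: Lim_transform_eventually)
  have "\<forall>\<^sub>F n in sequentially. - 1 < c n"
    using c0 by (rule order_tendstoD) simp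
  then have "\<forall>\<^sub>F n in sequentially. real n * ln (1 + c n) \<le> real n * c n \<and>
      real n * c n / (1 + c n) \<le> real n * ln (1 + c n) \<and> exp (real n * ln (1 + c n)) = (1 + c n) ^ n"
  proof eventually_elim
    case (elim n)
    have upper: "real n * ln (1 + c n) \<le> real n * c n"
      using elim by (intro mult_left_mono ln_add_one_self_le_self2) auto
    have "- (c n / (1 + c n)) > - 1" using elim by (simp add: divide_simps)
    then have "ln (1 + - (c n / (1 + c n))) \<le> - (c n / (1 + c n))"
      by (rule ln_add_one_self_le_self2)
    moreover have "1 + - (c n / (1 + c n)) = inverse (1 + c n)" using elim by (simp add: field_simps)
    ultimately have "c n / (1 + c n) \<le> ln (1 + c n)" using elim by (simp add: ln_inverse)
    then have "real n * (c n / (1 + c n)) \<le> real n * ln (1 + c n)" by (rule mult_left_mono) simp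
    moreover have "exp (real n * ln (1 + c n)) = (1 + c n) ^ n" using elim by (simp add: exp_of_nat_mult)
    ultimately show ?case using upper by simp
  qed
  then have upper: "\<forall>\<^sub>F n in sequentially. real n * ln (1 + c n) \<le> real n * c n"
    and lower: "\<forall>\<^sub>F n in sequentially. real n * c n / (1 + c n) \<le> real n * ln (1 + c n)"
    and eq: "\<forall>\<^sub>F n in sequentially. exp (real n * ln (1 + c n)) = (1 + c n) ^ n"
    by (simp_all add: eventually_conj_iff)
  have "(\<lambda>n. real n * c n / (1 + c n)) \<longlonglongrightarrow> L / (1 + 0)"
    by (intro tendsto_intros assms c0) simp
  then have "(\<lambda>n. real n * c n / (1 + c n)) \<longlonglongrightarrow> L" by simp
  from tendsto_sandwich[OF lower upper this assms]
  have "(\<lambda>n. exp (real n * ln (1 + c n))) \<longlonglongrightarrow> exp L" by (rule tendsto_exp)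
  then show ?thesis using eq by (rule Lim_transform_eventually)
qed

text \<open>The factor that a single observation, scaled by \<open>s\<close>, contributes to the expectation of
  \<open>exp (x * S - c * V\<^sup>2)\<close>.\<close>

definition tilt :: "real measure \<Rightarrow> real \<Rightarrow> real \<Rightarrow> real \<Rightarrow> real" where
  "tilt Q x c s = (LINT z|Q. exp (x * (s * z) - c * (s * z)\<^sup>2))"

context centered_slowly_varying
begin

lemma integrable_tilt: "0 \<le> c \<Longrightarrow> c > 0 \<or> x = 0 \<Longrightarrow> integrable Q (\<lambda>z. exp (x * (s * z) - c * (s * z)\<^sup>2))"
proof (rule integrable_const_bound[where B = "exp (x\<^sup>2 / (4 * c))"])
  assume "0 \<le> c" "c > 0 \<or> x = 0"
  then have "x * (s * z) - c * (s * z)\<^sup>2 \<le> x\<^sup>2 / (4 * c)" for z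
    using exponent_le[of c x "s * z"] by (cases "c = 0") auto
  then show "AE z in Q. norm (exp (x * (s * z) - c * (s * z)\<^sup>2)) \<le> exp (x\<^sup>2 / (4 * c))" by simp
qed simp

lemma tilt_nonneg: "0 \<le> tilt Q x c s"
  unfolding tilt_def by (intro integral_nonneg_AE) simp

lemma expectation_minus_linear:
  assumes [measurable]: "h \<in> borel_measurable borel"
    and lin: "\<And>y. \<bar>h y - 1 - x * y\<bar> \<le> C * \<bar>y\<bar>"
  shows "integrable Q (\<lambda>z. h (s * z))"
    and "(LINT z|Q. h (s * z) - 1 - x * (s * z)) = (LINT z|Q. h (s * z)) - 1"
proof -
  have C: "C \<ge> 0" using lin[of 1] by simp
  have i1: "integrable Q (\<lambda>z. h (s * z) - 1 - x * (s * z))"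
    by (rule Bochner_Integration.integrable_bound[OF integrable_mult_right[OF integrable_id, of "C * s"]])
      (use lin[of "s * _"] C in \<open>simp_all add: abs_mult mult.assoc\<close>)
  have i2: "integrable Q (\<lambda>z. 1 + x * (s * z))"
    by (intro Bochner_Integration.integrable_add integrable_mult_right integrable_id integrable_const)
  have "integrable Q (\<lambda>z. (h (s * z) - 1 - x * (s * z)) + (1 + x * (s * z)))"
    by (rule Bochner_Integration.integrable_add[OF i1 i2])
  then show i3: "integrable Q (\<lambda>z. h (s * z))" by simp
  have "(LINT z|Q. 1 + x * (s * z)) = 1 + x * (s * (LINT z|Q. z))"
    by (subst Bochner_Integration.integral_add)
      (simp_all add: integrable_id prob_space[simplified])
  then have l: "(LINT z|Q. 1 + x * (s * z)) = 1" by (simp add: mean_zero)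
  have "(LINT z|Q. h (s * z) - 1 - x * (s * z)) = (LINT z|Q. h (s * z) - (1 + x * (s * z)))"
    by (simp add: diff_diff_eq)
  also have "\<dots> = (LINT z|Q. h (s * z)) - 1"
    by (subst Bochner_Integration.integral_diff[OF i3 i2]) (simp only: l)
  finally show "(LINT z|Q. h (s * z) - 1 - x * (s * z)) = (LINT z|Q. h (s * z)) - 1" .
qed

text \<open>The mean is zero, so a linear term may be subtracted before lemma \<open>expectation_asymp\<close> is applied.\<close>

lemma centered_expectation_asymp:
  assumes [measurable]: "h \<in> borel_measurable borel"
    and lin: "\<And>y. \<bar>h y - 1 - x * y\<bar> \<le> C * \<bar>y\<bar>"
    and quad: "((\<lambda>y. (h y - 1 - x * y) / y\<^sup>2) \<longlongrightarrow> \<beta>) (at 0)"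
  shows "((\<lambda>s. ((LINT z|Q. h (s * z)) - 1) / U s) \<longlongrightarrow> 2 * \<beta>) (at_right 0)"
  using expectation_asymp[of "\<lambda>y. h y - 1 - x * y" C \<beta>] lin quad
  by (simp add: expectation_minus_linear(2)[OF assms(1) lin])

lemma tilt_asymp:
  assumes "c > 0"
  shows "((\<lambda>s. (tilt Q x c s - 1) / U s) \<longlongrightarrow> x\<^sup>2 - 2 * c) (at_right 0)"
proof -
  obtain C where C: "\<And>y. \<bar>exp (x * y - c * y\<^sup>2) - 1 - x * y\<bar> \<le> C * \<bar>y\<bar>"
    using exp_linear_bound[OF assms, of x] by blast
  have "((\<lambda>s. ((LINT z|Q. exp (x * (s * z) - c * (s * z)\<^sup>2)) - 1) / U s) \<longlongrightarrow> 2 * (x\<^sup>2 / 2 - c)) (at_right 0)"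
    by (rule centered_expectation_asymp[where h = "\<lambda>y. exp (x * y - c * y\<^sup>2)", OF _ C exp_second_order]) measurable
  then show ?thesis by (simp add: tilt_def right_diff_distrib)
qed

text \<open>The value \<open>1 / 2\<close> normalises the limit: \<open>U s\<close> is about half the truncated variance times \<open>s\<^sup>2\<close>, so the
  scaled squares have sum about \<open>1\<close>. The choice is meaningful only for large \<open>n\<close>.\<close>

definition scale :: "nat \<Rightarrow> real" where
  "scale n = (SOME s. 0 < s \<and> real n * U s = 1 / 2)"

lemma eventually_scale:
  "\<forall>\<^sub>F n in sequentially. 0 < scale n \<and> real n * U (scale n) = 1 / 2"
proof -
  have "\<forall>\<^sub>F n in sequentially. 1 / U 1 < real n"
    by (rule filterlim_at_top_dense[THEN iffD1, OF filterlim_real_sequentially, rule_format])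
  then show ?thesis
  proof eventually_elim
    case (elim n)
    have n: "real n > 0" using elim trunc_var_pos[of 1] less_trans[of 0 "1 / U 1" "real n"] by simp
    have "1 / (2 * real n) \<le> U 1"
      using elim n trunc_var_pos[of 1] by (simp add: field_simps)
    then have "\<exists>s\<ge>0. s \<le> 1 \<and> U s = 1 / (2 * real n)"
      using n by (intro IVT) (auto intro!: trunc_var_isCont)
    then obtain s where s: "s \<ge> 0" "U s = 1 / (2 * real n)" by blast
    then have "s \<noteq> 0" using n by auto
    then have "0 < s \<and> real n * U s = 1 / 2" using s n by simp
    then show ?case unfolding scale_def by (rule someI)
  qed
qed

lemma scale_at_right: "filterlim scale (at_right 0) sequentially"
proof -
  have "scale \<longlonglongrightarrow> 0"
  proof (rule tendstoI)
    fix e :: real assume e: "e > 0"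
    have "\<forall>\<^sub>F n in sequentially. 1 / (2 * U e) < real n"
      by (rule filterlim_at_top_dense[THEN iffD1, OF filterlim_real_sequentially, rule_format])
    with eventually_scale show "\<forall>\<^sub>F n in sequentially. dist (scale n) 0 < e"
    proof eventually_elim
      case (elim n)
      have U: "U e > 0" by (rule trunc_var_pos[OF e])
      have "\<not> e \<le> scale n"
      proof
        assume "e \<le> scale n"
        then have "real n * U e \<le> real n * U (scale n)"
          using e by (intro mult_left_mono trunc_var_mono) auto
        then show False using elim U by (simp add: field_simps)
      qed
      then show ?case using elim by (simp add: dist_real_def)
    qed
  qed
  moreover have "\<forall>\<^sub>F n in sequentially. scale n \<in> {0<..} \<and> scale n \<noteq> 0"
    using eventually_scale by eventually_elim auto
  ultimately show ?thesis unfolding filterlim_at by blast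
qed

lemma expectation_power_lim:
  assumes [measurable]: "h \<in> borel_measurable borel"
    and lin: "\<And>y. \<bar>h y - 1 - x * y\<bar> \<le> C * \<bar>y\<bar>"
    and quad: "((\<lambda>y. (h y - 1 - x * y) / y\<^sup>2) \<longlongrightarrow> \<beta>) (at 0)"
  shows "(\<lambda>n. (LINT z|Q. h (scale n * z)) ^ n) \<longlonglongrightarrow> exp \<beta>"
proof -
  let ?c = "\<lambda>n. (LINT z|Q. h (scale n * z)) - 1"
  have "(\<lambda>n. ?c n / U (scale n) * (1 / 2)) \<longlonglongrightarrow> 2 * \<beta> * (1 / 2)"
    by (intro tendsto_intros filterlim_compose[OF centered_expectation_asymp[OF assms] scale_at_right])
  moreover have "\<forall>\<^sub>F n in sequentially. ?c n / U (scale n) * (1 / 2) = real n * ?c n"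
    using eventually_scale
  proof eventually_elim
    case (elim n)
    have U: "U (scale n) > 0" using elim by (intro trunc_var_pos) simp
    have "?c n / U (scale n) * (real n * U (scale n)) = real n * ?c n"
      using U by simp
    then show ?case using elim by simp
  qed
  ultimately have "(\<lambda>n. real n * ?c n) \<longlonglongrightarrow> 2 * \<beta> * (1 / 2)"
    by (rule Lim_transform_eventually)
  from power_tendsto_exp[OF this] show ?thesis by simp
qed

lemma tilt_power_lim:
  assumes "c > 0"
  shows "(\<lambda>n. tilt Q x c (scale n) ^ n) \<longlonglongrightarrow> exp (x\<^sup>2 / 2 - c)"
proof -
  obtain C where C: "\<And>y. \<bar>exp (x * y - c * y\<^sup>2) - 1 - x * y\<bar> \<le> C * \<bar>y\<bar>"
    using exp_linear_bound[OF assms, of x] by blast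
  have "(\<lambda>n. (LINT z|Q. exp (x * (scale n * z) - c * (scale n * z)\<^sup>2)) ^ n) \<longlonglongrightarrow> exp (x\<^sup>2 / 2 - c)"
    by (rule expectation_power_lim[where h = "\<lambda>y. exp (x * y - c * y\<^sup>2)", OF _ C exp_second_order]) measurable
  then show ?thesis by (simp add: tilt_def)
qed

end

locale iid_sample = L: centered_slowly_varying Q + prob_space M
  for Q :: "real measure" and M :: "'a measure" +
  fixes Y :: "nat \<Rightarrow> 'a \<Rightarrow> real"
  assumes indep: "indep_vars (\<lambda>_. borel) Y UNIV"
    and law: "distr M borel (Y i) = Q"
begin

abbreviation "S n \<omega> \<equiv> (\<Sum>i<n. Y i \<omega>)"
abbreviation "V \<equiv> root_sum_sq Y"
abbreviation "T \<equiv> self_norm Y"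

lemma Y_measurable [measurable]: "Y i \<in> borel_measurable M"
  using indep by (auto simp: indep_vars_def)

lemma V_measurable [measurable]: "V n \<in> borel_measurable M"
  by (rule measurable_self_norm) measurable

lemma T_measurable [measurable]: "T n \<in> borel_measurable M"
  by (rule measurable_self_norm) measurable

lemma nn_integral_prod:
  assumes [measurable]: "f \<in> borel_measurable borel" and nn: "\<And>x. 0 \<le> f x" and int: "integrable Q f"
  shows "(\<integral>\<^sup>+\<omega>. ennreal (\<Prod>i<n. f (Y i \<omega>)) \<partial>M) = ennreal ((LINT x|Q. f x) ^ n)"
proof -
  have "(\<integral>\<^sup>+\<omega>. ennreal (\<Prod>i<n. f (Y i \<omega>)) \<partial>M) = (\<integral>\<^sup>+\<omega>. (\<Prod>i<n. ennreal (f (Y i \<omega>))) \<partial>M)"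
    by (simp add: prod_ennreal nn)
  also have "\<dots> = (\<Prod>i<n. \<integral>\<^sup>+\<omega>. ennreal (f (Y i \<omega>)) \<partial>M)"
  proof (rule indep_vars_nn_integral)
    show "indep_vars (\<lambda>_. borel) (\<lambda>i \<omega>. ennreal (f (Y i \<omega>))) {..<n}"
      by (rule indep_vars_compose2[OF indep_vars_subset[OF indep]]) auto
  qed auto
  also have "\<dots> = (\<Prod>i<n. ennreal (LINT x|Q. f x))"
  proof (rule prod.cong[OF refl])
    fix i
    have "(\<integral>\<^sup>+\<omega>. ennreal (f (Y i \<omega>)) \<partial>M) = (\<integral>\<^sup>+x. ennreal (f x) \<partial>distr M borel (Y i))"
      by (subst nn_integral_distr) auto
    also have "\<dots> = ennreal (LINT x|Q. f x)"
      unfolding law by (rule nn_integral_eq_integral[OF int]) (simp add: nn)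
    finally show "(\<integral>\<^sup>+\<omega>. ennreal (f (Y i \<omega>)) \<partial>M) = ennreal (LINT x|Q. f x)" .
  qed
  also have "(\<Prod>i<n. ennreal (LINT x|Q. f x)) = ennreal ((LINT x|Q. f x) ^ n)"
    by (simp add: ennreal_power integral_nonneg_AE nn)
  finally show ?thesis .
qed

lemma nn_integral_tilt:
  assumes "0 \<le> c" "c > 0 \<or> x = 0"
  shows "(\<integral>\<^sup>+\<omega>. ennreal (exp (x * (s * S n \<omega>) - c * (s * V n \<omega>)\<^sup>2)) \<partial>M) = ennreal (tilt Q x c s ^ n)"
proof -
  have "exp (x * (s * S n \<omega>) - c * (s * V n \<omega>)\<^sup>2) = (\<Prod>i<n. exp (x * (s * Y i \<omega>) - c * (s * Y i \<omega>)\<^sup>2))" for \<omega>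
  proof -
    have "x * (s * S n \<omega>) - c * (s * V n \<omega>)\<^sup>2 = (\<Sum>i<n. x * (s * Y i \<omega>) - c * (s * Y i \<omega>)\<^sup>2)"
      by (simp add: power_mult_distrib root_sum_sq_power2 sum_distrib_left sum_subtractf mult.assoc)
    then show ?thesis by (simp add: exp_sum)
  qed
  then show ?thesis
    unfolding tilt_def by (simp add: nn_integral_prod[OF _ _ L.integrable_tilt[OF assms]])
qed

lemma expectation_tilt:
  assumes "0 \<le> c" "c > 0 \<or> x = 0"
  shows "integrable M (\<lambda>\<omega>. exp (x * (s * S n \<omega>) - c * (s * V n \<omega>)\<^sup>2))"
    and "expectation (\<lambda>\<omega>. exp (x * (s * S n \<omega>) - c * (s * V n \<omega>)\<^sup>2)) = tilt Q x c s ^ n"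
proof -
  have "(\<lambda>\<omega>. exp (x * (s * S n \<omega>) - c * (s * V n \<omega>)\<^sup>2)) \<in> borel_measurable M" by measurable
  then have "has_bochner_integral M (\<lambda>\<omega>. exp (x * (s * S n \<omega>) - c * (s * V n \<omega>)\<^sup>2)) (tilt Q x c s ^ n)"
    using nn_integral_tilt[OF assms, of s n] L.tilt_nonneg[of x c s]
    by (intro has_bochner_integral_nn_integral) auto
  then show "integrable M (\<lambda>\<omega>. exp (x * (s * S n \<omega>) - c * (s * V n \<omega>)\<^sup>2))"
    "expectation (\<lambda>\<omega>. exp (x * (s * S n \<omega>) - c * (s * V n \<omega>)\<^sup>2)) = tilt Q x c s ^ n"
    by (auto simp: has_bochner_integral_iff)
qed

text \<open>The exponential \<open>E = exp (- (s * V)\<^sup>2)\<close> and its square have expectations that tend to \<open>exp (- 1)\<close> and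
  \<open>exp (- 2)\<close>. So \<open>E\<close> tends to \<open>exp (- 1)\<close> in mean square, and \<open>E\<close> determines \<open>s * V\<close>.\<close>

lemma V_law_of_large_numbers:
  assumes \<delta>: "0 < \<delta>" "\<delta> < 1"
  shows "(\<lambda>n. prob {\<omega> \<in> space M. \<delta> < \<bar>L.scale n * V n \<omega> - 1\<bar>}) \<longlonglongrightarrow> 0"
proof -
  let ?A = "\<lambda>n. {\<omega> \<in> space M. \<delta> < \<bar>L.scale n * V n \<omega> - 1\<bar>}"
  define E where "E n \<omega> = exp (- (L.scale n * V n \<omega>)\<^sup>2)" for n \<omega>
  define d where "d = min (exp (- 1) - exp (- ((1 + \<delta>)\<^sup>2))) (exp (- ((1 - \<delta>)\<^sup>2)) - exp (- 1 :: real))"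
  have "1 < (1 + \<delta>)\<^sup>2" "(1 - \<delta>)\<^sup>2 < 1"
    using \<delta> power_strict_mono[of 1 "1 + \<delta>" 2] power_strict_mono[of "1 - \<delta>" 1 2] by auto
  then have d: "d > 0" by (simp add: d_def)
  have E1: "integrable M (E n)" "expectation (E n) = tilt Q 0 1 (L.scale n) ^ n" for n
    using expectation_tilt[of 1 0 "L.scale n" n] by (simp_all add: E_def[abs_def])
  have sq: "(E n \<omega>)\<^sup>2 = exp (0 * (L.scale n * S n \<omega>) - 2 * (L.scale n * V n \<omega>)\<^sup>2)" for n \<omega>
    by (simp add: E_def power2_eq_square[of "exp _"] flip: exp_add)
  have E2: "integrable M (\<lambda>\<omega>. (E n \<omega>)\<^sup>2)" "expectation (\<lambda>\<omega>. (E n \<omega>)\<^sup>2) = tilt Q 0 2 (L.scale n) ^ n" for n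
    unfolding sq using expectation_tilt[of 2 0 "L.scale n" n] by simp_all
  have var: "expectation (\<lambda>\<omega>. (E n \<omega> - exp (- 1))\<^sup>2) =
      tilt Q 0 2 (L.scale n) ^ n - 2 * exp (- 1) * tilt Q 0 1 (L.scale n) ^ n + (exp (- 1))\<^sup>2"
    and intD: "integrable M (\<lambda>\<omega>. (E n \<omega> - exp (- 1))\<^sup>2)" for n
  proof -
    have eq: "(E n \<omega> - exp (- 1))\<^sup>2 = (E n \<omega>)\<^sup>2 - 2 * exp (- 1) * E n \<omega> + (exp (- 1))\<^sup>2" for \<omega>
      by (simp add: power2_diff)
    show "integrable M (\<lambda>\<omega>. (E n \<omega> - exp (- 1))\<^sup>2)"
      unfolding eq by (intro Bochner_Integration.integrable_add Bochner_Integration.integrable_diff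
          integrable_mult_right E1 E2 integrable_const)
    show "expectation (\<lambda>\<omega>. (E n \<omega> - exp (- 1))\<^sup>2) =
      tilt Q 0 2 (L.scale n) ^ n - 2 * exp (- 1) * tilt Q 0 1 (L.scale n) ^ n + (exp (- 1))\<^sup>2"
      unfolding eq
      by (subst Bochner_Integration.integral_add,
          (intro Bochner_Integration.integrable_diff integrable_mult_right E1 E2 integrable_const)+,
          subst Bochner_Integration.integral_diff, (intro integrable_mult_right E1 E2)+,
          simp add: E1(2) E2(2) prob_space)
  qed
  have "(\<lambda>n. tilt Q 0 2 (L.scale n) ^ n - 2 * exp (- 1) * tilt Q 0 1 (L.scale n) ^ n + (exp (- 1))\<^sup>2)
      \<longlonglongrightarrow> exp (0\<^sup>2 / 2 - 2) - 2 * exp (- 1) * exp (0\<^sup>2 / 2 - 1) + (exp (- 1))\<^sup>2"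
    by (intro tendsto_intros L.tilt_power_lim) auto
  also have "exp (0\<^sup>2 / 2 - 2) - 2 * exp (- 1) * exp (0\<^sup>2 / 2 - 1) + (exp (- 1))\<^sup>2 = (0::real)"
    by (simp add: power2_eq_square flip: exp_add)
  finally have "(\<lambda>n. expectation (\<lambda>\<omega>. (E n \<omega> - exp (- 1))\<^sup>2) / d\<^sup>2) \<longlonglongrightarrow> 0 / d\<^sup>2"
    unfolding var using d by (intro tendsto_intros) auto
  then have lim: "(\<lambda>n. expectation (\<lambda>\<omega>. (E n \<omega> - exp (- 1))\<^sup>2) / d\<^sup>2) \<longlonglongrightarrow> 0" by simp
  have dev: "d \<le> \<bar>E n \<omega> - exp (- 1)\<bar>" if "0 \<le> L.scale n" "\<delta> < \<bar>L.scale n * V n \<omega> - 1\<bar>" for n \<omega>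
  proof -
    have v: "0 \<le> L.scale n * V n \<omega>" using that root_sum_sq_nonneg[of Y n \<omega>] by simp
    have "1 + \<delta> < L.scale n * V n \<omega> \<or> L.scale n * V n \<omega> < 1 - \<delta>" using that(2) by linarith
    then show ?thesis
    proof
      assume "1 + \<delta> < L.scale n * V n \<omega>"
      then have "(1 + \<delta>)\<^sup>2 \<le> (L.scale n * V n \<omega>)\<^sup>2" using \<delta> by (intro power_mono) auto
      then have "E n \<omega> \<le> exp (- ((1 + \<delta>)\<^sup>2))" by (simp add: E_def)
      then show ?thesis unfolding d_def by linarith
    next
      assume "L.scale n * V n \<omega> < 1 - \<delta>"
      then have "(L.scale n * V n \<omega>)\<^sup>2 \<le> (1 - \<delta>)\<^sup>2" using v by (intro power_mono) auto
      then have "exp (- ((1 - \<delta>)\<^sup>2)) \<le> E n \<omega>" by (simp add: E_def)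
      then show ?thesis unfolding d_def by linarith
    qed
  qed
  have bound: "\<forall>\<^sub>F n in sequentially. prob (?A n) \<le> expectation (\<lambda>\<omega>. (E n \<omega> - exp (- 1))\<^sup>2) / d\<^sup>2"
    using L.eventually_scale
  proof eventually_elim
    case (elim n)
    have meas: "?A n \<in> sets M" by measurable
    have "d\<^sup>2 * prob (?A n) = expectation (\<lambda>\<omega>. d\<^sup>2 * indicator (?A n) \<omega>)"
      using meas by simp
    also have "\<dots> \<le> expectation (\<lambda>\<omega>. (E n \<omega> - exp (- 1))\<^sup>2)"
    proof (intro integral_mono intD)
      show "integrable M (\<lambda>\<omega>. d\<^sup>2 * indicator (?A n) \<omega>)"
        using meas by (intro integrable_mult_right integrable_real_indicator) (simp_all add: emeasure_eq_measure)
      fix \<omega>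
      show "d\<^sup>2 * indicator (?A n) \<omega> \<le> (E n \<omega> - exp (- 1))\<^sup>2"
      proof (cases "\<omega> \<in> ?A n")
        case True
        then have "d \<le> \<bar>E n \<omega> - exp (- 1)\<bar>" using elim by (intro dev) auto
        then have "d\<^sup>2 \<le> \<bar>E n \<omega> - exp (- 1)\<bar>\<^sup>2" using d by (intro power_mono) auto
        then show ?thesis using True by simp
      qed simp
    qed
    finally show ?case using d by (simp add: field_simps)
  qed
  show ?thesis
    by (rule tendsto_sandwich[OF _ bound tendsto_const lim]) simp
qed

end

section \<open>Exponential moments of the self-normalised sum\<close>

text \<open>The exponential at the rate \<open>x\<close> up to the truncation level \<open>1\<close>; each larger observation counts as one factor \<open>exp r\<close>.\<close>

definition trunc_exp :: "real \<Rightarrow> real \<Rightarrow> real \<Rightarrow> real" where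
  "trunc_exp r x y = exp (if \<bar>y\<bar> \<le> 1 then x * y else r)"

lemma trunc_exp_measurable [measurable]: "trunc_exp r x \<in> borel_measurable borel"
  unfolding trunc_exp_def by measurable

lemma trunc_exp_linear_bound: "\<exists>C. \<forall>y. \<bar>trunc_exp r x y - 1 - x * y\<bar> \<le> C * \<bar>y\<bar>"
proof -
  have "\<bar>trunc_exp r x y - 1 - x * y\<bar> \<le> (\<bar>x\<bar> * exp \<bar>x\<bar> + (exp r + 1) + \<bar>x\<bar>) * \<bar>y\<bar>" for y
  proof -
    have "\<bar>trunc_exp r x y - 1\<bar> \<le> (\<bar>x\<bar> * exp \<bar>x\<bar> + (exp r + 1)) * \<bar>y\<bar>"
    proof (cases "\<bar>y\<bar> \<le> 1")
      case True
      have "x * y \<le> \<bar>x\<bar> * \<bar>y\<bar>" unfolding abs_mult[symmetric] by (rule abs_ge_self)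
      also have "\<dots> \<le> \<bar>x\<bar> * 1" by (intro mult_left_mono True) auto
      finally have "\<bar>exp (x * y) - 1\<bar> \<le> \<bar>x * y\<bar> * exp \<bar>x\<bar>"
        by (intro abs_exp_minus_one_le) auto
      then have "\<bar>trunc_exp r x y - 1\<bar> \<le> \<bar>x\<bar> * exp \<bar>x\<bar> * \<bar>y\<bar>"
        using True by (simp add: trunc_exp_def abs_mult mult_ac)
      moreover have "0 \<le> (exp r + 1) * \<bar>y\<bar>" using exp_gt_zero[of r] by (intro mult_nonneg_nonneg) auto
      ultimately show ?thesis unfolding distrib_right[of "\<bar>x\<bar> * exp \<bar>x\<bar>"] by linarith
    next
      case False
      have "\<bar>exp r - 1\<bar> \<le> exp r + 1" using exp_gt_zero[of r] by linarith
      with False have "\<bar>trunc_exp r x y - 1\<bar> \<le> (exp r + 1) * 1"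
        by (simp add: trunc_exp_def)
      also have "\<dots> \<le> (exp r + 1) * \<bar>y\<bar>"
        using False exp_gt_zero[of r] by (intro mult_left_mono) auto
      moreover have "0 \<le> \<bar>x\<bar> * exp \<bar>x\<bar> * \<bar>y\<bar>" by simp
      ultimately show ?thesis unfolding distrib_right[of "\<bar>x\<bar> * exp \<bar>x\<bar>"] by linarith
    qed
    moreover have "\<bar>trunc_exp r x y - 1 - x * y\<bar> \<le> \<bar>trunc_exp r x y - 1\<bar> + \<bar>x\<bar> * \<bar>y\<bar>"
      unfolding abs_mult[symmetric] by (rule abs_triangle_ineq4)
    ultimately show ?thesis by (simp add: distrib_right)
  qed
  then show ?thesis by blast
qed

lemma trunc_exp_second_order:
  "((\<lambda>y. (trunc_exp r x y - 1 - x * y) / y\<^sup>2) \<longlongrightarrow> x\<^sup>2 / 2) (at 0)"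
proof -
  have "((\<lambda>y. (exp (x * y - 0 * y\<^sup>2) - 1 - x * y) / y\<^sup>2) \<longlongrightarrow> x\<^sup>2 / 2 - 0) (at (0::real))"
    by (rule exp_second_order)
  then have "((\<lambda>y. (exp (x * y) - 1 - x * y) / y\<^sup>2) \<longlongrightarrow> x\<^sup>2 / 2) (at (0::real))"
    by simp
  then show ?thesis
    by (rule Lim_transform_eventually)
      (auto simp: eventually_at trunc_exp_def dist_real_def intro!: exI[of _ 1])
qed

context centered_slowly_varying
begin

lemma trunc_var_power_growth:
  assumes triple: "\<And>s. 0 < s \<Longrightarrow> s \<le> s0 \<Longrightarrow> 3 * U s \<le> U (2 * s)"
    and s: "0 < s" "2 ^ k * s \<le> s0"
  shows "3 ^ k * U s \<le> U (2 ^ k * s)"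
  using s(2)
proof (induction k)
  case (Suc k)
  have "0 \<le> 2 ^ k * s" using s(1) by simp
  then have k: "2 ^ k * s \<le> s0" using Suc.prems by simp
  have "3 ^ Suc k * U s \<le> 3 * U (2 ^ k * s)" using Suc.IH[OF k] by simp
  also have "\<dots> \<le> U (2 * (2 ^ k * s))" using s(1) k by (intro triple) auto
  finally show ?case by (simp add: mult.assoc)
qed simp

lemma eventually_tilt_le:
  assumes "c > 0" "x\<^sup>2 - 2 * c < - b"
  shows "\<exists>s1>0. \<forall>s. 0 < s \<and> s \<le> s1 \<longrightarrow> tilt Q x c s \<le> 1 - b * U s"
proof -
  have "\<forall>\<^sub>F s in at_right 0. (tilt Q x c s - 1) / U s < - b"
    using tilt_asymp[OF assms(1)] assms(2) by (rule order_tendstoD)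
  then obtain d where d: "d > 0" "\<And>s. 0 < s \<Longrightarrow> s < d \<Longrightarrow> (tilt Q x c s - 1) / U s < - b"
    unfolding eventually_at_right_field by blast
  show ?thesis
  proof (intro exI[of _ "d / 2"] conjI allI impI)
    fix s assume s: "0 < s \<and> s \<le> d / 2"
    then have "(tilt Q x c s - 1) / U s < - b" using d by (intro d) auto
    then have "tilt Q x c s - 1 < - b * U s"
      using trunc_var_pos[of s] s by (simp add: pos_divide_less_eq)
    then show "tilt Q x c s \<le> 1 - b * U s" by simp
  qed (use d in simp)
qed

text \<open>A bound that depends neither on the index set nor on the weights; it uses only \<open>k \<le> 3 ^ k\<close>.\<close>

lemma dyadic_exp_sum:
  fixes w :: "nat \<Rightarrow> real"
  assumes "\<And>k. k \<in> I \<Longrightarrow> 3 ^ k * (1 / 2) \<le> w k" "finite I"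
  shows "(\<Sum>k\<in>I. exp (- w k)) \<le> 1 / (1 - exp (- 1 / 2 :: real))"
proof -
  have "(\<Sum>k\<in>I. exp (- w k)) \<le> (\<Sum>k\<in>I. exp (- 1 / 2 :: real) ^ k)"
  proof (rule sum_mono)
    fix k assume k: "k \<in> I"
    have "real k < 2 ^ k" by (rule of_nat_less_two_power)
    also have "(2::real) ^ k \<le> 3 ^ k" by (rule power_mono) auto
    finally have "real k \<le> 3 ^ k" by simp
    then have "real k * (1 / 2) \<le> w k" using assms(1)[OF k] by linarith
    then have "exp (- w k) \<le> exp (real k * (- 1 / 2))" by simp
    then show "exp (- w k) \<le> exp (- 1 / 2 :: real) ^ k" by (simp add: exp_of_nat_mult[symmetric])
  qed
  also have "\<dots> \<le> (\<Sum>k. exp (- 1 / 2 :: real) ^ k)"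
    using assms(2) by (intro sum_le_suminf summable_geometric) auto
  also have "\<dots> = 1 / (1 - exp (- 1 / 2 :: real))"
    by (intro suminf_geometric) auto
  finally show ?thesis .
qed

end

context iid_sample
begin

text \<open>If the normaliser is at least of the order \<open>1 / s\<close>, split the sum into small and large scaled
  observations. By the Cauchy-Schwarz inequality the large ones contribute to the quotient at most the root of
  their number, hence at most their number. The small ones contribute at most twice their scaled
  sum. Both bounds are additive over the observations, which leads to products.\<close>

lemma self_norm_trunc_bound:
  assumes r: "r \<ge> 0" and s: "s > 0" and sV: "1 / 2 \<le> s * V n \<omega>"
  shows "exp (r * T n \<omega>) \<le>
    (\<Prod>i<n. trunc_exp r (2 * r) (s * Y i \<omega>)) + (\<Prod>i<n. trunc_exp r (- 2 * r) (s * Y i \<omega>))"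
proof -
  define big where "big = {i \<in> {..<n}. 1 < \<bar>s * Y i \<omega>\<bar>}"
  define A where "A = (\<Sum>i<n. if \<bar>s * Y i \<omega>\<bar> \<le> 1 then s * Y i \<omega> else 0)"
  define B where "B = (\<Sum>i\<in>big. s * Y i \<omega>)"
  have fin: "finite big" by (simp add: big_def)
  have V: "V n \<omega> > 0" using sV s root_sum_sq_nonneg[of Y n \<omega>] by (cases "V n \<omega> = 0") auto
  have "s * S n \<omega> = (\<Sum>i<n. (if \<bar>s * Y i \<omega>\<bar> \<le> 1 then s * Y i \<omega> else 0) + (if 1 < \<bar>s * Y i \<omega>\<bar> then s * Y i \<omega> else 0))"
    unfolding sum_distrib_left by (intro sum.cong) auto
  also have "\<dots> = A + B"
    unfolding sum.distrib A_def B_def big_def by (subst sum.inter_filter) auto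
  finally have split: "s * S n \<omega> = A + B" .
  have "B\<^sup>2 = (\<Sum>i\<in>big. 1 * (s * Y i \<omega>))\<^sup>2" by (simp add: B_def)
  also have "\<dots> \<le> (\<Sum>i\<in>big. 1\<^sup>2) * (\<Sum>i\<in>big. (s * Y i \<omega>)\<^sup>2)" by (rule Cauchy_Schwarz_ineq_sum)
  also have "\<dots> \<le> real (card big) * (\<Sum>i<n. (s * Y i \<omega>)\<^sup>2)"
    unfolding big_def by (auto intro!: mult_left_mono sum_mono2)
  also have "(\<Sum>i<n. (s * Y i \<omega>)\<^sup>2) = (s * V n \<omega>)\<^sup>2"
    by (simp add: power_mult_distrib root_sum_sq_power2 sum_distrib_left)
  also have "real (card big) * (s * V n \<omega>)\<^sup>2 \<le> (real (card big))\<^sup>2 * (s * V n \<omega>)\<^sup>2"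
  proof (rule mult_right_mono)
    show "real (card big) \<le> (real (card big))\<^sup>2"
      by (cases "card big") (auto simp: power2_eq_square)
  qed simp
  finally have "B\<^sup>2 \<le> (real (card big) * (s * V n \<omega>))\<^sup>2" by (simp add: power_mult_distrib)
  then have B: "\<bar>B\<bar> \<le> real (card big) * (s * V n \<omega>)"
    using s V by (subst (asm) abs_le_square_iff[symmetric]) (simp add: abs_mult)
  have prod_eq: "exp (x * A + r * real (card big)) = (\<Prod>i<n. trunc_exp r x (s * Y i \<omega>))" for x
  proof -
    have "x * A + r * real (card big) = (\<Sum>i<n. if \<bar>s * Y i \<omega>\<bar> \<le> 1 then x * (s * Y i \<omega>) else r)"
    proof -
      have "r * real (card big) = (\<Sum>i<n. if 1 < \<bar>s * Y i \<omega>\<bar> then r else 0)"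
        unfolding big_def by (subst sum.inter_filter[symmetric]) auto
      moreover have "x * A = (\<Sum>i<n. if \<bar>s * Y i \<omega>\<bar> \<le> 1 then x * (s * Y i \<omega>) else 0)"
        unfolding A_def sum_distrib_left by (intro sum.cong) auto
      ultimately have "x * A + r * real (card big) =
          (\<Sum>i<n. (if \<bar>s * Y i \<omega>\<bar> \<le> 1 then x * (s * Y i \<omega>) else 0) + (if 1 < \<bar>s * Y i \<omega>\<bar> then r else 0))"
        by (simp add: sum.distrib)
      also have "\<dots> = (\<Sum>i<n. if \<bar>s * Y i \<omega>\<bar> \<le> 1 then x * (s * Y i \<omega>) else r)"
        by (intro sum.cong) auto
      finally show ?thesis .
    qed
    then show ?thesis by (simp add: exp_sum trunc_exp_def)
  qed
  have "T n \<omega> = \<bar>s * S n \<omega>\<bar> / (s * V n \<omega>)"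
    using V s by (simp add: self_norm_def abs_mult)
  also have "\<dots> \<le> (\<bar>A\<bar> + \<bar>B\<bar>) / (s * V n \<omega>)"
    unfolding split using s V by (intro divide_right_mono) auto
  also have "\<dots> = \<bar>A\<bar> / (s * V n \<omega>) + \<bar>B\<bar> / (s * V n \<omega>)" by (rule add_divide_distrib)
  also have "\<dots> \<le> 2 * \<bar>A\<bar> + real (card big)"
  proof (rule add_mono)
    have "\<bar>A\<bar> * 1 \<le> \<bar>A\<bar> * (2 * (s * V n \<omega>))" using sV by (intro mult_left_mono) auto
    then show "\<bar>A\<bar> / (s * V n \<omega>) \<le> 2 * \<bar>A\<bar>" using s V by (simp add: pos_divide_le_eq mult_ac)
    show "\<bar>B\<bar> / (s * V n \<omega>) \<le> real (card big)" using B s V by (simp add: pos_divide_le_eq)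
  qed
  finally have "r * T n \<omega> \<le> r * (2 * \<bar>A\<bar> + real (card big))"
    using r by (intro mult_left_mono)
  then have "exp (r * T n \<omega>) \<le> exp (2 * r * \<bar>A\<bar> + r * real (card big))"
    by (simp add: algebra_simps)
  also have "\<dots> \<le> exp (2 * r * A + r * real (card big)) + exp (- 2 * r * A + r * real (card big))"
    by (cases "A \<ge> 0") auto
  finally show ?thesis by (simp only: prod_eq)
qed

text \<open>If \<open>s * V\<close> lies in \<open>[1 / 2, 1)\<close>, the factor \<open>exp (c * (1 - (s * V)\<^sup>2))\<close> is at least \<open>1\<close>. Inserting
  it for a large \<open>c\<close> makes the expectation of the bound small if the typical \<open>V\<close> is much larger than \<open>1 / s\<close>.\<close>

lemma self_norm_tilt_bound:
  assumes r: "r \<ge> 0" and c: "c \<ge> 0" and sV: "1 / 2 \<le> s * V n \<omega>" "s * V n \<omega> < 1" and s: "s > 0"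
  shows "exp (r * T n \<omega>) \<le>
    exp c * (exp (2 * r * (s * S n \<omega>) - c * (s * V n \<omega>)\<^sup>2) + exp (- 2 * r * (s * S n \<omega>) - c * (s * V n \<omega>)\<^sup>2))"
proof -
  have V: "V n \<omega> > 0" using sV s root_sum_sq_nonneg[of Y n \<omega>] by (cases "V n \<omega> = 0") auto
  have "T n \<omega> = \<bar>s * S n \<omega>\<bar> / (s * V n \<omega>)"
    using V s by (simp add: self_norm_def abs_mult)
  also have "\<dots> \<le> 2 * \<bar>s * S n \<omega>\<bar>"
  proof -
    have "\<bar>s * S n \<omega>\<bar> * 1 \<le> \<bar>s * S n \<omega>\<bar> * (2 * (s * V n \<omega>))" using sV by (intro mult_left_mono) auto
    then show ?thesis using s V by (simp add: pos_divide_le_eq mult_ac)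
  qed
  finally have 1: "r * T n \<omega> \<le> r * (2 * \<bar>s * S n \<omega>\<bar>)" using r by (intro mult_left_mono)
  have "(s * V n \<omega>)\<^sup>2 \<le> 1" using sV by (intro power_le_one) auto
  then have "c * (s * V n \<omega>)\<^sup>2 \<le> c * 1" using c by (intro mult_left_mono)
  then have "r * T n \<omega> \<le> c + (2 * r * \<bar>s * S n \<omega>\<bar> - c * (s * V n \<omega>)\<^sup>2)" using 1 by simp
  then have "exp (r * T n \<omega>) \<le> exp c * exp (2 * r * \<bar>s * S n \<omega>\<bar> - c * (s * V n \<omega>)\<^sup>2)"
    by (simp flip: exp_add)
  also have "\<dots> \<le> exp c * (exp (2 * r * (s * S n \<omega>) - c * (s * V n \<omega>)\<^sup>2) + exp (- 2 * r * (s * S n \<omega>) - c * (s * V n \<omega>)\<^sup>2))"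
  proof (rule mult_left_mono)
    show "exp (2 * r * \<bar>s * S n \<omega>\<bar> - c * (s * V n \<omega>)\<^sup>2) \<le>
        exp (2 * r * (s * S n \<omega>) - c * (s * V n \<omega>)\<^sup>2) + exp (- 2 * r * (s * S n \<omega>) - c * (s * V n \<omega>)\<^sup>2)"
      by (cases "s * S n \<omega> \<ge> 0") (simp_all add: abs_of_nonneg abs_of_neg not_le less_imp_le)
  qed simp
  finally show ?thesis .
qed

lemma dyadic_scale:
  assumes v: "0 < v" "v < 1 / (2::real)"
  obtains k :: nat where "1 / 2 \<le> 2 ^ k * v" "2 ^ k * v < 1"
proof -
  obtain m :: nat where m: "1 / 2 / v < 2 ^ m"
    using real_arch_pow[of 2 "1 / 2 / v"] by auto
  define k where "k = (LEAST m. 1 / 2 \<le> 2 ^ m * v)"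
  have "1 / 2 \<le> 2 ^ m * v" using m v by (simp add: pos_divide_less_eq)
  then have k: "1 / 2 \<le> 2 ^ k * v" unfolding k_def by (rule LeastI)
  then have "k \<noteq> 0" using v by (cases k) auto
  then obtain j where j: "k = Suc j" by (cases k) auto
  then have "\<not> 1 / 2 \<le> 2 ^ j * v" unfolding k_def by (intro not_less_Least) (simp add: k_def[symmetric])
  then have "2 ^ k * v < 1" by (simp add: j)
  with k show ?thesis by (rule that)
qed

text \<open>Three ranges of \<open>V\<close> are treated separately. For \<open>V\<close> below the constant \<open>1 / s0\<close>, \<open>T \<le> sqrt n\<close> is weighed against a
  probability that is exponentially small in \<open>n\<close>. For \<open>V\<close> of at least half the typical order, lemma
  \<open>self_norm_trunc_bound\<close> applies. In between, \<open>V\<close> lies in a shell at scale \<open>\<sigma> = 2 ^ k * s\<close> for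
  some \<open>k\<close>. There lemma \<open>self_norm_tilt_bound\<close> gives an expectation of at most the order
  \<open>exp (- n * U \<sigma>)\<close>, where \<open>n * U \<sigma> \<ge> 3 ^ k / 2\<close> by slow variation.\<close>

theorem self_norm_exp_moment_bounded:
  assumes r: "r > 0"
  shows "\<exists>C. \<forall>\<^sub>F n in sequentially. (\<integral>\<^sup>+\<omega>. ennreal (exp (r * T n \<omega>)) \<partial>M) \<le> ennreal C"
proof -
  \<comment> \<open>then \<open>(2 * r)\<^sup>2 - 2 * c = - 2\<close>, so each observation contributes a factor of at most \<open>1 - U \<sigma>\<close>\<close>
  define c where "c = 2 * r\<^sup>2 + 1"
  have c: "c > 0" using r by (simp add: c_def add_nonneg_pos)
  have quad: "(2 * r)\<^sup>2 - 2 * c < - 1" "(- 2 * r)\<^sup>2 - 2 * c < - 1"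
    by (simp_all add: c_def power_mult_distrib)
  obtain s1 where s1: "s1 > 0" "\<And>s. 0 < s \<Longrightarrow> s \<le> s1 \<Longrightarrow> tilt Q (2 * r) c s \<le> 1 - 1 * L.U s"
    using L.eventually_tilt_le[OF c quad(1)] by blast
  obtain s2 where s2: "s2 > 0" "\<And>s. 0 < s \<Longrightarrow> s \<le> s2 \<Longrightarrow> tilt Q (- 2 * r) c s \<le> 1 - 1 * L.U s"
    using L.eventually_tilt_le[OF c quad(2)] by blast
  obtain s3 where s3: "s3 > 0" "\<And>s. 0 < s \<Longrightarrow> s \<le> s3 \<Longrightarrow> 3 * L.U s \<le> L.U (2 * s)"
    using L.eventually_trunc_var_triple by blast
  define s0 where "s0 = min s1 (min s2 s3)"
  have s0: "s0 > 0" "s0 \<le> s1" "s0 \<le> s2" "s0 \<le> s3" using s1 s2 s3 by (auto simp: s0_def)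
  define \<rho> where "\<rho> = tilt Q 0 (1 / 2) s0"
  have \<rho>: "\<rho> = 1 - L.U s0"
  proof -
    have "tilt Q 0 (1 / 2) s0 = (LINT z|Q. 1 - defect (s0 * z))"
      by (simp add: tilt_def defect_def)
    then show ?thesis
      unfolding \<rho>_def trunc_var_def
      by (simp add: Bochner_Integration.integral_diff L.prob_space[simplified])
  qed
  have U0: "L.U s0 > 0" by (rule L.trunc_var_pos[OF s0(1)])
  \<comment> \<open>the maximum over \<open>m\<close> of \<open>r * sqrt m - m * U s0\<close> is \<open>r\<^sup>2 / (4 * U s0)\<close>\<close>
  define C1 where "C1 = exp (1 + r\<^sup>2 / (4 * L.U s0))"
  define C2 where "C2 = 2 * (exp ((2 * r)\<^sup>2 / 2) + 1)"
  define C3 where "C3 = 2 * exp c * (1 / (1 - exp (- 1 / 2 :: real)))"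
  have small: "(\<integral>\<^sup>+\<omega>. ennreal (exp (1 + r * sqrt (real n)) * exp (0 * (s0 * S n \<omega>) - 1 / 2 * (s0 * V n \<omega>)\<^sup>2)) \<partial>M)
      \<le> ennreal C1" for n
  proof -
    have "\<rho> ^ n \<le> exp (- L.U s0) ^ n"
      using exp_ge_add_one_self[of "- L.U s0"] L.tilt_nonneg[of 0 "1/2" s0]
      by (intro power_mono) (simp_all add: \<rho> \<rho>_def[symmetric])
    also have "\<dots> = exp (- L.U s0 * (sqrt (real n))\<^sup>2)"
      by (simp add: exp_of_nat_mult[symmetric] mult.commute)
    finally have "exp (1 + r * sqrt (real n)) * \<rho> ^ n \<le>
        exp (1 + r * sqrt (real n)) * exp (- L.U s0 * (sqrt (real n))\<^sup>2)"
      by (intro mult_left_mono) auto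
    also have "\<dots> = exp (1 + (r * sqrt (real n) - L.U s0 * (sqrt (real n))\<^sup>2))"
      by (simp flip: exp_add)
    also have "\<dots> \<le> C1"
      unfolding C1_def using exponent_le[OF U0, of r "sqrt (real n)"] by simp
    finally have "exp (1 + r * sqrt (real n)) * \<rho> ^ n \<le> C1" .
    moreover have "(\<integral>\<^sup>+\<omega>. ennreal (exp (1 + r * sqrt (real n)) * exp (0 * (s0 * S n \<omega>) - 1 / 2 * (s0 * V n \<omega>)\<^sup>2)) \<partial>M)
        = ennreal (exp (1 + r * sqrt (real n))) * (\<integral>\<^sup>+\<omega>. ennreal (exp (0 * (s0 * S n \<omega>) - 1 / 2 * (s0 * V n \<omega>)\<^sup>2)) \<partial>M)"
      by (subst nn_integral_cmult[symmetric]) (simp_all add: ennreal_mult')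
    ultimately show ?thesis
      by (subst (asm) nn_integral_tilt) (auto intro!: ennreal_leI simp: \<rho>_def ennreal_mult'[symmetric])
  qed
  obtain D where D: "\<And>x y. x \<in> {2 * r, - 2 * r} \<Longrightarrow> \<bar>trunc_exp r x y - 1 - x * y\<bar> \<le> D x * \<bar>y\<bar>"
    using trunc_exp_linear_bound[of r] by metis
  have mid: "\<forall>\<^sub>F n in sequentially. (\<integral>\<^sup>+\<omega>. ennreal ((\<Prod>i<n. trunc_exp r x (L.scale n * Y i \<omega>))) \<partial>M) \<le> ennreal (C2 / 2)"
    if x: "x \<in> {2 * r, - 2 * r}" for x
  proof -
    have "(\<lambda>n. (LINT z|Q. trunc_exp r x (L.scale n * z)) ^ n) \<longlonglongrightarrow> exp (x\<^sup>2 / 2)"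
      by (rule L.expectation_power_lim[OF trunc_exp_measurable D[OF x] trunc_exp_second_order])
    then have "\<forall>\<^sub>F n in sequentially. (LINT z|Q. trunc_exp r x (L.scale n * z)) ^ n < exp (x\<^sup>2 / 2) + 1"
      by (rule order_tendstoD) simp
    then show ?thesis
    proof eventually_elim
      case (elim n)
      have "(\<integral>\<^sup>+\<omega>. ennreal ((\<Prod>i<n. trunc_exp r x (L.scale n * Y i \<omega>))) \<partial>M) =
          ennreal ((LINT z|Q. trunc_exp r x (L.scale n * z)) ^ n)"
        by (rule nn_integral_prod[where f = "\<lambda>z. trunc_exp r x (L.scale n * z)"])
          (simp_all add: trunc_exp_def[of _ _ "_ * _"] L.expectation_minus_linear(1)[OF trunc_exp_measurable D[OF x], unfolded trunc_exp_def])
      also have "\<dots> \<le> ennreal (C2 / 2)"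
        using elim x by (intro ennreal_leI) (auto simp: C2_def power_mult_distrib)
      finally show ?case .
    qed
  qed
  have "\<forall>\<^sub>F n in sequentially. (\<integral>\<^sup>+\<omega>. ennreal (exp (r * T n \<omega>)) \<partial>M) \<le> ennreal (C1 + C2 + C3)"
    using L.eventually_scale mid[of "2 * r", simplified] mid[of "- 2 * r", simplified]
  proof eventually_elim
    case (elim n)
    define s where "s = L.scale n"
    have s: "s > 0" "real n * L.U s = 1 / 2" using elim by (simp_all add: s_def)
    define I where "I = {k. 2 ^ k * s \<le> s0}"
    have finI: "finite I"
    proof -
      obtain m :: nat where m: "s0 / s < 2 ^ m" using real_arch_pow[of 2 "s0 / s"] by auto
      have "k < m" if "k \<in> I" for k
      proof (rule ccontr)
        assume "\<not> k < m"
        then have "(2::real) ^ m \<le> 2 ^ k" by (intro power_increasing) auto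
        then have "s0 / s < 2 ^ k" by (rule less_le_trans[OF m])
        then show False using that s by (simp add: I_def pos_divide_less_eq)
      qed
      then have "I \<subseteq> {..<m}" by auto
      then show ?thesis by (rule finite_subset) simp
    qed
    define G where "G x k \<omega> = exp (x * (2 ^ k * s * S n \<omega>) - c * (2 ^ k * s * V n \<omega>)\<^sup>2)" for x k \<omega>
    define F where "F k \<omega> = exp c * (G (2 * r) k \<omega> + G (- 2 * r) k \<omega>)" for k \<omega>
    have G: "(\<integral>\<^sup>+\<omega>. ennreal (G x k \<omega>) \<partial>M) \<le> ennreal (exp (- (real n * L.U (2 ^ k * s))))"
      if "k \<in> I" "x \<in> {2 * r, - 2 * r}" for x k
    proof -
      let ?\<sigma> = "2 ^ k * s"
      have \<sigma>: "0 < ?\<sigma>" "?\<sigma> \<le> s0" using that(1) s by (auto simp: I_def)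
      have "tilt Q x c ?\<sigma> \<le> 1 - 1 * L.U ?\<sigma>"
        using that(2) s1(2)[of ?\<sigma>] s2(2)[of ?\<sigma>] \<sigma> s0 by auto
      also have "\<dots> \<le> exp (- L.U ?\<sigma>)"
        using exp_ge_add_one_self[of "- L.U ?\<sigma>"] by simp
      finally have "tilt Q x c ?\<sigma> ^ n \<le> exp (- L.U ?\<sigma>) ^ n"
        by (intro power_mono L.tilt_nonneg)
      then show ?thesis
        unfolding G_def using c by (subst nn_integral_tilt) (auto intro!: ennreal_leI simp: exp_of_nat_mult[symmetric])
    qed
    let ?w = "\<lambda>k. real n * L.U (2 ^ k * s)"
    have sumG: "(\<integral>\<^sup>+\<omega>. (\<Sum>k\<in>I. ennreal (F k \<omega>)) \<partial>M) \<le> ennreal C3"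
    proof -
      have [measurable]: "G x k \<in> borel_measurable M" for x k unfolding G_def[abs_def] by measurable
      have Gpos: "0 \<le> G x k \<omega>" for x k \<omega> by (simp add: G_def)
      have "(\<integral>\<^sup>+\<omega>. (\<Sum>k\<in>I. ennreal (F k \<omega>)) \<partial>M) =
          (\<Sum>k\<in>I. (\<integral>\<^sup>+\<omega>. ennreal (exp c) * (ennreal (G (2 * r) k \<omega>) + ennreal (G (- 2 * r) k \<omega>)) \<partial>M))"
        unfolding F_def by (subst nn_integral_sum) (simp_all add: ennreal_mult' Gpos)
      also have "\<dots> = (\<Sum>k\<in>I. ennreal (exp c) * ((\<integral>\<^sup>+\<omega>. ennreal (G (2 * r) k \<omega>) \<partial>M) + (\<integral>\<^sup>+\<omega>. ennreal (G (- 2 * r) k \<omega>) \<partial>M)))"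
        by (simp add: nn_integral_cmult nn_integral_add)
      also have "\<dots> \<le> (\<Sum>k\<in>I. ennreal (exp c) * (ennreal (exp (- (?w k))) + ennreal (exp (- (?w k)))))"
        by (intro sum_mono mult_left_mono add_mono G) auto
      also have "\<dots> = (\<Sum>k\<in>I. ennreal (2 * exp c * exp (- (?w k))))"
        by (simp add: ennreal_mult'[symmetric] ennreal_plus[symmetric] mult_ac del: ennreal_plus)
      also have "\<dots> = ennreal (2 * exp c * (\<Sum>k\<in>I. exp (- (?w k))))"
        by (simp add: sum_ennreal sum_distrib_left)
      also have "\<dots> \<le> ennreal C3"
        unfolding C3_def
      proof (intro ennreal_leI mult_left_mono L.dyadic_exp_sum finI)
        fix k assume "k \<in> I"
        then have "3 ^ k * L.U s \<le> L.U (2 ^ k * s)"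
          using s0 s by (intro L.trunc_var_power_growth[of s3] s3(2)) (auto simp: I_def)
        then have "real n * (3 ^ k * L.U s) \<le> ?w k" by (rule mult_left_mono) simp
        then have "3 ^ k * (real n * L.U s) \<le> ?w k" by (simp only: mult.left_commute)
        then show "3 ^ k * (1 / 2) \<le> ?w k" by (simp only: s(2))
      qed simp
      finally show ?thesis .
    qed
    define a where "a \<omega> = exp (1 + r * sqrt (real n)) * exp (0 * (s0 * S n \<omega>) - 1 / 2 * (s0 * V n \<omega>)\<^sup>2)" for \<omega>
    define b where "b x \<omega> = (\<Prod>i<n. trunc_exp r x (s * Y i \<omega>))" for x \<omega>
    have apos: "0 \<le> a \<omega>" and bpos: "0 \<le> b x \<omega>" for x \<omega>
      by (simp_all add: a_def b_def trunc_exp_def prod_nonneg)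
    have [measurable]: "a \<in> borel_measurable M" "b x \<in> borel_measurable M" "F k \<in> borel_measurable M" for x k
      unfolding a_def[abs_def] b_def[abs_def] G_def[abs_def] F_def[abs_def] by measurable
    have "ennreal (exp (r * T n \<omega>)) \<le>
        ennreal (a \<omega>) + (ennreal (b (2 * r) \<omega>) + ennreal (b (- 2 * r) \<omega>)) +
        (\<Sum>k\<in>I. ennreal (F k \<omega>))" for \<omega>
    proof -
      let ?lhs = "exp (r * T n \<omega>)"
      consider (tiny) "s0 * V n \<omega> < 1" | (large) "1 / 2 \<le> s * V n \<omega>"
        | (dyadic) "1 \<le> s0 * V n \<omega>" "s * V n \<omega> < 1 / 2" by linarith
      then show ?thesis
      proof cases
        case tiny
        have "(s0 * V n \<omega>)\<^sup>2 \<le> 1"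
          using tiny s0 root_sum_sq_nonneg[of Y n \<omega>] by (intro power_le_one) auto
        moreover have "r * T n \<omega> \<le> r * sqrt (real n)"
          using r by (intro mult_left_mono self_norm_le) auto
        ultimately have "?lhs \<le> a \<omega>" by (simp add: a_def flip: exp_add)
        then have "ennreal ?lhs \<le> ennreal (a \<omega>)" by (rule ennreal_leI)
        then show ?thesis by (simp add: add_increasing2)
      next
        case large
        have "?lhs \<le> b (2 * r) \<omega> + b (- 2 * r) \<omega>"
          unfolding b_def using r s(1) large by (intro self_norm_trunc_bound) auto
        then have "ennreal ?lhs \<le> ennreal (b (2 * r) \<omega> + b (- 2 * r) \<omega>)" by (rule ennreal_leI)
        also have "\<dots> = ennreal (b (2 * r) \<omega>) + ennreal (b (- 2 * r) \<omega>)" by (simp add: bpos)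
        finally show ?thesis
          by (rule add_increasing2[OF zero_le add_increasing[OF zero_le]])
      next
        case dyadic
        have V: "0 < V n \<omega>" using dyadic(1) root_sum_sq_nonneg[of Y n \<omega>] by (cases "V n \<omega> = 0") auto
        obtain k where k: "1 / 2 \<le> 2 ^ k * (s * V n \<omega>)" "2 ^ k * (s * V n \<omega>) < 1"
          using dyadic_scale[of "s * V n \<omega>"] dyadic V s by auto
        have "(2 ^ k * s) * V n \<omega> < s0 * V n \<omega>" using k(2) dyadic(1) by (simp add: mult.assoc)
        then have kI: "k \<in> I" using V by (simp add: I_def)
        have "?lhs \<le> F k \<omega>"
          unfolding F_def G_def using k r c s(1) by (intro self_norm_tilt_bound) (auto simp: mult.assoc)
        then have "ennreal ?lhs \<le> ennreal (F k \<omega>)" by (rule ennreal_leI)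
        also have "\<dots> \<le> (\<Sum>k\<in>I. ennreal (F k \<omega>))"
          using kI finI by (intro member_le_sum) auto
        finally show ?thesis by (intro add_increasing) auto
      qed
    qed
    then have "(\<integral>\<^sup>+\<omega>. ennreal (exp (r * T n \<omega>)) \<partial>M) \<le>
        (\<integral>\<^sup>+\<omega>. ennreal (a \<omega>) + (ennreal (b (2 * r) \<omega>) + ennreal (b (- 2 * r) \<omega>)) +
        (\<Sum>k\<in>I. ennreal (F k \<omega>)) \<partial>M)"
      by (intro nn_integral_mono) simp
    also have "\<dots> = (\<integral>\<^sup>+\<omega>. ennreal (a \<omega>) \<partial>M) + ((\<integral>\<^sup>+\<omega>. ennreal (b (2 * r) \<omega>) \<partial>M) + (\<integral>\<^sup>+\<omega>. ennreal (b (- 2 * r) \<omega>) \<partial>M)) +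
        (\<integral>\<^sup>+\<omega>. (\<Sum>k\<in>I. ennreal (F k \<omega>)) \<partial>M)"
      by (simp add: nn_integral_add)
    also have "\<dots> \<le> ennreal C1 + (ennreal (C2 / 2) + ennreal (C2 / 2)) + ennreal C3"
      using elim(2,3) unfolding a_def b_def s_def[symmetric] 
      by (intro add_mono small sumG) (simp_all add: s_def)
    also have "\<dots> = ennreal (C1 + C2 + C3)"
    proof -
      have "0 \<le> C1" "0 \<le> C2" "0 \<le> C3" by (simp_all add: C1_def C2_def C3_def add_nonneg_nonneg)
      then show ?thesis by (simp add: ennreal_plus[symmetric] del: ennreal_plus)
    qed
    finally show ?case .
  qed
  then show ?thesis by blast
qed

end

section \<open>The expected mixture and the confidence intervals\<close>

lemma I_fun_minus:
  assumes "R > 0" "u > 0" shows "I_fun R (- y) u = I_fun R y u"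
  by (simp add: I_fun_cosh[OF assms])

lemma I_fun_isCont_width: "u > 0 \<Longrightarrow> isCont (\<lambda>R. I_fun R y u) R"
  unfolding I_fun_def
  by (intro continuous_intros isCont_o2[OF _ std_normal_cdf_isCont]) auto

lemma I_fun_measurable: "u > 0 \<Longrightarrow> (\<lambda>y. I_fun R y u) \<in> borel_measurable borel"
  by (intro borel_measurable_continuous_onI continuous_at_imp_continuous_on ballI I_fun_isCont)

context iid_sample
begin

abbreviation "tilted u \<theta> s n \<omega> \<equiv> exp (\<theta> * (s * S n \<omega>) - u * (\<theta> * (s * V n \<omega>))\<^sup>2)"

lemma nn_integral_tilt_scaled:
  assumes u: "u > 0"
  shows "(\<integral>\<^sup>+\<omega>. ennreal (tilted u \<theta> s n \<omega>) \<partial>M) = ennreal (tilt Q 1 u (\<theta> * s) ^ n)"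
  using nn_integral_tilt[of u 1 "\<theta> * s" n] u by (simp add: mult.assoc)

text \<open>The substitution \<open>x = \<theta> * (s * V)\<close> in the mixture integral removes the quotient. Where \<open>s * V\<close> is within \<open>\<delta>\<close> of \<open>1\<close>, the
  Jacobian is at most \<open>1 + \<delta>\<close> and the range of \<open>\<theta>\<close> is contained in a fixed interval.\<close>

lemma I_fun_near_bound:
  assumes R: "R > 0" and u: "u > 0" and \<delta>: "0 < \<delta>" "\<delta> < 1" and s: "s > 0"
    and near: "\<bar>s * V n \<omega> - 1\<bar> \<le> \<delta>"
  shows "ennreal (I_fun R (T n \<omega>) u) \<le> ennreal (1 + \<delta>) *
    (\<integral>\<^sup>+\<theta>. ennreal (tilted u \<theta> s n \<omega>) * indicator {- (R / (1 - \<delta>))..R / (1 - \<delta>)} \<theta> \<partial>lborel)"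
proof -
  define v where "v = s * V n \<omega>"
  define w where "w = s * S n \<omega>"
  have v: "1 - \<delta> \<le> v" "v \<le> 1 + \<delta>" "v > 0" using near \<delta> by (auto simp: v_def abs_le_iff)
  then have "V n \<omega> \<noteq> 0" by (auto simp: v_def)
  then have "T n \<omega> = \<bar>w\<bar> / v"
    using s by (simp add: self_norm_def v_def w_def abs_mult)
  then have "I_fun R (T n \<omega>) u = I_fun R (w / v) u"
    using I_fun_minus[OF R u, of "w / v"] by (cases "w \<ge> 0") simp_all
  then have "ennreal (I_fun R (T n \<omega>) u) =
      (\<integral>\<^sup>+x. ennreal (exp (x * (w / v) - u * x\<^sup>2)) * indicator {-R..R} x \<partial>lborel)"
    by (simp only: I_fun_nn_integral[OF R u])
  also have "\<dots> = ennreal \<bar>v\<bar> * (\<integral>\<^sup>+\<theta>. ennreal (exp ((0 + v * \<theta>) * (w / v) - u * (0 + v * \<theta>)\<^sup>2)) * indicator {-R..R} (0 + v * \<theta>) \<partial>lborel)"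
    using v by (intro nn_integral_real_affine) auto
  also have "\<dots> \<le> ennreal (1 + \<delta>) * (\<integral>\<^sup>+\<theta>. ennreal (exp (\<theta> * w - u * (\<theta> * v)\<^sup>2)) * indicator {- (R / (1 - \<delta>))..R / (1 - \<delta>)} \<theta> \<partial>lborel)"
  proof (rule mult_mono[OF _ nn_integral_mono])
    show "ennreal \<bar>v\<bar> \<le> ennreal (1 + \<delta>)" using v by (intro ennreal_leI) simp
    fix \<theta> :: real
    have "(0 + v * \<theta>) * (w / v) - u * (0 + v * \<theta>)\<^sup>2 = \<theta> * w - u * (\<theta> * v)\<^sup>2"
      using v(3) by (simp add: mult.commute)
    moreover have "indicator {-R..R} (0 + v * \<theta>) \<le> (indicator {- (R / (1 - \<delta>))..R / (1 - \<delta>)} \<theta> :: ennreal)"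
    proof (cases "0 + v * \<theta> \<in> {-R..R}")
      case True
      then have "\<bar>v * \<theta>\<bar> \<le> R" by (simp add: abs_le_iff)
      have "(1 - \<delta>) * \<bar>\<theta>\<bar> \<le> v * \<bar>\<theta>\<bar>" using v by (intro mult_right_mono) auto
      also have "\<dots> \<le> R" using \<open>\<bar>v * \<theta>\<bar> \<le> R\<close> v by (simp add: abs_mult)
      finally have "\<bar>\<theta>\<bar> \<le> R / (1 - \<delta>)" using \<delta> by (simp add: pos_le_divide_eq mult.commute)
      then have "\<theta> \<in> {- (R / (1 - \<delta>))..R / (1 - \<delta>)}" unfolding atLeastAtMost_iff by linarith
      then show ?thesis by (simp add: indicator_def)
    qed simp
    ultimately show "ennreal (exp ((0 + v * \<theta>) * (w / v) - u * (0 + v * \<theta>)\<^sup>2)) * indicator {-R..R} (0 + v * \<theta>) \<le>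
        ennreal (exp (\<theta> * w - u * (\<theta> * v)\<^sup>2)) * indicator {- (R / (1 - \<delta>))..R / (1 - \<delta>)} \<theta>"
      by (simp only: mult_left_mono[OF _ zero_le])
  qed auto
  finally show ?thesis by (simp only: v_def w_def)
qed

lemma tilt_scaled_limit:
  assumes u: "u > 0"
  shows "(\<lambda>n. tilt Q 1 u (\<theta> * L.scale n) ^ n) \<longlonglongrightarrow> exp (\<theta> * 0 - (u - 1 / 2) * \<theta>\<^sup>2)"
proof (cases "\<theta> = 0")
  case True
  then show ?thesis by (simp add: tilt_def L.prob_space[simplified])
next
  case False
  have "tilt Q 1 u (\<theta> * s) = tilt Q \<theta> (u * \<theta>\<^sup>2) s" for s
    unfolding tilt_def by (simp add: power_mult_distrib mult.assoc mult.left_commute)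
  moreover have "(\<lambda>n. tilt Q \<theta> (u * \<theta>\<^sup>2) (L.scale n) ^ n) \<longlonglongrightarrow> exp (\<theta>\<^sup>2 / 2 - u * \<theta>\<^sup>2)"
    using False u by (intro L.tilt_power_lim) auto
  moreover have "\<theta>\<^sup>2 / 2 - u * \<theta>\<^sup>2 = \<theta> * 0 - (u - 1 / 2) * \<theta>\<^sup>2" by (simp add: algebra_simps)
  ultimately show ?thesis by simp
qed

text \<open>The bound that dominates the integrand in \<open>\<theta>\<close>: since \<open>u > 1 / 2\<close>, the quadratic coefficient \<open>1 / 2 - u\<close> is
  negative, so the tilted expectation is at most \<open>1\<close> at all small scales of either sign.\<close>

lemma tilt_scaled_le_1:
  assumes u: "u > 1 / 2"
  shows "\<forall>\<^sub>F n in sequentially. \<forall>\<theta>. \<bar>\<theta>\<bar> \<le> B \<longrightarrow> tilt Q 1 u (\<theta> * L.scale n) \<le> 1"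
proof -
  obtain s1 where s1: "s1 > 0" "\<And>s. 0 < s \<Longrightarrow> s \<le> s1 \<Longrightarrow> tilt Q 1 u s \<le> 1 - 0 * L.U s"
    using L.eventually_tilt_le[of u 1 0] u by auto
  obtain s2 where s2: "s2 > 0" "\<And>s. 0 < s \<Longrightarrow> s \<le> s2 \<Longrightarrow> tilt Q (- 1) u s \<le> 1 - 0 * L.U s"
    using L.eventually_tilt_le[of u "- 1" 0] u by auto
  define b where "b = min s1 s2 / (\<bar>B\<bar> + 1)"
  have b: "b > 0" using s1 s2 by (simp add: b_def)
  have "\<forall>\<^sub>F n in sequentially. L.scale n < b"
    using L.scale_at_right b by (auto simp: filterlim_at intro: order_tendstoD(2))
  with L.eventually_scale show ?thesis
  proof eventually_elim
    case (elim n)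
    show ?case
    proof (intro allI impI)
      fix \<theta> :: real assume \<theta>: "\<bar>\<theta>\<bar> \<le> B"
      have "\<bar>\<theta>\<bar> * L.scale n \<le> (\<bar>B\<bar> + 1) * b" using \<theta> elim by (intro mult_mono) auto
      then have le: "\<bar>\<theta>\<bar> * L.scale n \<le> min s1 s2" by (simp add: b_def)
      have neg: "tilt Q 1 u (- s) = tilt Q (- 1) u s" for s by (simp add: tilt_def)
      show "tilt Q 1 u (\<theta> * L.scale n) \<le> 1"
      proof (cases \<theta> "0::real" rule: linorder_cases)
        case less
        then have "tilt Q (- 1) u (\<bar>\<theta>\<bar> * L.scale n) \<le> 1 - 0 * L.U (\<bar>\<theta>\<bar> * L.scale n)"
          using le elim by (intro s2(2) mult_pos_pos) auto
        then show ?thesis using less neg[of "\<bar>\<theta>\<bar> * L.scale n"] by simp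
      next
        case equal
        then show ?thesis by (simp add: tilt_def L.prob_space[simplified])
      next
        case greater
        then have "tilt Q 1 u (\<bar>\<theta>\<bar> * L.scale n) \<le> 1 - 0 * L.U (\<bar>\<theta>\<bar> * L.scale n)"
          using le elim by (intro s1(2) mult_pos_pos) auto
        then show ?thesis using greater by simp
      qed
    qed
  qed
qed

lemma mixture_limit:
  assumes u: "u > 1 / 2" and B: "B > 0"
  shows "(\<lambda>n. \<integral>\<^sup>+\<theta>. (\<integral>\<^sup>+\<omega>. ennreal (tilted u \<theta> (L.scale n) n \<omega>) \<partial>M) *
      indicator {-B..B} \<theta> \<partial>lborel) \<longlonglongrightarrow> ennreal (I_fun B 0 (u - 1 / 2))"
proof -
  obtain n0 where n0: "\<And>n \<theta>. n \<ge> n0 \<Longrightarrow> \<bar>\<theta>\<bar> \<le> B \<Longrightarrow> tilt Q 1 u (\<theta> * L.scale n) \<le> 1"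
    using tilt_scaled_le_1[OF u, of B] unfolding eventually_sequentially by blast
  define f where "f n \<theta> = (\<integral>\<^sup>+\<omega>. ennreal (tilted u \<theta> (L.scale n) n \<omega>) \<partial>M) *
      indicator {-B..B} \<theta>" for n \<theta>
  have f_eq: "f n \<theta> = ennreal (tilt Q 1 u (\<theta> * L.scale n) ^ n) * indicator {-B..B} \<theta>" for n \<theta>
    unfolding f_def using u by (subst nn_integral_tilt_scaled) auto
  have [measurable]: "f n \<in> borel_measurable lborel" for n
    unfolding f_def[abs_def] by measurable
  have "(\<lambda>n. \<integral>\<^sup>+\<theta>. f (n + n0) \<theta> \<partial>lborel) \<longlonglongrightarrow>
      (\<integral>\<^sup>+\<theta>. ennreal (exp (\<theta> * 0 - (u - 1 / 2) * \<theta>\<^sup>2)) * indicator {-B..B} \<theta> \<partial>lborel)"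
  proof (rule nn_integral_dominated_convergence[where w = "indicator {-B..B}"])
    show "AE \<theta> in lborel. f (n + n0) \<theta> \<le> indicator {-B..B} \<theta>" for n
    proof (rule AE_I2)
      fix \<theta>
      show "f (n + n0) \<theta> \<le> indicator {-B..B} \<theta>"
      proof (cases "\<theta> \<in> {-B..B}")
        case True
        then have "tilt Q 1 u (\<theta> * L.scale (n + n0)) ^ (n + n0) \<le> 1"
          by (intro power_le_one n0 L.tilt_nonneg) auto
        with True show ?thesis unfolding f_eq by simp
      qed (simp add: f_eq)
    qed
    show "(\<integral>\<^sup>+\<theta>. indicator {-B..B} \<theta> \<partial>lborel) < \<infinity>"
      using B by simp
    show "AE \<theta> in lborel. (\<lambda>n. f (n + n0) \<theta>) \<longlonglongrightarrow>
        ennreal (exp (\<theta> * 0 - (u - 1 / 2) * \<theta>\<^sup>2)) * indicator {-B..B} \<theta>"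
    proof (rule AE_I2)
      fix \<theta>
      have "(\<lambda>n. tilt Q 1 u (\<theta> * L.scale (n + n0)) ^ (n + n0)) \<longlonglongrightarrow> exp (\<theta> * 0 - (u - 1 / 2) * \<theta>\<^sup>2)"
        using u by (intro LIMSEQ_ignore_initial_segment tilt_scaled_limit) auto
      then have "(\<lambda>n. ennreal (tilt Q 1 u (\<theta> * L.scale (n + n0)) ^ (n + n0))) \<longlonglongrightarrow> ennreal (exp (\<theta> * 0 - (u - 1 / 2) * \<theta>\<^sup>2))"
        by (rule tendsto_ennrealI)
      then show "(\<lambda>n. f (n + n0) \<theta>) \<longlonglongrightarrow> ennreal (exp (\<theta> * 0 - (u - 1 / 2) * \<theta>\<^sup>2)) * indicator {-B..B} \<theta>"
        unfolding f_eq by (cases "\<theta> \<in> {-B..B}") simp_all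
    qed
  qed measurable
  also have "(\<integral>\<^sup>+\<theta>. ennreal (exp (\<theta> * 0 - (u - 1 / 2) * \<theta>\<^sup>2)) * indicator {-B..B} \<theta> \<partial>lborel) = ennreal (I_fun B 0 (u - 1 / 2))"
    using u B by (subst I_fun_nn_integral) auto
  finally show ?thesis unfolding f_def by (rule LIMSEQ_offset)
qed

lemma near_part_limit:
  assumes R: "R > 0" and u: "u > 1 / 2" and \<delta>: "0 < \<delta>" "\<delta> < 1" and e: "e > 0"
  shows "\<forall>\<^sub>F n in sequentially.
    (\<integral>\<^sup>+\<omega>. ennreal (I_fun R (T n \<omega>) u) * indicator {\<omega>. \<bar>L.scale n * V n \<omega> - 1\<bar> \<le> \<delta>} \<omega> \<partial>M)
      \<le> ennreal ((1 + \<delta>) * (I_fun (R / (1 - \<delta>)) 0 (u - 1 / 2) + e))"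
proof -
  define B where "B = R / (1 - \<delta>)"
  have B: "B > 0" using R \<delta> by (simp add: B_def)
  have IB: "0 \<le> I_fun B 0 (u - 1 / 2)" using B u by (intro I_fun_nonneg) auto
  interpret MP: pair_sigma_finite M lborel ..
  have "\<forall>\<^sub>F n in sequentially. (\<integral>\<^sup>+\<theta>. (\<integral>\<^sup>+\<omega>. ennreal (tilted u \<theta> (L.scale n) n \<omega>) \<partial>M) *
      indicator {-B..B} \<theta> \<partial>lborel) < ennreal (I_fun B 0 (u - 1 / 2) + e)"
    using mixture_limit[OF u B] e IB by (intro order_tendstoD(2)) (auto intro!: ennreal_lessI)
  with L.eventually_scale show ?thesis
  proof eventually_elim
    case (elim n)
    define s where "s = L.scale n"
    have s: "s > 0" using elim by (simp add: s_def)
    define g where "g \<omega> \<theta> = ennreal (tilted u \<theta> s n \<omega>) * indicator {-B..B} \<theta>" for \<omega> \<theta>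
    have gm [measurable]: "case_prod g \<in> borel_measurable (M \<Otimes>\<^sub>M lborel)"
      unfolding g_def[abs_def] by measurable
    have "(\<integral>\<^sup>+\<omega>. ennreal (I_fun R (T n \<omega>) u) * indicator {\<omega>. \<bar>s * V n \<omega> - 1\<bar> \<le> \<delta>} \<omega> \<partial>M) \<le>
        (\<integral>\<^sup>+\<omega>. ennreal (1 + \<delta>) * (\<integral>\<^sup>+\<theta>. g \<omega> \<theta> \<partial>lborel) \<partial>M)"
    proof (rule nn_integral_mono)
      fix \<omega>
      show "ennreal (I_fun R (T n \<omega>) u) * indicator {\<omega>. \<bar>s * V n \<omega> - 1\<bar> \<le> \<delta>} \<omega> \<le>
          ennreal (1 + \<delta>) * (\<integral>\<^sup>+\<theta>. g \<omega> \<theta> \<partial>lborel)"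
        using I_fun_near_bound[OF R _ \<delta> s, of u n \<omega>] u
        by (cases "\<bar>s * V n \<omega> - 1\<bar> \<le> \<delta>") (simp_all add: g_def B_def)
    qed
    also have "\<dots> = ennreal (1 + \<delta>) * (\<integral>\<^sup>+\<omega>. (\<integral>\<^sup>+\<theta>. g \<omega> \<theta> \<partial>lborel) \<partial>M)"
      by (rule nn_integral_cmult) measurable
    also have "(\<integral>\<^sup>+\<omega>. (\<integral>\<^sup>+\<theta>. g \<omega> \<theta> \<partial>lborel) \<partial>M) = (\<integral>\<^sup>+\<theta>. (\<integral>\<^sup>+\<omega>. g \<omega> \<theta> \<partial>M) \<partial>lborel)"
      by (rule MP.Fubini'[OF gm, symmetric])
    also have "\<dots> = (\<integral>\<^sup>+\<theta>. (\<integral>\<^sup>+\<omega>. ennreal (tilted u \<theta> s n \<omega>) \<partial>M) * indicator {-B..B} \<theta> \<partial>lborel)"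
      unfolding g_def by (intro nn_integral_cong nn_integral_multc) measurable
    also have "ennreal (1 + \<delta>) * \<dots> \<le> ennreal (1 + \<delta>) * ennreal (I_fun B 0 (u - 1 / 2) + e)"
      using elim by (intro mult_left_mono) (auto simp: s_def)
    also have "\<dots> = ennreal ((1 + \<delta>) * (I_fun B 0 (u - 1 / 2) + e))"
      using \<delta> by (simp add: ennreal_mult')
    finally show ?case by (simp add: s_def B_def)
  qed
qed

text \<open>The elementary inequality \<open>a \<le> \<eta> * a\<^sup>2 + 1 / \<eta>\<close>, applied to \<open>a = exp (R * T)\<close>, trades the exponential moment at \<open>2 * R\<close> against the
  probability of the event.\<close>

lemma far_part_small:
  assumes R: "R > 0" and u: "u > 0" and \<delta>: "0 < \<delta>" "\<delta> < 1" and e: "e > 0"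
  shows "\<forall>\<^sub>F n in sequentially.
    (\<integral>\<^sup>+\<omega>. ennreal (I_fun R (T n \<omega>) u) * indicator {\<omega>. \<delta> < \<bar>L.scale n * V n \<omega> - 1\<bar>} \<omega> \<partial>M)
      \<le> ennreal e"
proof -
  obtain C where C: "\<forall>\<^sub>F n in sequentially. (\<integral>\<^sup>+\<omega>. ennreal (exp (2 * R * T n \<omega>)) \<partial>M) \<le> ennreal C"
    using self_norm_exp_moment_bounded[of "2 * R"] R by auto
  define D where "D = \<bar>C\<bar> + 1"
  have D: "D > 0" "C \<le> D" by (auto simp: D_def)
  \<comment> \<open>then each of the two summands of the final bound is \<open>e / 2\<close>\<close>
  define \<eta> where "\<eta> = e / (4 * R * D)"
  have \<eta>: "\<eta> > 0" using e R D by (simp add: \<eta>_def)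
  have "\<forall>\<^sub>F n in sequentially. prob {\<omega> \<in> space M. \<delta> < \<bar>L.scale n * V n \<omega> - 1\<bar>} < \<eta> * e / (4 * R)"
    using V_law_of_large_numbers[OF \<delta>] by (rule order_tendstoD) (use \<eta> e R in simp)
  with C show ?thesis
  proof eventually_elim
    case (elim n)
    let ?A = "{\<omega> \<in> space M. \<delta> < \<bar>L.scale n * V n \<omega> - 1\<bar>}"
    have A [measurable]: "?A \<in> sets M" by measurable
    have "(\<integral>\<^sup>+\<omega>. ennreal (I_fun R (T n \<omega>) u) * indicator {\<omega>. \<delta> < \<bar>L.scale n * V n \<omega> - 1\<bar>} \<omega> \<partial>M) \<le>
        (\<integral>\<^sup>+\<omega>. ennreal (2 * R * \<eta>) * ennreal (exp (2 * R * T n \<omega>)) + ennreal (2 * R / \<eta>) * indicator ?A \<omega> \<partial>M)"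
    proof (rule nn_integral_mono)
      fix \<omega> assume \<omega>: "\<omega> \<in> space M"
      show "ennreal (I_fun R (T n \<omega>) u) * indicator {\<omega>. \<delta> < \<bar>L.scale n * V n \<omega> - 1\<bar>} \<omega> \<le>
          ennreal (2 * R * \<eta>) * ennreal (exp (2 * R * T n \<omega>)) + ennreal (2 * R / \<eta>) * indicator ?A \<omega>"
      proof (cases "\<omega> \<in> ?A")
        case True
        define a where "a = exp (R * T n \<omega>)"
        have a: "a > 0" by (simp add: a_def)
        have "a \<le> \<eta> * a\<^sup>2 + 1 / \<eta>"
        proof (cases "\<eta> * a \<le> 1")
          case True
          then have "a \<le> 1 / \<eta>" using \<eta> by (simp add: pos_le_divide_eq mult.commute)
          moreover have "0 \<le> \<eta> * a\<^sup>2" using \<eta> by simp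
          ultimately show ?thesis by simp
        next
          case False
          then have "1 * a \<le> \<eta> * a * a" using a by (intro mult_right_mono) auto
          moreover have "0 \<le> 1 / \<eta>" using \<eta> by simp
          ultimately show ?thesis
            unfolding power2_eq_square mult.assoc[symmetric] by linarith
        qed
        then have "2 * R * a \<le> 2 * R * (\<eta> * a\<^sup>2 + 1 / \<eta>)" using R by (intro mult_left_mono) auto
        moreover have "I_fun R (T n \<omega>) u \<le> 2 * R * a"
          unfolding a_def using R u by (intro I_fun_le_exp self_norm_nonneg)
        moreover have "a\<^sup>2 = exp (2 * R * T n \<omega>)"
          by (simp add: a_def power2_eq_square flip: exp_add)
        ultimately have "I_fun R (T n \<omega>) u \<le> 2 * R * \<eta> * exp (2 * R * T n \<omega>) + 2 * R / \<eta>"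
          by (simp add: algebra_simps)
        then have "ennreal (I_fun R (T n \<omega>) u) \<le> ennreal (2 * R * \<eta> * exp (2 * R * T n \<omega>) + 2 * R / \<eta>)"
          by (rule ennreal_leI)
        also have "\<dots> = ennreal (2 * R * \<eta>) * ennreal (exp (2 * R * T n \<omega>)) + ennreal (2 * R / \<eta>)"
          using R \<eta> by (simp add: ennreal_plus ennreal_mult')
        finally show ?thesis using True by simp
      next
        case False
        then have "\<not> \<delta> < \<bar>L.scale n * V n \<omega> - 1\<bar>" using \<omega> by simp
        then show ?thesis by simp
      qed
    qed
    also have "\<dots> = ennreal (2 * R * \<eta>) * (\<integral>\<^sup>+\<omega>. ennreal (exp (2 * R * T n \<omega>)) \<partial>M) + ennreal (2 * R / \<eta>) * emeasure M ?A"
      by (subst nn_integral_add) (simp_all add: nn_integral_cmult nn_integral_cmult_indicator)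
    also have "\<dots> \<le> ennreal (2 * R * \<eta>) * ennreal D + ennreal (2 * R / \<eta>) * ennreal (\<eta> * e / (4 * R))"
    proof (intro add_mono mult_left_mono)
      show "(\<integral>\<^sup>+\<omega>. ennreal (exp (2 * R * T n \<omega>)) \<partial>M) \<le> ennreal D"
        using elim(1) ennreal_leI[OF D(2)] by (rule order_trans)
      show "emeasure M ?A \<le> ennreal (\<eta> * e / (4 * R))"
        unfolding emeasure_eq_measure using elim(2) by (intro ennreal_leI) simp
    qed auto
    also have "\<dots> = ennreal (2 * R * \<eta> * D + 2 * R / \<eta> * (\<eta> * e / (4 * R)))"
      using R \<eta> D e by (simp add: ennreal_plus[symmetric] ennreal_mult'[symmetric] del: ennreal_plus)
    also have "2 * R * \<eta> * D + 2 * R / \<eta> * (\<eta> * e / (4 * R)) = e"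
      using R \<eta> D e by (simp add: \<eta>_def field_simps)
    finally show ?case .
  qed
qed

text \<open>The part near \<open>s * V = 1\<close> gives the constant up to a factor that tends to \<open>1\<close> with \<open>\<delta>\<close>, by continuity in
  the width \<open>R\<close>; the other part vanishes.\<close>

theorem mixture_expectation_le:
  assumes R: "R > 0" and u: "u > 1 / 2" and e: "e > 0"
  shows "\<forall>\<^sub>F n in sequentially.
    (\<integral>\<^sup>+\<omega>. ennreal (I_fun R (T n \<omega>) u) \<partial>M) \<le> ennreal (I_fun R 0 (u - 1 / 2) + e)"
proof -
  let ?Z = "\<lambda>R. I_fun R 0 (u - 1 / 2)"
  have cont: "((\<lambda>\<delta>. ?Z (R / (1 - \<delta>))) \<longlongrightarrow> ?Z R) (at_right 0)"
  proof (rule isCont_tendsto_compose[where g = ?Z])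
    show "isCont ?Z R" using u by (intro I_fun_isCont_width) auto
    have "((\<lambda>\<delta>::real. R / (1 - \<delta>)) \<longlongrightarrow> R / (1 - 0)) (at_right 0)" by (intro tendsto_intros) auto
    then show "((\<lambda>\<delta>::real. R / (1 - \<delta>)) \<longlongrightarrow> R) (at_right 0)" by simp
  qed
  have "((\<lambda>\<delta>. (1 + \<delta>) * (?Z (R / (1 - \<delta>)) + \<delta>)) \<longlongrightarrow> (1 + 0) * (?Z R + 0)) (at_right 0)"
    by (intro tendsto_intros cont)
  then have "\<forall>\<^sub>F \<delta> in at_right 0. (1 + \<delta>) * (?Z (R / (1 - \<delta>)) + \<delta>) < ?Z R + e / 2"
    using e by (intro order_tendstoD(2)) auto
  moreover have "\<forall>\<^sub>F \<delta>::real in at_right 0. \<delta> < 1"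
    by (intro order_tendstoD(2)[OF tendsto_ident_at]) simp
  ultimately have "\<forall>\<^sub>F \<delta> in at_right 0. (1 + \<delta>) * (?Z (R / (1 - \<delta>)) + \<delta>) < ?Z R + e / 2 \<and> \<delta> < 1 \<and> 0 < \<delta>"
    using eventually_at_right_less[of "0::real"] by eventually_elim simp
  then obtain \<delta> where \<delta>: "(1 + \<delta>) * (?Z (R / (1 - \<delta>)) + \<delta>) < ?Z R + e / 2" "\<delta> < 1" "0 < \<delta>"
    using eventually_happens[of _ "at_right (0::real)"] by auto
  have e2: "e / 2 > 0" using e by simp
  have u0: "u > 0" using u by simp
  have [measurable]: "(\<lambda>y. I_fun R y u) \<in> borel_measurable borel" by (rule I_fun_measurable[OF u0])
  from near_part_limit[OF R u \<delta>(3,2,3)] far_part_small[OF R u0 \<delta>(3,2) e2]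
  show ?thesis
  proof eventually_elim
    case (elim n)
    let ?f = "\<lambda>\<omega>. ennreal (I_fun R (T n \<omega>) u)"
    have "(\<integral>\<^sup>+\<omega>. ?f \<omega> \<partial>M) = (\<integral>\<^sup>+\<omega>. ?f \<omega> * indicator {\<omega>. \<bar>L.scale n * V n \<omega> - 1\<bar> \<le> \<delta>} \<omega> +
        ?f \<omega> * indicator {\<omega>. \<delta> < \<bar>L.scale n * V n \<omega> - 1\<bar>} \<omega> \<partial>M)"
      by (intro nn_integral_cong) (auto simp: indicator_def)
    also have "\<dots> = (\<integral>\<^sup>+\<omega>. ?f \<omega> * indicator {\<omega>. \<bar>L.scale n * V n \<omega> - 1\<bar> \<le> \<delta>} \<omega> \<partial>M) +
        (\<integral>\<^sup>+\<omega>. ?f \<omega> * indicator {\<omega>. \<delta> < \<bar>L.scale n * V n \<omega> - 1\<bar>} \<omega> \<partial>M)"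
      by (rule nn_integral_add) measurable
    also have "\<dots> \<le> ennreal ((1 + \<delta>) * (?Z (R / (1 - \<delta>)) + \<delta>)) + ennreal (e / 2)"
      using elim by (rule add_mono)
    also have "\<dots> \<le> ennreal (?Z R + e / 2) + ennreal (e / 2)"
      using \<delta>(1) by (intro add_right_mono ennreal_leI) simp
    also have "\<dots> = ennreal (?Z R + e)"
      using e I_fun_nonneg[OF R, of "u - 1 / 2" 0] u by (simp add: ennreal_plus[symmetric] del: ennreal_plus)
    finally show ?case .
  qed
qed

end

lemma iid_sample_centered:
  assumes P: "P \<in> DAN \<mu>" and iid: "iid_under M X P"
  shows "iid_sample (distr P borel (\<lambda>x. x - \<mu>)) M (\<lambda>i \<omega>. X i \<omega> - \<mu>)"
proof -
  interpret prob_space M using iid by (simp add: iid_under_def)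
  have ind: "indep_vars (\<lambda>_. borel) X UNIV" and law: "\<And>i. distr M borel (X i) = P"
    using iid by (auto simp: iid_under_def)
  have [measurable]: "X i \<in> borel_measurable M" for i
    using ind by (auto simp: indep_vars_def)
  interpret Q: centered_slowly_varying "distr P borel (\<lambda>x. x - \<mu>)"
    by (rule DAN_centered_slowly_varying[OF P])
  show ?thesis
  proof unfold_locales
    show "indep_vars (\<lambda>_. borel) (\<lambda>i \<omega>. X i \<omega> - \<mu>) UNIV"
      by (rule indep_vars_compose2[OF ind]) auto
    show "distr M borel (\<lambda>\<omega>. X i \<omega> - \<mu>) = distr P borel (\<lambda>x. x - \<mu>)" for i
      unfolding law[of i, symmetric] by (subst distr_distr) (auto simp: comp_def)
  qed
qed

theorem theorem3p6:
  fixes \<mu> R \<kappa> :: real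
    and M :: "real measure \<Rightarrow> 'a measure"
    and X :: "nat \<Rightarrow> 'a \<Rightarrow> real"
  assumes "R > 0" and "\<kappa> > 0"
    and "\<And>P. P \<in> DAN \<mu> \<Longrightarrow> iid_under (M P) X P"
  shows "asymptotic_post_hoc_ci M (DAN \<mu>) (H_mix_iwr X R \<kappa>) \<mu>"
proof -
  define u where "u = (\<kappa>\<^sup>2 + 1) / (2 * \<kappa>\<^sup>2)"
  define Z where "Z = Z_const R \<kappa>"
  have u_eq: "u - 1 / 2 = 1 / (2 * \<kappa>\<^sup>2)" using assms(2) by (simp add: u_def field_simps)
  then have u: "u > 1 / 2" using assms(2) by (metis diff_gt_0_iff_gt zero_less_divide_1_iff zero_less_mult_iff zero_less_numeral zero_less_power)
  then have u0: "u > 0" by simp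
  have Z_eq: "Z = I_fun R 0 (u - 1 / 2)" unfolding Z_def u_eq by (rule Z_const_eq_I_fun[OF assms(2)])
  have Z: "Z > 0" unfolding Z_eq using assms(1) u by (intro I_fun_pos) auto
  have [measurable]: "(\<lambda>y. I_fun R y u) \<in> borel_measurable borel" by (rule I_fun_measurable[OF u0])
  have loss: "post_hoc_loss (H_mix_iwr X R \<kappa>) \<mu> n \<omega> =
      ennreal (1 / Z) * ennreal (I_fun R (self_norm (\<lambda>i \<omega>. X i \<omega> - \<mu>) n \<omega>) u)" if "n \<ge> 1" for n \<omega>
    using post_hoc_loss_eq[OF assms(1,2) that, of X \<mu> \<omega>] Z
    unfolding u_def[symmetric] Z_def[symmetric] by (simp add: ennreal_mult'[symmetric])
  show ?thesis
    unfolding asymptotic_post_hoc_ci_def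
  proof (intro conjI ballI allI impI SUP_least)
    fix P and n :: nat assume P: "P \<in> DAN \<mu>" and n: "1 \<le> n"
    interpret iid_sample "distr P borel (\<lambda>x. x - \<mu>)" "M P" "\<lambda>i \<omega>. X i \<omega> - \<mu>"
      by (rule iid_sample_centered[OF P assms(3)[OF P]])
    show "post_hoc_loss (H_mix_iwr X R \<kappa>) \<mu> n \<in> borel_measurable (M P)"
      unfolding loss[OF n, abs_def] by measurable
  next
    fix P assume P: "P \<in> DAN \<mu>"
    interpret iid_sample "distr P borel (\<lambda>x. x - \<mu>)" "M P" "\<lambda>i \<omega>. X i \<omega> - \<mu>"
      by (rule iid_sample_centered[OF P assms(3)[OF P]])
    show "limsup (\<lambda>n. \<integral>\<^sup>+\<omega>. post_hoc_loss (H_mix_iwr X R \<kappa>) \<mu> n \<omega> \<partial>M P) \<le> 1"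
    proof (rule ennreal_le_epsilon)
      fix e :: real assume e: "0 < e"
      have "\<forall>\<^sub>F n in sequentially. (\<integral>\<^sup>+\<omega>. ennreal (I_fun R (self_norm (\<lambda>i \<omega>. X i \<omega> - \<mu>) n \<omega>) u) \<partial>M P) \<le> ennreal (Z + Z * e)"
        unfolding Z_eq using u e Z by (intro mixture_expectation_le assms(1)) (auto simp: Z_eq)
      then have "\<forall>\<^sub>F n in sequentially. (\<integral>\<^sup>+\<omega>. post_hoc_loss (H_mix_iwr X R \<kappa>) \<mu> n \<omega> \<partial>M P) \<le> 1 + ennreal e"
        using eventually_ge_at_top[of 1]
      proof eventually_elim
        case (elim n)
        have "(\<integral>\<^sup>+\<omega>. post_hoc_loss (H_mix_iwr X R \<kappa>) \<mu> n \<omega> \<partial>M P) =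
            ennreal (1 / Z) * (\<integral>\<^sup>+\<omega>. ennreal (I_fun R (self_norm (\<lambda>i \<omega>. X i \<omega> - \<mu>) n \<omega>) u) \<partial>M P)"
          unfolding loss[OF elim(2)] by (rule nn_integral_cmult) measurable
        also have "\<dots> \<le> ennreal (1 / Z) * ennreal (Z + Z * e)"
          using elim(1) by (rule mult_left_mono) simp
        also have "\<dots> = ennreal (1 + e)"
          using Z e by (simp add: ennreal_mult'[symmetric] field_simps)
        also have "\<dots> = 1 + ennreal e" using e by (simp add: ennreal_plus)
        finally show ?case .
      qed
      then show "limsup (\<lambda>n. \<integral>\<^sup>+\<omega>. post_hoc_loss (H_mix_iwr X R \<kappa>) \<mu> n \<omega> \<partial>M P) \<le> 1 + ennreal e"
        by (rule Limsup_bounded)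
    qed
  qed
qed

end
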